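(* Let $V$ be a left vector space over a division ring whose dimension is an infinite cardinal number $\alpha$. Let $\mathcal{G}$ be a Grassmannian of $V$, i.e. $\mathcal{G}=\mathcal{G}_{\beta}(V)$ or $\mathcal{G}=\mathcal{G}^{\beta}(V)$ for a certain cardinal number $\beta\le\alpha$. If $f$ is a bijective transformation of $\mathcal{G}$ such that $f$ and $f^{-1}$ send apartments of $\mathcal{G}$ to apartments of $\mathcal{G}$, then $f$ is induced by a semilinear automorphism of $V$, i.e. there is a semilinear automorphism $l:V\to V$ such that $f(X)=l(X)$ for every $X\in\mathcal{G}$.
   Context: For a cardinal number $\beta\le\alpha=\dim V$, $\mathcal{G}_{\beta}(V)$ denotes the set of all subspaces of $V$ of dimension $\beta$ and codimension $\alpha$, and $\mathcal{G}^{\beta}(V)$ denotes the set of all subspaces of $V$ of dimension $\alpha$ and codimension $\beta$; in particular $\mathcal{G}_{\alpha}(V)=\mathcal{G}^{\alpha}(V)$. For a basis $B$ of $V$, the apartment of $\mathcal{G}$ defined by $B$ is the set of all elements of $\mathcal{G}$ spanned by subsets of $B$; an apartment of $\mathcal{G}$ is a set of this form for some basis $B$. "$f$ sends apartments to apartments" means that $f(\mathcal{A})$ is an apartment for every apartment $\mathcal{A}$. A semilinear automorphism of $V$ is a bijection $l:V\to V$ such that $l(x+y)=l(x)+l(y)$ for all $x,y\in V$ and there is an automorphism $\sigma$ of the division ring with $l(ax)=\sigma(a)l(x)$ for all vectors $x$ and scalars $a$. *)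

theory Defs
  imports Complex_Main
begin

unbundle cardinal_syntax

text \<open>
  The library locales \<open>module\<close> and \<open>vector_space\<close> require commutative scalars, so left vector
  spaces over a division ring are introduced here.
\<close>

locale left_vector_space =
  fixes scale :: "'k::division_ring \<Rightarrow> 'v::ab_group_add \<Rightarrow> 'v"
  assumes scale_right_distrib: "scale a (x + y) = scale a x + scale a y"
    and scale_left_distrib: "scale (a + b) x = scale a x + scale b x"
    and scale_scale: "scale a (scale b x) = scale (a * b) x"
    and scale_one: "scale 1 x = x"

text \<open>
  Span, basis and dimension take the operations as explicit arguments, so that they apply both to
  subspaces of \<open>V\<close> and to quotients \<open>V/X\<close>, whose vectors are cosets.  They are meant for operations
  that make the carrier \<open>W\<close> a left vector space.
\<close>

definition closed_under_ops ::
    "('w \<Rightarrow> 'w \<Rightarrow> 'w) \<Rightarrow> 'w \<Rightarrow> ('k \<Rightarrow> 'w \<Rightarrow> 'w) \<Rightarrow> 'w set \<Rightarrow> bool" where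
  "closed_under_ops add zero scale S \<longleftrightarrow>
     zero \<in> S \<and> (\<forall>x\<in>S. \<forall>y\<in>S. add x y \<in> S) \<and> (\<forall>a. \<forall>x\<in>S. scale a x \<in> S)"

definition ops_span ::
    "('w \<Rightarrow> 'w \<Rightarrow> 'w) \<Rightarrow> 'w \<Rightarrow> ('k \<Rightarrow> 'w \<Rightarrow> 'w) \<Rightarrow> 'w set \<Rightarrow> 'w set" where
  "ops_span add zero scale S = closed_under_ops add zero scale hull S"

definition ops_basis ::
    "('w \<Rightarrow> 'w \<Rightarrow> 'w) \<Rightarrow> 'w \<Rightarrow> ('k \<Rightarrow> 'w \<Rightarrow> 'w) \<Rightarrow> 'w set \<Rightarrow> 'w set \<Rightarrow> bool" where
  "ops_basis add zero scale W B \<longleftrightarrow>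
     B \<subseteq> W \<and> (\<forall>b\<in>B. b \<notin> ops_span add zero scale (B - {b})) \<and> ops_span add zero scale B = W"

definition ops_dim ::
    "('w \<Rightarrow> 'w \<Rightarrow> 'w) \<Rightarrow> 'w \<Rightarrow> ('k \<Rightarrow> 'w \<Rightarrow> 'w) \<Rightarrow> 'w set \<Rightarrow> 'w rel" where
  "ops_dim add zero scale W = card_of (SOME B. ops_basis add zero scale W B)"

abbreviation lvs_subspace ::
    "('k::division_ring \<Rightarrow> 'v::ab_group_add \<Rightarrow> 'v) \<Rightarrow> 'v set \<Rightarrow> bool" where
  "lvs_subspace \<equiv> closed_under_ops (+) 0"

abbreviation lvs_span ::
    "('k::division_ring \<Rightarrow> 'v::ab_group_add \<Rightarrow> 'v) \<Rightarrow> 'v set \<Rightarrow> 'v set" where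
  "lvs_span \<equiv> ops_span (+) 0"

abbreviation lvs_basis ::
    "('k::division_ring \<Rightarrow> 'v::ab_group_add \<Rightarrow> 'v) \<Rightarrow> 'v set \<Rightarrow> bool" where
  "lvs_basis scale \<equiv> ops_basis (+) 0 scale UNIV"

abbreviation lvs_dim ::
    "('k::division_ring \<Rightarrow> 'v::ab_group_add \<Rightarrow> 'v) \<Rightarrow> 'v set \<Rightarrow> 'v rel" where
  "lvs_dim \<equiv> ops_dim (+) 0"

definition coset :: "'v::ab_group_add set \<Rightarrow> 'v \<Rightarrow> 'v set" where
  "coset X v = (+) v ` X"

definition coset_add :: "'v::ab_group_add set \<Rightarrow> 'v set \<Rightarrow> 'v set" where
  "coset_add C D = {c + d | c d. c \<in> C \<and> d \<in> D}"

text \<open>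
  The summand from \<open>X\<close> only matters for the scalar 0, where the product must be the whole zero
  coset \<open>X\<close>; see \<open>coset_scale_coset\<close> below.
\<close>

definition coset_scale ::
    "('k::division_ring \<Rightarrow> 'v::ab_group_add \<Rightarrow> 'v) \<Rightarrow> 'v set \<Rightarrow> 'k \<Rightarrow> 'v set \<Rightarrow> 'v set" where
  "coset_scale scale X a C = {scale a c + x | c x. c \<in> C \<and> x \<in> X}"

definition lvs_codim ::
    "('k::division_ring \<Rightarrow> 'v::ab_group_add \<Rightarrow> 'v) \<Rightarrow> 'v set \<Rightarrow> 'v set rel" where
  "lvs_codim scale X = ops_dim coset_add X (coset_scale scale X) (range (coset X))"

context left_vector_space
begin

lemma scale_zero_right [simp]: "scale a 0 = 0"
  using scale_right_distrib[of a 0 0] by simp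

lemma scale_zero_left [simp]: "scale 0 x = 0"
  using scale_left_distrib[of 0 0 x] by simp

lemma coset_zero: "coset X 0 = X"
  by (simp add: coset_def)

lemma coset_add_coset:
  assumes "lvs_subspace scale X"
  shows "coset_add (coset X u) (coset X v) = coset X (u + v)"
proof (intro equalityI subsetI)
  fix y assume "y \<in> coset_add (coset X u) (coset X v)"
  then obtain p q where pq: "p \<in> X" "q \<in> X" and y: "y = (u + p) + (v + q)"
    by (auto simp: coset_add_def coset_def)
  have "p + q \<in> X" using assms pq by (simp add: closed_under_ops_def)
  moreover have "y = (u + v) + (p + q)" by (simp add: y algebra_simps)
  ultimately show "y \<in> coset X (u + v)" by (simp add: coset_def)
next
  fix y assume "y \<in> coset X (u + v)"
  then obtain p where p: "p \<in> X" and y: "y = (u + v) + p" by (auto simp: coset_def)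
  have "y = (u + 0) + (v + p)" by (simp add: y algebra_simps)
  moreover have "0 \<in> X" using assms by (simp add: closed_under_ops_def)
  ultimately show "y \<in> coset_add (coset X u) (coset X v)"
    using p unfolding coset_add_def coset_def by blast
qed

lemma coset_scale_coset:
  assumes "lvs_subspace scale X"
  shows "coset_scale scale X a (coset X v) = coset X (scale a v)"
proof (intro equalityI subsetI)
  fix y assume "y \<in> coset_scale scale X a (coset X v)"
  then obtain p q where pq: "p \<in> X" "q \<in> X" and y: "y = scale a (v + p) + q"
    by (auto simp: coset_scale_def coset_def)
  have "scale a p + q \<in> X" using assms pq by (simp add: closed_under_ops_def)
  moreover have "y = scale a v + (scale a p + q)"
    by (simp add: y scale_right_distrib algebra_simps)
  ultimately show "y \<in> coset X (scale a v)" by (simp add: coset_def)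
next
  fix y assume "y \<in> coset X (scale a v)"
  then obtain p where p: "p \<in> X" and y: "y = scale a v + p" by (auto simp: coset_def)
  have "y = scale a (v + 0) + p" by (simp add: y)
  moreover have "0 \<in> X" using assms by (simp add: closed_under_ops_def)
  ultimately show "y \<in> coset_scale scale X a (coset X v)"
    using p unfolding coset_scale_def coset_def by blast
qed

end

text \<open>
  Cardinal numbers are cardinal orders, compared up to \<open>=o\<close>.  The first definition is
  \<open>G\<^sub>\<beta>(V)\<close>, the second \<open>G\<^sup>\<beta>(V)\<close>.
\<close>

definition grassmannian_dim ::
    "('k::division_ring \<Rightarrow> 'v::ab_group_add \<Rightarrow> 'v) \<Rightarrow> 'c rel \<Rightarrow> 'v set set" where
  "grassmannian_dim scale \<beta> =
     {X. lvs_subspace scale X \<and> lvs_dim scale X =o \<beta> \<and> lvs_codim scale X =o lvs_dim scale UNIV}"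

definition grassmannian_codim ::
    "('k::division_ring \<Rightarrow> 'v::ab_group_add \<Rightarrow> 'v) \<Rightarrow> 'c rel \<Rightarrow> 'v set set" where
  "grassmannian_codim scale \<beta> =
     {X. lvs_subspace scale X \<and> lvs_dim scale X =o lvs_dim scale UNIV \<and> lvs_codim scale X =o \<beta>}"

definition apartment_of ::
    "('k::division_ring \<Rightarrow> 'v::ab_group_add \<Rightarrow> 'v) \<Rightarrow> 'v set set \<Rightarrow> 'v set \<Rightarrow> 'v set set" where
  "apartment_of scale G B = {X \<in> G. \<exists>S\<subseteq>B. X = lvs_span scale S}"

definition is_apartment ::
    "('k::division_ring \<Rightarrow> 'v::ab_group_add \<Rightarrow> 'v) \<Rightarrow> 'v set set \<Rightarrow> 'v set set \<Rightarrow> bool" where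
  "is_apartment scale G A \<longleftrightarrow> (\<exists>B. lvs_basis scale B \<and> A = apartment_of scale G B)"

definition division_ring_automorphism :: "('k::division_ring \<Rightarrow> 'k) \<Rightarrow> bool" where
  "division_ring_automorphism \<sigma> \<longleftrightarrow>
     bij \<sigma> \<and> (\<forall>a b. \<sigma> (a + b) = \<sigma> a + \<sigma> b) \<and> (\<forall>a b. \<sigma> (a * b) = \<sigma> a * \<sigma> b) \<and> \<sigma> 1 = 1"

definition semilinear_automorphism ::
    "('k::division_ring \<Rightarrow> 'v::ab_group_add \<Rightarrow> 'v) \<Rightarrow> ('v \<Rightarrow> 'v) \<Rightarrow> bool" where
  "semilinear_automorphism scale l \<longleftrightarrow>
     bij l \<and> (\<forall>x y. l (x + y) = l x + l y) \<and>
     (\<exists>\<sigma>. division_ring_automorphism \<sigma> \<and> (\<forall>a x. l (scale a x) = scale (\<sigma> a) (l x)))"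

end

theory Submission
  imports Defs
begin

text \<open>
  For a basis \<open>B\<close> and distinct \<open>i, j \<in> B\<close> let \<open>C\<^bsub>ij\<^esub>\<close> be the set of those \<open>X\<close> in the apartment of
  \<open>B\<close> with \<open>i \<in> X\<close> and \<open>j \<notin> X\<close>. A subset of the apartment lies in a second apartment iff it
  misses some \<open>C\<^bsub>ij\<^esub>\<close> (replace \<open>i\<close> by \<open>i + j\<close>), so \<open>f\<close> maps the sets \<open>C\<^bsub>ij\<^esub>\<close> of one apartment to those of
  another. Their disjointness relation then yields a bijection \<open>\<delta>\<close> of the two bases with either
  \<open>b \<in> X \<longleftrightarrow> \<delta> b \<in> f X\<close> throughout the apartment, or \<open>b \<in> X \<longleftrightarrow> \<delta> b \<notin> f X\<close> throughout. The second
  case forces dimension and codimension to be \<open>\<alpha>\<close> and is refuted by the hyperplane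
  of coordinate sum zero, which contains no coordinate subspace of finite codimension.

  It remains to see that the line of \<open>\<delta> b\<close> depends on \<open>b\<close> only. If the codimension is \<open>\<alpha>\<close>, a basis of
  \<open>X \<ni> b\<close> containing \<open>b\<close> extends by elements of \<open>B\<close>, and two members of \<open>G\<close> spanned by \<open>b\<close> and such
  elements meet in the line of \<open>b\<close>. If the dimension is \<open>\<alpha>\<close>, the dual argument handles hyperplanes
  spanned by subsets of \<open>B\<close>, and the points follow because all members of an apartment through a
  basis vector meet in its line. The resulting map of points is a collineation, and the
  fundamental theorem of projective geometry applies.
\<close>

text \<open>If a subset of an apartment meets every \<open>Cset B i j\<close>, its members through
  \<open>i\<close> meet in the line of \<open>i\<close>, so it determines the basis up to scalars;
  hence the criterion for lying in a second apartment. In dimension or codimension one,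
  \<open>Cset B i j\<close> depends on one of its indices only, and members are matched with basis
  vectors directly. Replacing index sets by their complements permutes the sets
  \<open>Cset B i j\<close> when dimension and codimension agree, so no single apartment can exclude
  the reversing case: two apartments have to be compared. Infinite dimension also enters through
  splitting: a set of size \<alpha> contains three disjoint parts of size \<alpha>, so two members
  can meet in a prescribed line, or span a prescribed hyperplane, while the third part keeps
  codimension or dimension at \<alpha>. Small codimension cannot be reduced to small dimension by
  dualizing, since a space of infinite dimension is not reflexive; that case is handled inside
  \<open>V\<close> by changes of basis.\<close>

section \<open>Closure operators with exchange\<close>

lemma finite_ordLeq_infinite: "finite A \<Longrightarrow> infinite B \<Longrightarrow> |A| \<le>o |B|"
  using card_of_ordLeq_finite ordLeq_total[OF card_of_Well_order card_of_Well_order] by blast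

text \<open>A finitary closure with exchange, that is, a matroid of possibly infinite rank. It is
  instantiated by the span and, through \<open>relative\<close>, by the span modulo a
  subspace.\<close>

locale pregeometry =
  fixes cl :: "'a set \<Rightarrow> 'a set"
  assumes cl_ext: "A \<subseteq> cl A"
    and cl_mono: "A \<subseteq> B \<Longrightarrow> cl A \<subseteq> cl B"
    and cl_idem: "cl (cl A) = cl A"
    and cl_finite: "x \<in> cl A \<Longrightarrow> \<exists>F. finite F \<and> F \<subseteq> A \<and> x \<in> cl F"
    and cl_exchange: "x \<in> cl (insert y A) \<Longrightarrow> x \<notin> cl A \<Longrightarrow> y \<in> cl (insert x A)"
begin

definition indep :: "'a set \<Rightarrow> bool" where
  "indep A \<longleftrightarrow> (\<forall>a\<in>A. a \<notin> cl (A - {a}))"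

lemma cl_least: "A \<subseteq> cl B \<Longrightarrow> cl A \<subseteq> cl B"
  using cl_mono[of A "cl B"] by (simp add: cl_idem)

lemma in_cl: "x \<in> A \<Longrightarrow> x \<in> cl A"
  using cl_ext by blast

lemma indep_subset: "indep B \<Longrightarrow> A \<subseteq> B \<Longrightarrow> indep A"
  unfolding indep_def by (meson Diff_mono cl_mono order_refl subsetD)

lemma indep_insert:
  assumes "indep A" "a \<notin> cl A"
  shows "indep (insert a A)"
  unfolding indep_def
proof
  fix b assume b: "b \<in> insert a A"
  show "b \<notin> cl (insert a A - {b})"
  proof (cases "b = a")
    case True
    then show ?thesis using assms(2) cl_mono[of "insert a A - {b}" A] by auto
  next
    case False
    with b have bA: "b \<in> A" by simp
    have eq: "insert a A - {b} = insert a (A - {b})" using False by auto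
    have "b \<notin> cl (A - {b})" using assms(1) bA by (simp add: indep_def)
    then have "b \<in> cl (insert a (A - {b})) \<Longrightarrow> a \<in> cl (insert b (A - {b}))"
      by (rule cl_exchange[rotated])
    then show ?thesis using assms(2) eq bA by (auto simp: insert_absorb)
  qed
qed

lemma indepI_finite:
  assumes "\<And>F. finite F \<Longrightarrow> F \<subseteq> A \<Longrightarrow> indep F"
  shows "indep A"
  unfolding indep_def
proof (intro ballI notI)
  fix a assume a: "a \<in> A" "a \<in> cl (A - {a})"
  then obtain F where F: "finite F" "F \<subseteq> A - {a}" "a \<in> cl F" using cl_finite by blast
  have "indep (insert a F)" using F a by (intro assms) auto
  moreover have "insert a F - {a} = F" using F by auto
  ultimately show False using F(3) by (auto simp: indep_def)
qed

text \<open>Finite subsets suffice, so the elements of \<open>E\<close> are added one at a time. The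
  condition is placed on \<open>E\<close> so that a sheared basis can be checked on its moved
  vectors.\<close>

lemma indep_Un:
  assumes "indep A" "\<And>e. e \<in> E \<Longrightarrow> e \<notin> cl (A \<union> E - {e})"
  shows "indep (A \<union> E)"
proof (rule indepI_finite)
  fix F assume F: "finite F" "F \<subseteq> A \<union> E"
  have "indep (A \<union> D)" if "finite D" "D \<subseteq> E" for D
    using that
  proof (induction D rule: finite_induct)
    case empty
    then show ?case using assms(1) by simp
  next
    case (insert e D)
    show ?case
    proof (cases "e \<in> A")
      case True
      then show ?thesis using insert by (simp add: insert_absorb)
    next
      case False
      then have "A \<union> D \<subseteq> A \<union> E - {e}" using insert by auto
      then have "e \<notin> cl (A \<union> D)" using assms(2)[of e] insert.prems cl_mono by blast
      then show ?thesis using insert indep_insert by simp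
    qed
  qed
  from this[of "F \<inter> E"] have "indep (A \<union> F \<inter> E)" using F by simp
  then show "indep F" by (rule indep_subset) (use F in auto)
qed

text \<open>Zorn's lemma inside \<open>I \<union> C\<close>. That new elements come from
  \<open>C\<close> matters later, when a basis of a subspace is completed by vectors of a given
  basis.\<close>

lemma indep_extend:
  assumes "indep I"
  obtains J where "I \<subseteq> J" "J \<subseteq> I \<union> C" "indep J" "C \<subseteq> cl J"
proof -
  let ?P = "{J. I \<subseteq> J \<and> J \<subseteq> I \<union> C \<and> indep J}"
  have "\<exists>M\<in>?P. \<forall>X\<in>?P. M \<subseteq> X \<longrightarrow> X = M"
  proof (rule subset_Zorn_nonempty)
    show "?P \<noteq> {}" using assms by blast
    fix K assume K: "K \<noteq> {}" "subset.chain ?P K"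
    have "indep (\<Union>K)"
    proof (rule indepI_finite)
      fix F assume F: "finite F" "F \<subseteq> \<Union>K"
      obtain J where "J \<in> K" "F \<subseteq> J"
        using finite_subset_Union_chain[OF F K] by blast
      then show "indep F" using K(2) indep_subset by (auto simp: subset.chain_def)
    qed
    then show "\<Union>K \<in> ?P" using K by (auto simp: subset.chain_def)
  qed
  then obtain J where J: "J \<in> ?P" and mx: "\<forall>X\<in>?P. J \<subseteq> X \<longrightarrow> X = J" by (rule bexE)
  have "C \<subseteq> cl J"
  proof
    fix c assume c: "c \<in> C"
    show "c \<in> cl J"
    proof (rule ccontr)
      assume n: "c \<notin> cl J"
      then have "insert c J \<in> ?P" using J c indep_insert by auto
      then have "J \<subseteq> insert c J \<longrightarrow> insert c J = J" by (rule mx[THEN bspec])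
      then have "c \<in> J" by auto
      then show False using n in_cl by blast
    qed
  qed
  with J show ?thesis using that by blast
qed

text \<open>This replaces coordinates: \<open>x \<in> cl (B - {b})\<close> says that the
  \<open>b\<close>-coordinate of \<open>x\<close> is zero. Starting from a finite set that carries
  \<open>x\<close>, exchange removes the elements outside \<open>S\<close> one by one.\<close>

lemma cl_subset_iff:
  assumes "indep B" "S \<subseteq> B" "x \<in> cl B"
  shows "x \<in> cl S \<longleftrightarrow> (\<forall>b\<in>B - S. x \<in> cl (B - {b}))"
proof
  assume "x \<in> cl S"
  show "\<forall>b\<in>B - S. x \<in> cl (B - {b})"
  proof
    fix b assume "b \<in> B - S"
    then have "S \<subseteq> B - {b}" using assms(2) by auto
    then show "x \<in> cl (B - {b})" using \<open>x \<in> cl S\<close> cl_mono by blast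
  qed
next
  assume *: "\<forall>b\<in>B - S. x \<in> cl (B - {b})"
  obtain F where F: "finite F" "F \<subseteq> B" "x \<in> cl F" using cl_finite assms(3) by blast
  have "x \<in> cl (S \<union> (F - D))" if "finite D" "D \<subseteq> F" for D
    using that
  proof (induction D rule: finite_induct)
    case empty
    then show ?case using F cl_mono[of F "S \<union> F"] by auto
  next
    case (insert d D)
    then have IH: "x \<in> cl (S \<union> (F - D))" by blast
    show ?case
    proof (cases "d \<in> S")
      case True
      then have "S \<union> (F - insert d D) = S \<union> (F - D)" by auto
      then show ?thesis using IH by simp
    next
      case False
      let ?R = "S \<union> (F - insert d D)"
      have eq: "S \<union> (F - D) = insert d ?R" using insert False by auto
      have sub: "?R \<subseteq> B - {d}" using assms(2) F False by auto
      have dB: "d \<in> B" using insert F by auto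
      have xd: "x \<in> cl (B - {d})" using * dB False by blast
      show ?thesis
      proof (rule ccontr)
        assume "x \<notin> cl ?R"
        then have "d \<in> cl (insert x ?R)" using IH eq cl_exchange by metis
        moreover have "insert x ?R \<subseteq> cl (B - {d})" using sub xd cl_ext by blast
        ultimately have "d \<in> cl (B - {d})" using cl_least by blast
        then show False using assms(1) dB by (simp add: indep_def)
      qed
    qed
  qed
  from this[of F] show "x \<in> cl S" using F by simp
qed

lemma in_cl_indep_iff:
  assumes "indep B" "S \<subseteq> B" "b \<in> B"
  shows "b \<in> cl S \<longleftrightarrow> b \<in> S"
proof
  assume b: "b \<in> cl S"
  show "b \<in> S"
  proof (rule ccontr)
    assume "b \<notin> S"
    then have "S \<subseteq> B - {b}" using assms by auto
    then have "b \<in> cl (B - {b})" using b cl_mono by blast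
    then show False using assms by (simp add: indep_def)
  qed
qed (rule in_cl)

text \<open>When \<open>D\<close> is added element by element, there is a first \<open>d\<close> at
  which \<open>a\<close> enters the closure, and exchange applies to it.\<close>

lemma finite_exchange_step:
  assumes "finite D" "a \<notin> cl A" "a \<in> cl (A \<union> D)"
  shows "\<exists>d\<in>D. d \<notin> A \<and> d \<in> cl (insert a (A \<union> D - {d}))"
  using assms(1,3)
proof (induction D rule: finite_induct)
  case empty
  then show ?case using assms(2) by simp
next
  case (insert d D)
  show ?case
  proof (cases "a \<in> cl (A \<union> D)")
    case True
    then obtain x where x: "x \<in> D" "x \<notin> A" "x \<in> cl (insert a (A \<union> D - {x}))"
      using insert by blast
    have "insert a (A \<union> D - {x}) \<subseteq> insert a (A \<union> insert d D - {x})" by auto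
    then show ?thesis using x cl_mono by blast
  next
    case False
    have "a \<in> cl (insert d (A \<union> D))" using insert.prems by simp
    then have "d \<in> cl (insert a (A \<union> D))" using False by (rule cl_exchange)
    moreover have "d \<notin> A" using False insert.prems by (auto simp: insert_absorb)
    moreover have "A \<union> D \<subseteq> A \<union> insert d D - {d}" using insert \<open>d \<notin> A\<close> by auto
    then have "cl (insert a (A \<union> D)) \<subseteq> cl (insert a (A \<union> insert d D - {d}))"
      by (intro cl_mono) blast
    ultimately show ?thesis by blast
  qed
qed

text \<open>Steinitz exchange: an element of \<open>I\<close> replaces an element of
  \<open>J\<close> outside \<open>I\<close>, so the size of \<open>J\<close> stays the same while
  \<open>I - J\<close> shrinks.\<close>

lemma card_indep_le:
  assumes "finite I" "indep I" "finite J" "I \<subseteq> cl J"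
  shows "card I \<le> card J"
  using assms(3,4)
proof (induction "card (I - J)" arbitrary: J)
  case 0
  then have "I \<subseteq> J" using assms(1) by auto
  then show ?case using 0 by (simp add: card_mono)
next
  case (Suc n)
  then obtain a where a: "a \<in> I" "a \<notin> J"
    by (metis Diff_iff card.empty ex_in_conv nat.distinct(1))
  have "I \<inter> J \<subseteq> I - {a}" using a by auto
  then have "a \<notin> cl (I \<inter> J)" using a assms(2) cl_mono unfolding indep_def by blast
  moreover have IJ: "I \<inter> J \<union> (J - I) = J" by auto
  then have "a \<in> cl (I \<inter> J \<union> (J - I))" using a Suc.prems by auto
  ultimately obtain d where d: "d \<in> J - I" "d \<in> cl (insert a (I \<inter> J \<union> (J - I) - {d}))"
    using finite_exchange_step[of "J - I" a "I \<inter> J"] Suc.prems by auto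
  let ?J = "insert a (J - {d})"
  have "d \<in> cl ?J" using d by (simp add: IJ)
  then have "J \<subseteq> cl ?J" using cl_ext[of ?J] by blast
  then have "I \<subseteq> cl ?J" using Suc.prems cl_least by blast
  moreover have "I - ?J = (I - J) - {a}" using d by auto
  then have "n = card (I - ?J)" using Suc.hyps(2) a assms(1) by simp
  ultimately have "card I \<le> card ?J" using Suc.hyps(1)[of ?J] Suc.prems by simp
  also have "card ?J = card J" using a d Suc.prems card.remove[of J d] by simp
  finally show ?case .
qed

text \<open>For infinite \<open>J\<close>, each element of \<open>J\<close> needs only finitely many
  elements of \<open>I\<close>. These finite sets together already generate \<open>I\<close>, so by
  independence they exhaust it.\<close>

lemma indep_ordLeq:
  assumes "indep I" "I \<subseteq> cl J" "J \<subseteq> cl I"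
  shows "|I| \<le>o |J|"
proof (cases "finite J")
  case True
  have "finite I"
  proof (rule ccontr)
    assume "infinite I"
    then obtain F where F: "finite F" "card F = Suc (card J)" "F \<subseteq> I"
      using infinite_arbitrarily_large by blast
    have "card F \<le> card J" using F True assms by (intro card_indep_le indep_subset[OF assms(1)]) auto
    then show False using F by simp
  qed
  then show ?thesis using True assms card_indep_le[of I J] by (metis card_of_ordLeq card_le_inj)
next
  case False
  have "\<forall>j\<in>J. \<exists>F. finite F \<and> F \<subseteq> I \<and> j \<in> cl F" using assms(3) cl_finite by blast
  then obtain F where F: "\<And>j. j \<in> J \<Longrightarrow> finite (F j) \<and> F j \<subseteq> I \<and> j \<in> cl (F j)" by metis
  let ?U = "\<Union>j\<in>J. F j"
  have "J \<subseteq> cl ?U" using F cl_mono by (metis SUP_upper in_mono subsetI)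
  then have IU: "I \<subseteq> cl ?U" using assms(2) cl_least by blast
  have "I \<subseteq> ?U"
  proof
    fix i assume i: "i \<in> I"
    then show "i \<in> ?U" using IU in_cl_indep_iff[of I ?U i] assms(1) F by blast
  qed
  then have "|I| \<le>o |?U|" by (rule card_of_mono1)
  moreover have "|?U| \<le>o |J|"
  proof (rule card_of_UNION_ordLeq_infinite[OF False])
    show "\<forall>j\<in>J. |F j| \<le>o |J|"
      using F False finite_ordLeq_infinite by blast
  qed (use card_of_refl ordIso_imp_ordLeq in blast)
  ultimately show ?thesis using ordLeq_transitive by blast
qed

lemma indep_ordIso:
  assumes "indep I" "indep J" "I \<subseteq> cl J" "J \<subseteq> cl I"
  shows "|I| =o |J|"
  using assms indep_ordLeq ordIso_iff_ordLeq by blast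

text \<open>This is the closure in the quotient by \<open>cl X\<close>; codimension is computed with
  it.\<close>

lemma relative: "pregeometry (\<lambda>A. cl (X \<union> A))"
proof
  fix A B x y
  show "A \<subseteq> cl (X \<union> A)" using cl_ext by blast
  show "A \<subseteq> B \<Longrightarrow> cl (X \<union> A) \<subseteq> cl (X \<union> B)" by (rule cl_mono) blast
  show "cl (X \<union> cl (X \<union> A)) = cl (X \<union> A)"
  proof
    have "X \<union> cl (X \<union> A) \<subseteq> cl (X \<union> A)" using cl_ext by blast
    then show "cl (X \<union> cl (X \<union> A)) \<subseteq> cl (X \<union> A)" by (rule cl_least)
    show "cl (X \<union> A) \<subseteq> cl (X \<union> cl (X \<union> A))" using cl_mono cl_ext by (metis sup.cobounded2 cl_idem)
  qed
  show "\<exists>F. finite F \<and> F \<subseteq> A \<and> x \<in> cl (X \<union> F)" if x: "x \<in> cl (X \<union> A)"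
  proof -
    obtain F where F: "finite F" "F \<subseteq> X \<union> A" "x \<in> cl F" using x cl_finite by blast
    have "F \<subseteq> X \<union> (F \<inter> A)" using F by auto
    then have "x \<in> cl (X \<union> (F \<inter> A))" using F cl_mono by blast
    then show ?thesis using F by (intro exI[of _ "F \<inter> A"]) auto
  qed
  show "x \<in> cl (X \<union> insert y A) \<Longrightarrow> x \<notin> cl (X \<union> A) \<Longrightarrow> y \<in> cl (X \<union> insert x A)"
    using cl_exchange[of x y "X \<union> A"] by simp
qed

end

section \<open>Linear algebra over a division ring\<close>

context left_vector_space
begin

abbreviation sp :: "'v set \<Rightarrow> 'v set" ("\<langle>_\<rangle>") where
  "\<langle>S\<rangle> \<equiv> lvs_span scale S"

lemma sub_0: "lvs_subspace scale X \<Longrightarrow> 0 \<in> X"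
  and sub_add: "lvs_subspace scale X \<Longrightarrow> x \<in> X \<Longrightarrow> y \<in> X \<Longrightarrow> x + y \<in> X"
  and sub_scale: "lvs_subspace scale X \<Longrightarrow> x \<in> X \<Longrightarrow> scale a x \<in> X"
  by (auto simp: closed_under_ops_def)

lemma scale_minus_left: "scale (- a) x = - scale a x"
  using scale_left_distrib[of a "- a" x] by (simp add: minus_unique[symmetric])

lemma scale_minus_right: "scale a (- x) = - scale a x"
  using scale_right_distrib[of a x "- x"] by (simp add: minus_unique[symmetric])

lemma scale_diff_left: "scale (a - b) x = scale a x - scale b x"
  using scale_left_distrib[of a "- b" x] by (simp add: scale_minus_left)

lemma scale_diff_right: "scale a (x - y) = scale a x - scale a y"
  using scale_right_distrib[of a x "- y"] by (simp add: scale_minus_right)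

lemma scale_inverse: "a \<noteq> 0 \<Longrightarrow> scale (inverse a) (scale a x) = x"
  "a \<noteq> 0 \<Longrightarrow> scale a (scale (inverse a) x) = x"
  by (simp_all add: scale_scale scale_one)

lemma scale_eq_0_iff [simp]: "scale a x = 0 \<longleftrightarrow> a = 0 \<or> x = 0"
  by (metis scale_inverse(1) scale_zero_left scale_zero_right)

lemma sub_uminus: "lvs_subspace scale X \<Longrightarrow> x \<in> X \<Longrightarrow> - x \<in> X"
  using sub_scale[of X x "- 1"] by (simp add: scale_minus_left scale_one)

lemma sub_diff: "lvs_subspace scale X \<Longrightarrow> x \<in> X \<Longrightarrow> y \<in> X \<Longrightarrow> x - y \<in> X"
  using sub_add[of X x "- y"] sub_uminus by simp

lemma sub_scale_iff: "lvs_subspace scale X \<Longrightarrow> a \<noteq> 0 \<Longrightarrow> scale a x \<in> X \<longleftrightarrow> x \<in> X"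
  by (metis scale_inverse(1) sub_scale)

lemma span_sub: "lvs_subspace scale \<langle>S\<rangle>"
  unfolding ops_span_def by (rule hull_in) (auto simp: closed_under_ops_def)

lemma span_superset: "S \<subseteq> \<langle>S\<rangle>"
  unfolding ops_span_def by (rule hull_subset)

lemma span_mono: "S \<subseteq> T \<Longrightarrow> \<langle>S\<rangle> \<subseteq> \<langle>T\<rangle>"
  unfolding ops_span_def by (rule hull_mono)

lemma span_minimal: "lvs_subspace scale X \<Longrightarrow> S \<subseteq> X \<Longrightarrow> \<langle>S\<rangle> \<subseteq> X"
  unfolding ops_span_def by (rule hull_minimal)

lemma span_of_sub: "lvs_subspace scale X \<Longrightarrow> \<langle>X\<rangle> = X"
  using span_minimal span_superset by blast

lemma span_base: "x \<in> S \<Longrightarrow> x \<in> \<langle>S\<rangle>"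
  using span_superset by blast

lemmas span_0 [simp] = sub_0[OF span_sub]
lemmas span_add = sub_add[OF span_sub]
lemmas span_scale = sub_scale[OF span_sub]
lemmas span_diff = sub_diff[OF span_sub]
lemmas span_uminus = sub_uminus[OF span_sub]
lemmas span_scale_iff = sub_scale_iff[OF span_sub]

lemma span_empty [simp]: "\<langle>{}\<rangle> = {0}"
  using span_minimal[of "{0}" "{}"] span_0 by (auto simp: closed_under_ops_def)

lemma span_insert_iff: "x \<in> \<langle>insert a S\<rangle> \<longleftrightarrow> (\<exists>k. x - scale k a \<in> \<langle>S\<rangle>)"
proof
  let ?T = "{x. \<exists>k. x - scale k a \<in> \<langle>S\<rangle>}"
  have "lvs_subspace scale ?T"
    unfolding closed_under_ops_def
  proof (intro conjI ballI allI)
    show "0 \<in> ?T" using span_0[of S] by (auto intro!: exI[of _ 0])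
    fix x assume "x \<in> ?T"
    then obtain k where k: "x - scale k a \<in> \<langle>S\<rangle>" by auto
    {
      fix c
      have "scale c x - scale (c * k) a \<in> \<langle>S\<rangle>"
        using span_scale[OF k, of c] by (simp add: scale_diff_right scale_scale)
      then show "scale c x \<in> ?T" by blast
    }
    fix y assume "y \<in> ?T"
    then obtain m where m: "y - scale m a \<in> \<langle>S\<rangle>" by auto
    have "(x + y) - scale (k + m) a \<in> \<langle>S\<rangle>"
      using span_add[OF k m] by (simp add: scale_left_distrib algebra_simps)
    then show "x + y \<in> ?T" by blast
  qed
  moreover have "insert a S \<subseteq> ?T"
  proof
    fix y assume "y \<in> insert a S"
    then show "y \<in> ?T"
    proof
      assume "y = a"
      then show ?thesis using span_0[of S] by (auto simp: scale_one intro!: exI[of _ 1])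
    next
      assume "y \<in> S"
      then show ?thesis using span_base[of y S] by (auto intro!: exI[of _ 0])
    qed
  qed
  ultimately have "\<langle>insert a S\<rangle> \<subseteq> ?T" by (rule span_minimal)
  then show "x \<in> \<langle>insert a S\<rangle> \<Longrightarrow> \<exists>k. x - scale k a \<in> \<langle>S\<rangle>" by blast
next
  assume "\<exists>k. x - scale k a \<in> \<langle>S\<rangle>"
  then obtain k where "x - scale k a \<in> \<langle>S\<rangle>" by blast
  then have "x - scale k a \<in> \<langle>insert a S\<rangle>" using span_mono[of S "insert a S"] by blast
  moreover have "scale k a \<in> \<langle>insert a S\<rangle>" by (simp add: span_base span_scale)
  ultimately have "(x - scale k a) + scale k a \<in> \<langle>insert a S\<rangle>" by (rule span_add)
  then show "x \<in> \<langle>insert a S\<rangle>" by simp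
qed

lemma span_singleton: "x \<in> \<langle>{a}\<rangle> \<longleftrightarrow> (\<exists>k. x = scale k a)"
  using span_insert_iff[of x a "{}"] by simp

lemma span_pair: "x \<in> \<langle>{a, b}\<rangle> \<longleftrightarrow> (\<exists>k m. x = scale k a + scale m b)"
  using span_insert_iff[of x a "{b}"] by (auto simp: span_singleton algebra_simps)

lemma span_finite:
  assumes "x \<in> \<langle>A\<rangle>"
  shows "\<exists>F. finite F \<and> F \<subseteq> A \<and> x \<in> \<langle>F\<rangle>"
proof -
  let ?T = "{x. \<exists>F. finite F \<and> F \<subseteq> A \<and> x \<in> \<langle>F\<rangle>}"
  have "lvs_subspace scale ?T"
    unfolding closed_under_ops_def
  proof (intro conjI ballI allI)
    show "0 \<in> ?T" using span_0 by blast
    fix x assume "x \<in> ?T"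
    then obtain F where F: "finite F" "F \<subseteq> A" "x \<in> \<langle>F\<rangle>" by auto
    show "scale c x \<in> ?T" for c using F span_scale by blast
    fix y assume "y \<in> ?T"
    then obtain H where H: "finite H" "H \<subseteq> A" "y \<in> \<langle>H\<rangle>" by auto
    have "x \<in> \<langle>F \<union> H\<rangle>" "y \<in> \<langle>F \<union> H\<rangle>" using F H span_mono by blast+
    then have "x + y \<in> \<langle>F \<union> H\<rangle>" by (rule span_add)
    then show "x + y \<in> ?T" using F H by (metis (mono_tags, lifting) Un_least finite_UnI mem_Collect_eq)
  qed
  moreover have "A \<subseteq> ?T"
  proof
    fix a assume "a \<in> A"
    then show "a \<in> ?T" using span_base[of a "{a}"] by (auto intro!: exI[of _ "{a}"])
  qed
  ultimately show ?thesis using span_minimal[of ?T A] assms by blast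
qed

sublocale pregeometry "lvs_span scale"
proof
  show "\<langle>\<langle>A\<rangle>\<rangle> = \<langle>A\<rangle>" for A using span_of_sub span_sub by blast
  show "y \<in> \<langle>insert x A\<rangle>" if xy: "x \<in> \<langle>insert y A\<rangle>" "x \<notin> \<langle>A\<rangle>" for x y A
  proof -
    obtain k where k: "x - scale k y \<in> \<langle>A\<rangle>" using xy(1) span_insert_iff by blast
    have k0: "k \<noteq> 0" using k xy(2) by auto
    have "scale (- inverse k) (x - scale k y) \<in> \<langle>A\<rangle>" using k by (rule span_scale)
    also have "scale (- inverse k) (x - scale k y) = y - scale (inverse k) x"
      using k0 by (simp add: scale_diff_right scale_minus_left scale_inverse)
    finally show ?thesis using span_insert_iff by blast
  qed
qed (rule span_superset span_mono span_finite, assumption?)+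

lemma span_eqI: "A \<subseteq> \<langle>B\<rangle> \<Longrightarrow> B \<subseteq> \<langle>A\<rangle> \<Longrightarrow> \<langle>A\<rangle> = \<langle>B\<rangle>"
  using cl_least by blast

lemma ops_basis_iff: "ops_basis (+) 0 scale W B \<longleftrightarrow> indep B \<and> \<langle>B\<rangle> = W"
  using span_superset by (auto simp: ops_basis_def indep_def)

lemma obtain_basis:
  assumes "lvs_subspace scale W" "indep I" "I \<subseteq> W"
  obtains J where "I \<subseteq> J" "indep J" "\<langle>J\<rangle> = W"
proof -
  obtain J where J: "I \<subseteq> J" "J \<subseteq> I \<union> W" "indep J" "W \<subseteq> \<langle>J\<rangle>"
    using indep_extend[OF assms(2)] by blast
  have "\<langle>J\<rangle> \<subseteq> W" using J assms by (intro span_minimal) auto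
  then show ?thesis using J that by blast
qed

lemma indep_empty: "indep {}"
  by (simp add: indep_def)

lemma indep_singleton: "x \<noteq> 0 \<Longrightarrow> indep {x}"
  by (simp add: indep_def)

section \<open>Dimension and codimension of spans of basis vectors\<close>

lemma lvs_dim_span:
  assumes "indep S"
  shows "lvs_dim scale \<langle>S\<rangle> =o |S|"
proof -
  let ?B = "SOME B. ops_basis (+) 0 scale \<langle>S\<rangle> B"
  have "ops_basis (+) 0 scale \<langle>S\<rangle> ?B"
    by (rule someI[of _ S]) (simp add: ops_basis_iff assms)
  then have "indep ?B" "\<langle>?B\<rangle> = \<langle>S\<rangle>" by (simp_all add: ops_basis_iff)
  then show ?thesis unfolding ops_dim_def
    using assms span_superset by (intro indep_ordIso) blast+
qed

lemma coset_eq_iff: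
  assumes "lvs_subspace scale X"
  shows "coset X u = coset X v \<longleftrightarrow> u - v \<in> X"
proof
  assume "coset X u = coset X v"
  moreover have "u \<in> coset X u" using sub_0[OF assms] by (force simp: coset_def)
  ultimately obtain x where "x \<in> X" "u = v + x" by (auto simp: coset_def)
  then show "u - v \<in> X" by simp
next
  assume uv: "u - v \<in> X"
  have "coset X u \<subseteq> coset X v" if "u - v \<in> X" for u v
  proof
    fix y assume "y \<in> coset X u"
    then obtain x where x: "x \<in> X" "y = u + x" by (auto simp: coset_def)
    then have "y = v + ((u - v) + x)" by simp
    moreover have "(u - v) + x \<in> X" using assms that x sub_add by blast
    ultimately show "y \<in> coset X v" unfolding coset_def by (rule image_eqI)
  qed
  moreover have "v - u \<in> X" using sub_uminus[OF assms uv] by simp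
  ultimately show "coset X u = coset X v" using uv by blast
qed

text \<open>Preimages under the coset map turn subspaces of the quotient into subspaces containing
  \<open>S\<close>, so spans of cosets become spans relative to \<open>S\<close>.\<close>

lemma ops_span_coset:
  "ops_span coset_add \<langle>S\<rangle> (coset_scale scale \<langle>S\<rangle>) (coset \<langle>S\<rangle> ` A) = coset \<langle>S\<rangle> ` \<langle>S \<union> A\<rangle>"
  (is "?L = ?R")
proof
  have Z: "coset \<langle>S\<rangle> s = \<langle>S\<rangle>" if "s \<in> \<langle>S\<rangle>" for s
    using that coset_eq_iff[OF span_sub, of S s 0] by (simp add: coset_zero)
  have "closed_under_ops coset_add \<langle>S\<rangle> (coset_scale scale \<langle>S\<rangle>) ?R"
    unfolding closed_under_ops_def
  proof (intro conjI ballI allI)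
    show "\<langle>S\<rangle> \<in> ?R" using Z[of 0] by (metis imageI span_0)
  qed (auto simp: coset_add_coset span_sub coset_scale_coset intro!: imageI span_add span_scale)
  moreover have "coset \<langle>S\<rangle> ` A \<subseteq> ?R" using span_superset by blast
  ultimately show "?L \<subseteq> ?R" unfolding ops_span_def by (intro hull_minimal)
  have cl: "closed_under_ops coset_add \<langle>S\<rangle> (coset_scale scale \<langle>S\<rangle>) ?L"
    unfolding ops_span_def by (rule hull_in) (auto simp: closed_under_ops_def)
  have "lvs_subspace scale {v. coset \<langle>S\<rangle> v \<in> ?L}"
    using cl by (auto simp: closed_under_ops_def coset_zero
        simp flip: coset_add_coset[OF span_sub] coset_scale_coset[OF span_sub])
  moreover have "coset \<langle>S\<rangle> ` A \<subseteq> ?L" unfolding ops_span_def by (rule hull_subset)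
  then have "S \<union> A \<subseteq> {v. coset \<langle>S\<rangle> v \<in> ?L}"
    using Z[OF span_base] cl by (auto simp: closed_under_ops_def)
  ultimately have "\<langle>S \<union> A\<rangle> \<subseteq> {v. coset \<langle>S\<rangle> v \<in> ?L}" by (rule span_minimal)
  then show "?R \<subseteq> ?L" by blast
qed

lemma lvs_codim_span:
  assumes B: "lvs_basis scale B" and S: "S \<subseteq> B"
  shows "lvs_codim scale \<langle>S\<rangle> =o |B - S|"
proof -
  let ?q = "coset \<langle>S\<rangle>"
  let ?bas = "ops_basis coset_add \<langle>S\<rangle> (coset_scale scale \<langle>S\<rangle>) (range ?q)"
  have q_span: "v \<in> \<langle>S \<union> A\<rangle>" if v: "?q v \<in> ?q ` \<langle>S \<union> A\<rangle>" for v A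
  proof -
    obtain w where w: "w \<in> \<langle>S \<union> A\<rangle>" "v - w \<in> \<langle>S\<rangle>"
      using v coset_eq_iff[OF span_sub] by (metis imageE)
    then have "v - w \<in> \<langle>S \<union> A\<rangle>" using span_mono[of S "S \<union> A"] by blast
    then have "(v - w) + w \<in> \<langle>S \<union> A\<rangle>" using w by (intro span_add)
    then show ?thesis by simp
  qed
  have Bi: "indep B" "\<langle>B\<rangle> = UNIV" using B by (simp_all add: ops_basis_iff)
  interpret rel: pregeometry "\<lambda>A. \<langle>S \<union> A\<rangle>" by (rule relative)
  have rel_B: "rel.indep (B - S)"
    unfolding rel.indep_def
  proof
    fix b assume "b \<in> B - S"
    then have "S \<union> (B - S - {b}) = B - {b}" "b \<in> B" using S by auto
    then show "b \<notin> \<langle>S \<union> (B - S - {b})\<rangle>" using Bi by (simp add: indep_def)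
  qed
  have inj: "inj_on ?q (B - S)"
  proof (rule inj_onI)
    fix x y assume xy: "x \<in> B - S" "y \<in> B - S" "?q x = ?q y"
    show "x = y"
    proof (rule ccontr)
      assume "x \<noteq> y"
      then have "y \<in> B - S - {x}" using xy by auto
      then have "y \<in> \<langle>S \<union> (B - S - {x})\<rangle>" by (intro span_base) blast
      then have "?q x \<in> ?q ` \<langle>S \<union> (B - S - {x})\<rangle>" unfolding xy(3) by (rule imageI)
      then have "x \<in> \<langle>S \<union> (B - S - {x})\<rangle>" by (rule q_span)
      then show False using rel_B xy by (simp add: rel.indep_def)
    qed
  qed
  \<comment> \<open>Some quotient basis has to be exhibited before the choice made in
    \<open>ops_dim\<close> is known to be one.\<close>
  have "?bas (?q ` (B - S))"
    unfolding ops_basis_def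
  proof (intro conjI ballI)
    fix C assume "C \<in> ?q ` (B - S)"
    then obtain b where b: "b \<in> B - S" "C = ?q b" by blast
    have "?q ` (B - S) - {C} = ?q ` (B - S - {b})" using b inj by (auto simp: inj_on_def)
    moreover have "?q b \<notin> ?q ` \<langle>S \<union> (B - S - {b})\<rangle>"
      using q_span rel_B b unfolding rel.indep_def by blast
    ultimately show "C \<notin> ops_span coset_add \<langle>S\<rangle> (coset_scale scale \<langle>S\<rangle>) (?q ` (B - S) - {C})"
      by (simp add: ops_span_coset b)
  next
    have "S \<union> (B - S) = B" using S by auto
    then show "ops_span coset_add \<langle>S\<rangle> (coset_scale scale \<langle>S\<rangle>) (?q ` (B - S)) = range ?q"
      by (simp add: ops_span_coset Bi)
  qed auto
  then have bas0: "?bas (SOME R. ?bas R)" by (rule someI)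
  define Q where "Q = (SOME R. ?bas R)"
  have bas: "?bas Q" unfolding Q_def by (rule bas0)
  \<comment> \<open>Representatives move the arbitrarily chosen quotient basis \<open>Q\<close> back
    into the space, where the relative closure compares it with \<open>B - S\<close>.\<close>
  define r where "r = inv_into UNIV ?q"
  have Q: "Q \<subseteq> range ?q" using bas by (simp add: ops_basis_def)
  have qr: "?q (r C) = C" if "C \<in> Q" for C using Q that f_inv_into_f[of C ?q UNIV] by (auto simp: r_def)
  have qrQ: "?q ` r ` Q = Q" using qr by force
  have "?q ` \<langle>S \<union> r ` Q\<rangle> = range ?q"
    using bas ops_span_coset[of S "r ` Q"] by (simp add: ops_basis_def qrQ)
  then have "v \<in> \<langle>S \<union> r ` Q\<rangle>" for v by (intro q_span) auto
  then have sp: "\<langle>S \<union> r ` Q\<rangle> = UNIV" by auto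
  have rel_R: "rel.indep (r ` Q)"
    unfolding rel.indep_def
  proof (intro ballI notI)
    fix v assume v: "v \<in> r ` Q" "v \<in> \<langle>S \<union> (r ` Q - {v})\<rangle>"
    then obtain C where C: "C \<in> Q" "v = r C" by blast
    have "?q ` (r ` Q - {v}) = Q - {C}"
    proof (intro equalityI subsetI)
      fix D assume "D \<in> ?q ` (r ` Q - {v})"
      then obtain w where w: "w \<in> r ` Q - {v}" "D = ?q w" by (rule imageE)
      then obtain E where E: "E \<in> Q" "w = r E" by blast
      then have "D = E" "E \<noteq> C" using w C(2) qr[OF E(1)] by auto
      then show "D \<in> Q - {C}" using E by simp
    next
      fix D assume D: "D \<in> Q - {C}"
      then have "r D \<noteq> r C" using qr[of D] qr[of C] C(1) by (metis DiffE singletonI)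
      then show "D \<in> ?q ` (r ` Q - {v})" using D qr[of D] C(2) by (metis Diff_iff imageI singletonD)
    qed
    then have "?q ` \<langle>S \<union> (r ` Q - {v})\<rangle> = ops_span coset_add \<langle>S\<rangle> (coset_scale scale \<langle>S\<rangle>) (Q - {C})"
      using ops_span_coset[of S "r ` Q - {v}"] by simp
    moreover have "C \<in> ?q ` \<langle>S \<union> (r ` Q - {v})\<rangle>"
      using v(2) qr[OF C(1)] C(2) by (intro image_eqI[of C ?q v]) simp_all
    ultimately show False using bas C(1) by (simp add: ops_basis_def)
  qed
  have SB: "S \<union> (B - S) = B" using S by auto
  have "|r ` Q| =o |B - S|"
    by (rule rel.indep_ordIso[OF rel_R rel_B]) (use S in \<open>simp_all add: Un_absorb1 Bi sp\<close>)
  moreover have "inj_on r Q" using qr by (metis inj_onI)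
  then have "|Q| =o |r ` Q|" using card_of_ordIsoI inj_on_imp_bij_betw by blast
  ultimately show ?thesis unfolding lvs_codim_def ops_dim_def Q_def[symmetric]
    using ordIso_transitive by blast
qed

end

section \<open>The fundamental theorem of projective geometry\<close>

text \<open>Points are represented by nonzero vectors, and \<open>g\<close> picks a vector on each
  image point. \<open>g_surj\<close> is surjectivity on points, \<open>large\<close> is dimension at
  least three.\<close>

locale collineation = left_vector_space scale
  for scale :: "'k::division_ring \<Rightarrow> 'v::ab_group_add \<Rightarrow> 'v" +
  fixes g :: "'v \<Rightarrow> 'v"
  assumes g_nonzero: "x \<noteq> 0 \<Longrightarrow> g x \<noteq> 0"
    and g_collinear: "x \<noteq> 0 \<Longrightarrow> y \<noteq> 0 \<Longrightarrow> z \<noteq> 0 \<Longrightarrow> z \<in> \<langle>{x, y}\<rangle> \<longleftrightarrow> g z \<in> \<langle>{g x, g y}\<rangle>"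
    and g_surj: "y \<noteq> 0 \<Longrightarrow> \<exists>x. x \<noteq> 0 \<and> g x \<in> \<langle>{y}\<rangle>"
    and large: "\<exists>z. z \<notin> \<langle>{x, y}\<rangle>"
begin

lemma g_parallel: "x \<noteq> 0 \<Longrightarrow> y \<noteq> 0 \<Longrightarrow> y \<in> \<langle>{x}\<rangle> \<longleftrightarrow> g y \<in> \<langle>{g x}\<rangle>"
  using g_collinear[of x x y] by simp

lemma not_span_nonzero: "x \<notin> \<langle>S\<rangle> \<Longrightarrow> x \<noteq> 0"
  using span_0 by blast

lemma not_span_scale:
  assumes "x \<notin> \<langle>S\<rangle>" "y \<in> \<langle>{x}\<rangle>" "y \<noteq> 0"
  shows "y \<notin> \<langle>S\<rangle>"
proof -
  obtain k where k: "y = scale k x" using assms(2) span_singleton by blast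
  then have "k \<noteq> 0" using assms(3) by auto
  then show ?thesis using k assms(1) span_scale_iff by simp
qed

lemma span_singleton_sym: "y \<in> \<langle>{x}\<rangle> \<Longrightarrow> y \<noteq> 0 \<Longrightarrow> x \<in> \<langle>{y}\<rangle>"
  by (metis scale_inverse(1) scale_zero_left span_singleton)

lemma span_add_iff: "x \<in> \<langle>S\<rangle> \<Longrightarrow> x + y \<in> \<langle>S\<rangle> \<longleftrightarrow> y \<in> \<langle>S\<rangle>"
  "x \<in> \<langle>S\<rangle> \<Longrightarrow> y + x \<in> \<langle>S\<rangle> \<longleftrightarrow> y \<in> \<langle>S\<rangle>"
  using span_add[of x S y] span_diff[of "x + y" S x] by (auto simp: add.commute)

lemma notin_span_add: "x \<in> \<langle>S\<rangle> \<Longrightarrow> y \<notin> \<langle>S\<rangle> \<Longrightarrow> x + y \<notin> \<langle>S\<rangle>"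
  "x \<in> \<langle>S\<rangle> \<Longrightarrow> y \<notin> \<langle>S\<rangle> \<Longrightarrow> y + x \<notin> \<langle>S\<rangle>"
  by (simp_all add: span_add_iff)

lemma span_subset_pair: "a \<in> \<langle>S\<rangle> \<Longrightarrow> b \<in> \<langle>S\<rangle> \<Longrightarrow> \<langle>{a, b}\<rangle> \<subseteq> \<langle>S\<rangle>"
  by (rule cl_least) simp

lemma span_subset_single: "a \<in> \<langle>S\<rangle> \<Longrightarrow> \<langle>{a}\<rangle> \<subseteq> \<langle>S\<rangle>"
  by (rule cl_least) simp

text \<open>
  For \<open>x\<close> outside the line of \<open>e\<close> such a \<open>v\<close> is unique, and \<open>lift e\<close> is the only candidate for the
  semilinear map that induces \<open>g\<close> and sends \<open>e\<close> to \<open>g e\<close>.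
\<close>

definition lift :: "'v \<Rightarrow> 'v \<Rightarrow> 'v" where
  "lift e x = (SOME v. v \<in> \<langle>{g x}\<rangle> \<and> v \<noteq> 0 \<and> g (e + x) \<in> \<langle>{g e + v}\<rangle>)"

end

section \<open>The lift off the line of \<open>e\<close>\<close>

locale pointed_collineation = collineation scale g
  for scale :: "'k::division_ring \<Rightarrow> 'v::ab_group_add \<Rightarrow> 'v" and g +
  fixes e :: 'v
  assumes e_nonzero: "e \<noteq> 0"
begin

abbreviation l0 :: "'v \<Rightarrow> 'v" where
  "l0 \<equiv> lift e"

lemma e_notin: "x \<notin> \<langle>{e}\<rangle> \<Longrightarrow> e \<notin> \<langle>{x}\<rangle>"
  using span_singleton_sym e_nonzero by blast

lemma g_notin: "x \<notin> \<langle>{e}\<rangle> \<Longrightarrow> g x \<notin> \<langle>{g e}\<rangle>" "x \<notin> \<langle>{e}\<rangle> \<Longrightarrow> g e \<notin> \<langle>{g x}\<rangle>"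
  using g_parallel[of e x] g_parallel[of x e] e_nonzero e_notin not_span_nonzero by blast+

lemma plus_e_notin: "x \<notin> \<langle>{e}\<rangle> \<Longrightarrow> e + x \<notin> \<langle>{e}\<rangle>"
  by (simp add: span_add_iff span_base)

text \<open>\<open>g (e + x)\<close> is a combination of \<open>g e\<close> and \<open>g x\<close>
  with both coefficients nonzero, as \<open>e + x\<close> is parallel to neither \<open>e\<close>
  nor \<open>x\<close>. Dividing by the coefficient of \<open>g e\<close> gives the required
  vector.\<close>

lemma l0_spec:
  assumes x: "x \<notin> \<langle>{e}\<rangle>"
  shows "l0 x \<in> \<langle>{g x}\<rangle>" "l0 x \<noteq> 0" "g (e + x) \<in> \<langle>{g e + l0 x}\<rangle>"
proof -
  have x0: "x \<noteq> 0" "e + x \<noteq> 0" using x plus_e_notin[OF x] not_span_nonzero by auto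
  have "e + x \<in> \<langle>{e, x}\<rangle>" by (simp add: span_add span_base)
  then obtain a b where ab: "g (e + x) = scale a (g e) + scale b (g x)"
    using g_collinear[of e x "e + x"] x0 e_nonzero span_pair by blast
  have a: "a \<noteq> 0"
  proof
    assume "a = 0"
    then have "g (e + x) \<in> \<langle>{g x}\<rangle>" using ab span_singleton by auto
    then have "e + x \<in> \<langle>{x}\<rangle>" using g_parallel x0 by blast
    then show False using e_notin[OF x] by (simp add: span_add_iff span_base)
  qed
  have b: "b \<noteq> 0"
  proof
    assume "b = 0"
    then have "g (e + x) \<in> \<langle>{g e}\<rangle>" using ab span_singleton by auto
    then show False using g_parallel[of e "e + x"] x0 e_nonzero plus_e_notin[OF x] by blast
  qed
  let ?v = "scale (inverse a * b) (g x)"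
  have "g (e + x) = scale a (g e + ?v)"
    using a by (simp add: ab scale_right_distrib scale_scale mult.assoc[symmetric])
  then have "?v \<in> \<langle>{g x}\<rangle> \<and> ?v \<noteq> 0 \<and> g (e + x) \<in> \<langle>{g e + ?v}\<rangle>"
    using a b g_nonzero x0 span_singleton by auto
  from someI[of "\<lambda>v. v \<in> \<langle>{g x}\<rangle> \<and> v \<noteq> 0 \<and> g (e + x) \<in> \<langle>{g e + v}\<rangle>", OF this]
  show "l0 x \<in> \<langle>{g x}\<rangle>" "l0 x \<noteq> 0" "g (e + x) \<in> \<langle>{g e + l0 x}\<rangle>"
    unfolding lift_def by auto
qed

lemma l0_unique:
  assumes x: "x \<notin> \<langle>{e}\<rangle>" and v: "v \<in> \<langle>{g x}\<rangle>" and u: "g (e + x) \<in> \<langle>{g e + v}\<rangle>"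
  shows "l0 x = v"
proof -
  obtain p where p: "g (e + x) = scale p (g e + v)" using u span_singleton by blast
  obtain q where q: "g (e + x) = scale q (g e + l0 x)" using l0_spec(3)[OF x] span_singleton by blast
  have p0: "p \<noteq> 0" using p g_nonzero[of "e + x"] plus_e_notin[OF x] not_span_nonzero by auto
  have "scale p (g e) + scale p v = scale q (g e) + scale q (l0 x)"
    using p q by (simp add: scale_right_distrib)
  then have eq: "scale (p - q) (g e) = scale q (l0 x) - scale p v"
    by (simp add: scale_diff_left algebra_simps)
  then have "scale (p - q) (g e) \<in> \<langle>{g x}\<rangle>"
    using v l0_spec(1)[OF x] by (simp add: span_diff span_scale)
  then have pq: "p = q" using g_notin(2)[OF x] span_scale_iff[of "p - q"] by force
  then have "scale p (l0 x - v) = 0" using eq by (simp add: scale_diff_right)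
  then show ?thesis using p0 by simp
qed

lemma g_in_l0: "x \<notin> \<langle>{e}\<rangle> \<Longrightarrow> g x \<in> \<langle>{l0 x}\<rangle>"
  using l0_spec span_singleton_sym by blast

lemma l0_notin:
  assumes "x \<notin> \<langle>{e}\<rangle>" "y \<notin> \<langle>{e, x}\<rangle>"
  shows "l0 y \<notin> \<langle>{g e, l0 x}\<rangle>"
proof
  have ye: "y \<notin> \<langle>{e}\<rangle>" using assms(2) span_mono[of "{e}" "{e, x}"] by blast
  have x0: "x \<noteq> 0" "y \<noteq> 0" using assms not_span_nonzero by auto
  assume "l0 y \<in> \<langle>{g e, l0 x}\<rangle>"
  moreover have "l0 x \<in> \<langle>{g e, g x}\<rangle>" using l0_spec(1)[OF assms(1)] span_mono[of "{g x}" "{g e, g x}"] by blast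
  ultimately have "l0 y \<in> \<langle>{g e, g x}\<rangle>" using span_subset_pair[of "g e" "{g e, g x}" "l0 x"] span_base[of "g e" "{g e, g x}"] by blast
  then have "g y \<in> \<langle>{g e, g x}\<rangle>"
    using g_in_l0[OF ye] span_subset_single by blast
  then show False using g_collinear[OF e_nonzero x0] assms(2) by blast
qed

lemma l0_indep:
  assumes x: "x \<notin> \<langle>{e}\<rangle>" and y: "y \<notin> \<langle>{e, x}\<rangle>"
    and eq: "scale a (g e) + scale b (l0 x) + scale c (l0 y) = scale a' (g e) + scale b' (l0 x) + scale c' (l0 y)"
  shows "a = a'" "b = b'" "c = c'"
proof -
  have "scale (c' - c) (l0 y) = scale (a - a') (g e) + scale (b - b') (l0 x)"
    using eq by (simp add: scale_diff_left algebra_simps)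
  then have "scale (c' - c) (l0 y) \<in> \<langle>{g e, l0 x}\<rangle>" using span_pair by blast
  then show c: "c = c'" using l0_notin[OF x y] span_scale_iff[of "c' - c"] by force
  then have "scale (b' - b) (l0 x) = scale (a - a') (g e)"
    using eq by (simp add: scale_diff_left algebra_simps)
  then have "scale (b' - b) (l0 x) \<in> \<langle>{g e}\<rangle>" using span_singleton by blast
  moreover have "l0 x \<notin> \<langle>{g e}\<rangle>" using not_span_scale[OF g_notin(1)[OF x] l0_spec(1,2)[OF x]] .
  ultimately show b: "b = b'" using span_scale_iff[of "b' - b"] by force
  then have "scale (a' - a) (g e) = 0" using eq c by (simp add: scale_diff_left)
  then show "a = a'" using g_nonzero[OF e_nonzero] by simp
qed

text \<open>The point of \<open>e + (x + y)\<close> lies on the join of \<open>e + x\<close> with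
  \<open>y\<close> and on that of \<open>e + y\<close> with \<open>x\<close>; comparing coefficients
  makes \<open>g e + (l0 x + l0 y)\<close> a representative of its image. The point of
  \<open>x + y\<close> lies on the join of \<open>x\<close> with \<open>y\<close> and on that of
  \<open>e\<close> with \<open>e + (x + y)\<close>, so \<open>l0 x + l0 y\<close> represents its
  image and \<open>l0_unique\<close> applies.\<close>

lemma l0_add_indep:
  assumes x: "x \<notin> \<langle>{e}\<rangle>" and y: "y \<notin> \<langle>{e, x}\<rangle>"
  shows "l0 (x + y) = l0 x + l0 y"
proof -
  have ye: "y \<notin> \<langle>{e}\<rangle>" using y span_mono[of "{e}" "{e, x}"] by blast
  have sub: "x \<in> \<langle>{e, x}\<rangle>" "e \<in> \<langle>{e, x}\<rangle>" by (simp_all add: span_base)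
  have xy': "x + y \<notin> \<langle>{e, x}\<rangle>" using y sub by (simp add: span_add_iff)
  have xye: "x + y \<notin> \<langle>{e}\<rangle>" using xy' span_mono[of "{e}" "{e, x}"] by blast
  have nz: "x \<noteq> 0" "y \<noteq> 0" "x + y \<noteq> 0" "e + x \<noteq> 0" "e + y \<noteq> 0" "e + (x + y) \<noteq> 0"
    using x ye xye plus_e_notin not_span_nonzero by blast+
  have pair: "g z \<in> \<langle>{u, v}\<rangle>" if "z \<in> \<langle>{p, q}\<rangle>" "p \<noteq> 0" "q \<noteq> 0" "z \<noteq> 0" "g p \<in> \<langle>{u}\<rangle>" "g q \<in> \<langle>{v}\<rangle>" for z p q u v
  proof -
    have "g p \<in> \<langle>{u, v}\<rangle>" "g q \<in> \<langle>{u, v}\<rangle>"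
      using that span_mono[of "{u}" "{u, v}"] span_mono[of "{v}" "{u, v}"] by blast+
    then show ?thesis using that g_collinear[of p q z] span_subset_pair by blast
  qed
  have eq1: "e + (x + y) = (e + x) + y" "e + (x + y) = (e + y) + x" by (simp_all add: algebra_simps)
  have "g (e + (x + y)) \<in> \<langle>{g e + l0 x, l0 y}\<rangle>"
    by (rule pair[of _ "e + x" y]) (simp_all add: nz l0_spec x g_in_l0 ye eq1(1) span_add span_base nz(6)[unfolded eq1(1)])
  then obtain a b where ab: "g (e + (x + y)) = scale a (g e + l0 x) + scale b (l0 y)" using span_pair by blast
  have "g (e + (x + y)) \<in> \<langle>{g e + l0 y, l0 x}\<rangle>"
    by (rule pair[of _ "e + y" x]) (simp_all add: nz l0_spec x g_in_l0 ye eq1(2) span_add span_base nz(6)[unfolded eq1(2)])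
  then obtain c d where cd: "g (e + (x + y)) = scale c (g e + l0 y) + scale d (l0 x)" using span_pair by blast
  have "scale a (g e) + scale a (l0 x) + scale b (l0 y) = scale c (g e) + scale d (l0 x) + scale c (l0 y)"
    using ab cd by (simp add: scale_right_distrib algebra_simps)
  then have "b = a" using l0_indep[OF x y] by metis
  then have gs: "g (e + (x + y)) \<in> \<langle>{g e + (l0 x + l0 y)}\<rangle>"
    using ab by (auto simp: span_singleton scale_right_distrib algebra_simps)
  have "g (x + y) \<in> \<langle>{l0 x, l0 y}\<rangle>"
    by (rule pair[of _ x y]) (simp_all add: nz g_in_l0 x ye span_add span_base)
  then obtain p q where pq: "g (x + y) = scale p (l0 x) + scale q (l0 y)" using span_pair by blast
  have "(e + (x + y)) - e \<in> \<langle>{e, e + (x + y)}\<rangle>" by (intro span_diff span_base) auto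
  then have "x + y \<in> \<langle>{e, e + (x + y)}\<rangle>" by simp
  then have "g (x + y) \<in> \<langle>{g e, g e + (l0 x + l0 y)}\<rangle>"
    by (rule pair) (simp_all add: nz e_nonzero gs span_base)
  then obtain r s where rs: "g (x + y) = scale r (g e) + scale s (g e + (l0 x + l0 y))" using span_pair by blast
  have "scale 0 (g e) + scale p (l0 x) + scale q (l0 y) = scale (r + s) (g e) + scale s (l0 x) + scale s (l0 y)"
    using pq rs by (simp add: scale_right_distrib scale_left_distrib algebra_simps)
  then have "p = s" "q = s" using l0_indep[OF x y] by metis+
  then have gxy: "g (x + y) = scale s (l0 x + l0 y)" using pq by (simp add: scale_right_distrib)
  then have "l0 x + l0 y \<in> \<langle>{g (x + y)}\<rangle>"
    using span_singleton_sym[of "g (x + y)" "l0 x + l0 y"] g_nonzero[OF nz(3)] span_singleton by blast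
  then show ?thesis using l0_unique[OF xye _ gs] by blast
qed

text \<open>If \<open>y\<close> lies in the plane of \<open>e\<close> and \<open>x\<close>, a vector
  \<open>z\<close> off that plane makes every sum used in computing \<open>x + y + z\<close> in two
  ways an independent one.\<close>

lemma l0_add:
  assumes x: "x \<notin> \<langle>{e}\<rangle>" and y: "y \<notin> \<langle>{e}\<rangle>" and xy: "x + y \<notin> \<langle>{e}\<rangle>"
  shows "l0 (x + y) = l0 x + l0 y"
proof (cases "y \<in> \<langle>{e, x}\<rangle>")
  case False
  then show ?thesis using x l0_add_indep by blast
next
  case True
  obtain z where z: "z \<notin> \<langle>{e, x}\<rangle>" using large by blast
  have sub: "x \<in> \<langle>{e, x}\<rangle>" "e \<in> \<langle>{e, x}\<rangle>" by (simp_all add: span_base)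
  have z1: "z \<notin> \<langle>{e, x + y}\<rangle>" "z \<notin> \<langle>{e, y}\<rangle>" "y + z \<notin> \<langle>{e, x}\<rangle>"
    using z span_subset_pair[OF sub(2) span_add[OF sub(1) True]] span_subset_pair[OF sub(2) True]
      notin_span_add(1)[OF True z] by auto
  have "l0 (x + y) + l0 z = l0 ((x + y) + z)" using l0_add_indep[OF xy z1(1)] by simp
  also have "\<dots> = l0 (x + (y + z))" by (simp add: add.assoc)
  also have "\<dots> = l0 x + l0 (y + z)" by (rule l0_add_indep[OF x z1(3)])
  also have "l0 (y + z) = l0 y + l0 z" by (rule l0_add_indep[OF y z1(2)])
  finally show ?thesis by (simp add: add.assoc[symmetric])
qed

section \<open>Extension of the lift to the line of \<open>e\<close>\<close>

lemma ex_notin: "\<exists>z. z \<notin> \<langle>{e}\<rangle>"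
  using large[of e e] by simp

text \<open>\<open>l0\<close> has its meaning only off the line of \<open>e\<close>. On that line
  the value is forced by additivity with an auxiliary vector off the line.\<close>

definition l :: "'v \<Rightarrow> 'v" where
  "l x = (if x \<in> \<langle>{e}\<rangle> then let z = (SOME z. z \<notin> \<langle>{e}\<rangle>) in l0 (x + z) - l0 z else l0 x)"

lemma l_outside: "x \<notin> \<langle>{e}\<rangle> \<Longrightarrow> l x = l0 x"
  by (simp add: l_def)

text \<open>The value of \<open>l\<close> on the line does not depend on the auxiliary vector: for
  two such vectors, evaluating \<open>l0\<close> at \<open>x + y + z\<close> in two ways gives the
  same difference.\<close>

lemma l_mixed:
  assumes x: "x \<in> \<langle>{e}\<rangle>" and y: "y \<notin> \<langle>{e}\<rangle>"
  shows "l (x + y) = l x + l y"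
proof -
  define z where "z = (SOME z. z \<notin> \<langle>{e}\<rangle>)"
  have z: "z \<notin> \<langle>{e}\<rangle>" unfolding z_def using ex_notin by (rule someI_ex)
  have lx: "l x = l0 (x + z) - l0 z" using x by (simp add: l_def z_def[symmetric])
  have out: "x + w \<notin> \<langle>{e}\<rangle>" if "w \<notin> \<langle>{e}\<rangle>" for w using x that by (rule notin_span_add(1))
  have swap: "l0 (x + y) + l0 w = l0 (x + w) + l0 y"
    if "w \<notin> \<langle>{e}\<rangle>" "y \<notin> \<langle>{e}\<rangle>" "y + w \<notin> \<langle>{e}\<rangle>" for y w
  proof -
    have "l0 (x + y) + l0 w = l0 (x + y + w)"
      using that out[of y] out[of "y + w"] by (intro l0_add[symmetric]) (simp_all add: add.assoc)
    also have "x + y + w = x + w + y" by (simp add: algebra_simps)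
    also have "l0 (x + w + y) = l0 (x + w) + l0 y"
      using that out[of w] out[of "w + y"] by (intro l0_add) (simp_all add: algebra_simps)
    finally show ?thesis .
  qed
  have "l0 (x + y) + l0 z = l0 (x + z) + l0 y"
  proof (cases "y + z \<in> \<langle>{e}\<rangle>")
    case False
    then show ?thesis by (rule swap[OF z y])
  next
    case True
    \<comment> \<open>Here \<open>x + y + z\<close> falls on the line of \<open>e\<close>, out of
      reach of \<open>l0_add\<close>; \<open>y\<close> and \<open>z\<close> are compared with a
      third vector off their plane instead.\<close>
    obtain w where w: "w \<notin> \<langle>{e, y}\<rangle>" using large by blast
    have sub: "\<langle>{e}\<rangle> \<subseteq> \<langle>{e, y}\<rangle>" by (rule span_mono) simp
    have yy: "y \<in> \<langle>{e, y}\<rangle>" by (simp add: span_base)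
    have zz: "z \<in> \<langle>{e, y}\<rangle>" using True sub span_add_iff(1)[OF yy, of z] by auto
    have w1: "w \<notin> \<langle>{e}\<rangle>" "y + w \<notin> \<langle>{e}\<rangle>" "z + w \<notin> \<langle>{e}\<rangle>"
      using w notin_span_add(1)[OF yy w] notin_span_add(1)[OF zz w] sub by auto
    have "l0 (x + y) + l0 w = l0 (x + w) + l0 y" "l0 (x + z) + l0 w = l0 (x + w) + l0 z"
      using swap[OF w1(1) y w1(2)] swap[OF w1(1) z w1(3)] by simp_all
    then have "(l0 (x + y) + l0 w) + l0 z = (l0 (x + z) + l0 w) + l0 y" by (simp add: ac_simps)
    then show ?thesis by (simp add: ac_simps)
  qed
  then have "l0 (x + y) = l0 (x + z) + l0 y - l0 z" by (simp add: eq_diff_eq)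
  also have "\<dots> = (l0 (x + z) - l0 z) + l0 y" by simp
  finally show ?thesis using lx l_outside[OF y] l_outside[OF out[OF y]] by metis
qed

lemma l_add: "l (x + y) = l x + l y"
proof (cases "x \<in> \<langle>{e}\<rangle>")
  case True
  note x = this
  show ?thesis
  proof (cases "y \<in> \<langle>{e}\<rangle>")
    case True
    obtain w where w: "w \<notin> \<langle>{e}\<rangle>" using ex_notin by blast
    have yw: "y + w \<notin> \<langle>{e}\<rangle>" using True w by (rule notin_span_add(1))
    have "l (x + y) + l w = l (x + y + w)" using l_mixed[of "x + y" w] x True w span_add by simp
    also have "\<dots> = l (x + (y + w))" by (simp add: add.assoc)
    also have "\<dots> = l x + (l y + l w)" using l_mixed[OF x yw] l_mixed[OF True w] by simp
    finally show ?thesis by (simp add: add.assoc[symmetric])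
  qed (use x l_mixed in blast)
next
  case False
  note x = this
  show ?thesis
  proof (cases "y \<in> \<langle>{e}\<rangle>")
    case True
    then show ?thesis using l_mixed[OF True x] by (simp add: add.commute)
  next
    case False
    note y = this
    show ?thesis
    proof (cases "x + y \<in> \<langle>{e}\<rangle>")
      case True
      obtain w where w: "w \<notin> \<langle>{e, x}\<rangle>" using large by blast
      have sub: "\<langle>{e}\<rangle> \<subseteq> \<langle>{e, x}\<rangle>" by (rule span_mono) simp
      have xx: "x \<in> \<langle>{e, x}\<rangle>" by (simp add: span_base)
      have yy: "y \<in> \<langle>{e, x}\<rangle>" using True sub span_add_iff(1)[OF xx, of y] by auto
      have yw: "y + w \<notin> \<langle>{e, x}\<rangle>" using yy w by (rule notin_span_add(1))
      have w1: "w \<notin> \<langle>{e}\<rangle>" "y + w \<notin> \<langle>{e}\<rangle>" "x + (y + w) \<notin> \<langle>{e}\<rangle>"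
        using w yw notin_span_add(1)[OF xx yw] sub by auto
      have "l (x + y) + l w = l (x + y + w)" using l_mixed[OF True w1(1)] by simp
      also have "\<dots> = l (x + (y + w))" by (simp add: add.assoc)
      also have "\<dots> = l x + (l y + l w)"
        using l0_add[OF x w1(2,3)] l0_add[OF y w1(1,2)] x y w1 by (simp add: l_outside)
      finally show ?thesis by (simp add: add.assoc[symmetric])
    qed (use l0_add x y in \<open>simp add: l_outside\<close>)
  qed
qed

lemma l_0 [simp]: "l 0 = 0"
  using l_add[of 0 0] by simp

text \<open>The image lies in the plane of \<open>g e\<close> and \<open>l0 z\<close> for every
  \<open>z\<close> off the line; for \<open>z\<close> and \<open>w\<close> independent modulo
  \<open>e\<close>, two such planes meet in the line of \<open>g e\<close>.\<close>

lemma l_in_inside: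
  assumes x: "x \<in> \<langle>{e}\<rangle>" "x \<noteq> 0"
  shows "l x \<in> \<langle>{g e}\<rangle>"
proof -
  have gx: "g x \<in> \<langle>{g e}\<rangle>" using g_parallel[of e x] e_nonzero x by blast
  have mem: "l x \<in> \<langle>{g e, l0 z}\<rangle>" if z: "z \<notin> \<langle>{e}\<rangle>" for z
  proof -
    have xz: "x + z \<notin> \<langle>{e}\<rangle>" using x(1) z by (rule notin_span_add(1))
    have nz: "z \<noteq> 0" "x + z \<noteq> 0" using z xz not_span_nonzero by auto
    have "x + z \<in> \<langle>{x, z}\<rangle>" by (simp add: span_add span_base)
    then have 1: "g (x + z) \<in> \<langle>{g x, g z}\<rangle>" using g_collinear[OF x(2) nz] by blast
    have "g x \<in> \<langle>{g e, l0 z}\<rangle>" "g z \<in> \<langle>{g e, l0 z}\<rangle>"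
      using gx g_in_l0[OF z] span_mono[of "{g e}" "{g e, l0 z}"] span_mono[of "{l0 z}" "{g e, l0 z}"] by blast+
    then have "g (x + z) \<in> \<langle>{g e, l0 z}\<rangle>" using 1 span_subset_pair by blast
    then have "l0 (x + z) \<in> \<langle>{g e, l0 z}\<rangle>" using l0_spec(1)[OF xz] span_subset_single by blast
    moreover have "l0 z \<in> \<langle>{g e, l0 z}\<rangle>" by (simp add: span_base)
    ultimately have "l0 (x + z) - l0 z \<in> \<langle>{g e, l0 z}\<rangle>" by (rule span_diff)
    moreover have "l x = l0 (x + z) - l0 z" using l_add[of x z] z xz by (simp add: l_outside)
    ultimately show ?thesis by simp
  qed
  obtain z where z: "z \<notin> \<langle>{e}\<rangle>" using ex_notin by blast
  obtain w where w: "w \<notin> \<langle>{e, z}\<rangle>" using large by blast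
  have we: "w \<notin> \<langle>{e}\<rangle>" using w span_mono[of "{e}" "{e, z}"] by blast
  obtain a b where ab: "l x = scale a (g e) + scale b (l0 z)" using mem[OF z] span_pair by blast
  obtain c d where cd: "l x = scale c (g e) + scale d (l0 w)" using mem[OF we] span_pair by blast
  have "scale a (g e) + scale b (l0 z) + scale 0 (l0 w) = scale c (g e) + scale 0 (l0 z) + scale d (l0 w)"
    using ab cd by simp
  then have "b = 0" using l0_indep[OF z w] by metis
  then show ?thesis using ab span_singleton by auto
qed

lemma l_nonzero: "x \<noteq> 0 \<Longrightarrow> l x \<noteq> 0"
proof (cases "x \<in> \<langle>{e}\<rangle>")
  case True
  assume x: "x \<noteq> 0"
  obtain z where z: "z \<notin> \<langle>{e}\<rangle>" using ex_notin by blast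
  have xz: "x + z \<notin> \<langle>{e}\<rangle>" using True z by (rule notin_span_add(1))
  have nz: "z \<noteq> 0" "x + z \<noteq> 0" using z xz not_span_nonzero by auto
  show "l x \<noteq> 0"
  proof
    assume "l x = 0"
    then have "l0 (x + z) = l0 z" using l_add[of x z] z xz by (simp add: l_outside)
    then have "g (x + z) \<in> \<langle>{g z}\<rangle>" using g_in_l0[OF xz] l0_spec(1)[OF z] span_subset_single by auto
    then have "x + z \<in> \<langle>{z}\<rangle>" using g_parallel nz by blast
    then have "x \<in> \<langle>{z}\<rangle>" using span_add_iff(2)[of z "{z}" x] span_base[of z "{z}"] by blast
    then have "z \<in> \<langle>{x}\<rangle>" using x span_singleton_sym by blast
    then show False using z True span_subset_single by blast
  qed
qed (use l0_spec in \<open>simp add: l_outside\<close>)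

lemma l_in: "x \<noteq> 0 \<Longrightarrow> l x \<in> \<langle>{g x}\<rangle>"
proof (cases "x \<in> \<langle>{e}\<rangle>")
  case True
  assume x: "x \<noteq> 0"
  then have "g e \<in> \<langle>{g x}\<rangle>" using True g_parallel[of x e] e_nonzero span_singleton_sym by blast
  then show "l x \<in> \<langle>{g x}\<rangle>" using l_in_inside[OF True x] span_subset_single by blast
qed (use l0_spec in \<open>simp add: l_outside\<close>)

lemma g_in_l: "x \<noteq> 0 \<Longrightarrow> g x \<in> \<langle>{l x}\<rangle>"
  using l_in l_nonzero span_singleton_sym by blast

lemma l_diff: "l (x - y) = l x - l y"
  using l_add[of "x - y" y] by simp

lemma l_inj: "l x = l y \<Longrightarrow> x = y"
  using l_diff[of x y] l_nonzero[of "x - y"] by auto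

lemma l_scale_ex: "\<exists>s. l (scale a x) = scale s (l x)"
proof (cases "scale a x = 0")
  case True
  then show ?thesis by (auto intro!: exI[of _ 0])
next
  case False
  then have x: "x \<noteq> 0" by auto
  have "scale a x \<in> \<langle>{x}\<rangle>" using span_singleton by blast
  then have "g (scale a x) \<in> \<langle>{g x}\<rangle>" using g_parallel x False by blast
  moreover have "g x \<in> \<langle>{l x}\<rangle>" by (rule g_in_l[OF x])
  ultimately have "g (scale a x) \<in> \<langle>{l x}\<rangle>" using span_subset_single by blast
  then have "l (scale a x) \<in> \<langle>{l x}\<rangle>" using l_in[OF False] span_subset_single by blast
  then show ?thesis using span_singleton by blast
qed

lemma l_notin:
  assumes "x \<noteq> 0" "y \<notin> \<langle>{x}\<rangle>"
  shows "l y \<notin> \<langle>{l x}\<rangle>"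
proof
  have y: "y \<noteq> 0" using assms not_span_nonzero by blast
  assume "l y \<in> \<langle>{l x}\<rangle>"
  then have "g y \<in> \<langle>{l x}\<rangle>" using g_in_l[OF y] span_subset_single by blast
  then have "g y \<in> \<langle>{g x}\<rangle>" using l_in[OF assms(1)] span_subset_single by blast
  then show False using assms y g_parallel by blast
qed

section \<open>The automorphism of scalars\<close>

definition sg :: "'k \<Rightarrow> 'k" where
  "sg a = (SOME s. l (scale a e) = scale s (l e))"

lemma l_scale_e: "l (scale a e) = scale (sg a) (l e)"
  unfolding sg_def using l_scale_ex by (rule someI_ex)

lemma scale_cancel: "scale a x = scale b x \<Longrightarrow> x \<noteq> 0 \<Longrightarrow> a = b"
  using scale_diff_left[of a b x] by simp

text \<open>The factor belonging to \<open>x + y\<close> must agree with that of \<open>x\<close>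
  and with that of \<open>y\<close>, because \<open>l x\<close> and \<open>l y\<close> are
  independent.\<close>

lemma scale_transfer:
  assumes x: "x \<noteq> 0" and y: "y \<notin> \<langle>{x}\<rangle>" and s: "l (scale a x) = scale s (l x)"
  shows "l (scale a y) = scale s (l y)"
proof -
  obtain t where t: "l (scale a y) = scale t (l y)" using l_scale_ex by blast
  obtain r where r: "l (scale a (x + y)) = scale r (l (x + y))" using l_scale_ex by blast
  have eq: "scale r (l x) + scale r (l y) = scale s (l x) + scale t (l y)"
    using s t r by (simp add: l_add scale_right_distrib)
  then have "scale (r - t) (l y) = scale (s - r) (l x)" by (simp add: scale_diff_left algebra_simps)
  then have "scale (r - t) (l y) \<in> \<langle>{l x}\<rangle>" using span_singleton by blast
  then have "r = t" using l_notin[OF x y] span_scale_iff[of "r - t"] by force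
  moreover from this have "r = s" using eq scale_cancel l_nonzero[OF x] by auto
  ultimately show ?thesis using t by simp
qed

lemma l_scale: "l (scale a x) = scale (sg a) (l x)"
proof (cases "x \<in> \<langle>{e}\<rangle>")
  case False
  then show ?thesis using scale_transfer[OF e_nonzero _ l_scale_e] by blast
next
  case True
  show ?thesis
  proof (cases "x = 0")
    case False
    \<comment> \<open>\<open>x\<close> is parallel to \<open>e\<close>, so the factor is carried
      from \<open>e\<close> to \<open>y\<close> and then from \<open>y\<close> to
      \<open>x\<close>.\<close>
    obtain y where y: "y \<notin> \<langle>{e}\<rangle>" using ex_notin by blast
    have xy: "x \<notin> \<langle>{y}\<rangle>" using y True False span_singleton_sym span_subset_single by blast
    have "l (scale a y) = scale (sg a) (l y)" using scale_transfer[OF e_nonzero y l_scale_e] .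
    then show ?thesis using scale_transfer[of y x a "sg a"] xy y not_span_nonzero by blast
  qed simp
qed

lemma sg_eqI: "scale (sg a) (l e) = scale s (l e) \<Longrightarrow> sg a = s"
  using scale_cancel l_nonzero[OF e_nonzero] by blast

text \<open>Surjectivity on points gives a vector with coefficients \<open>a\<close> at
  \<open>e\<close> and \<open>b\<close> at \<open>y\<close> that is mapped into the line of
  \<open>l e + scale c (l y)\<close>. Comparing coefficients exhibits \<open>c\<close> as the image
  of \<open>inverse a * b\<close>.\<close>

lemma sg_surj: "\<exists>a. sg a = c"
proof (cases "c = 0")
  case True
  have "sg 0 = 0" by (rule sg_eqI) (simp add: l_scale[symmetric])
  then show ?thesis using True by blast
next
  case False
  obtain y where y: "y \<notin> \<langle>{e}\<rangle>" using ex_notin by blast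
  have y0: "y \<noteq> 0" using y not_span_nonzero by blast
  have ly: "l y \<notin> \<langle>{l e}\<rangle>" by (rule l_notin[OF e_nonzero y])
  define v where "v = l e + scale c (l y)"
  have "v \<noteq> 0"
  proof
    assume "v = 0"
    then have "scale c (l y) = scale (- 1) (l e)"
      by (simp add: v_def scale_minus_left scale_one add_eq_0_iff)
    then have "scale c (l y) \<in> \<langle>{l e}\<rangle>" using span_singleton by blast
    then show False using False ly span_scale_iff by blast
  qed
  then obtain u where u: "u \<noteq> 0" "g u \<in> \<langle>{v}\<rangle>" using g_surj by blast
  have "l e \<in> \<langle>{g e, g y}\<rangle>" "l y \<in> \<langle>{g e, g y}\<rangle>"
    using l_in[OF e_nonzero] l_in[OF y0] span_mono[of "{g e}" "{g e, g y}"] span_mono[of "{g y}" "{g e, g y}"] by blast+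
  then have "v \<in> \<langle>{g e, g y}\<rangle>" unfolding v_def by (intro span_add span_scale)
  then have "g u \<in> \<langle>{g e, g y}\<rangle>" using u span_subset_single by blast
  then have "u \<in> \<langle>{e, y}\<rangle>" using g_collinear[OF e_nonzero y0 u(1)] by blast
  then obtain a b where ab: "u = scale a e + scale b y" using span_pair by blast
  have "l u \<in> \<langle>{v}\<rangle>" using l_in[OF u(1)] u(2) span_subset_single by blast
  then have "v \<in> \<langle>{l u}\<rangle>" using l_nonzero[OF u(1)] span_singleton_sym by blast
  then obtain d where d: "v = scale d (l u)" using span_singleton by blast
  have eq: "l e + scale c (l y) = scale (d * sg a) (l e) + scale (d * sg b) (l y)"
    using d ab by (simp add: v_def l_add l_scale scale_right_distrib scale_scale)
  then have "scale (c - d * sg b) (l y) = scale (d * sg a - 1) (l e)"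
    by (simp add: scale_diff_left scale_one algebra_simps)
  then have "scale (c - d * sg b) (l y) \<in> \<langle>{l e}\<rangle>" using span_singleton by blast
  then have c: "c = d * sg b" using ly span_scale_iff[of "c - d * sg b"] by force
  then have "scale 1 (l e) = scale (d * sg a) (l e)" using eq by (simp add: scale_one)
  then have 1: "d * sg a = 1" using scale_cancel l_nonzero[OF e_nonzero] by metis
  then have a0: "sg a \<noteq> 0" by auto
  have "a \<noteq> 0" using a0 sg_eqI[of 0 0] l_scale[of 0 e] by auto
  then have "scale (sg a * sg (inverse a * b)) (l e) = scale (sg b) (l e)"
    by (simp add: scale_scale[symmetric] l_scale[symmetric]) (simp add: scale_scale mult.assoc[symmetric])
  then have "sg a * sg (inverse a * b) = sg b" using scale_cancel l_nonzero[OF e_nonzero] by blast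
  then have "d * sg a * sg (inverse a * b) = d * sg b" by (simp add: mult.assoc)
  then have "sg (inverse a * b) = c" using 1 c by simp
  then show ?thesis by blast
qed

lemma semilinear: "semilinear_automorphism scale l"
proof -
  have add: "sg (a + b) = sg a + sg b" for a b
    by (rule sg_eqI) (simp add: l_scale[symmetric] scale_left_distrib l_add)
  have mult: "sg (a * b) = sg a * sg b" for a b
    by (rule sg_eqI) (simp add: scale_scale[symmetric] l_scale[symmetric])
  have one: "sg 1 = 1" by (rule sg_eqI) (simp add: l_scale[symmetric] scale_one)
  have inj: "inj sg"
  proof (rule injI)
    fix a b assume "sg a = sg b"
    then have "l (scale a e) = l (scale b e)" by (simp add: l_scale)
    then show "a = b" using l_inj scale_cancel e_nonzero by blast
  qed
  have "bij sg" using inj sg_surj by (metis bijI surjI)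
  moreover have "surj l"
  proof (rule surjI)
    fix y
    show "l (SOME x. l x = y) = y"
    proof (rule someI_ex, cases "y = 0")
      case False
      then obtain x where x: "x \<noteq> 0" "g x \<in> \<langle>{y}\<rangle>" using g_surj by blast
      then have "y \<in> \<langle>{g x}\<rangle>" using span_singleton_sym g_nonzero by blast
      then have "y \<in> \<langle>{l x}\<rangle>" using g_in_l[OF x(1)] span_subset_single by blast
      then obtain c where "y = scale c (l x)" using span_singleton by blast
      then show "\<exists>x. l x = y" using sg_surj l_scale by metis
    qed (auto intro: exI[of _ 0])
  qed
  then have "bij l" using l_inj by (simp add: bij_def inj_def)
  ultimately show ?thesis
    unfolding semilinear_automorphism_def division_ring_automorphism_def
    using l_add l_scale add mult one by blast
qed

end

lemma (in collineation) fundamental_theorem: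
  "\<exists>l. semilinear_automorphism scale l \<and> (\<forall>x. x \<noteq> 0 \<longrightarrow> l x \<noteq> 0 \<and> l x \<in> \<langle>{g x}\<rangle>)"
proof -
  obtain e where "e \<notin> \<langle>{0, 0}\<rangle>" using large by blast
  then have "e \<noteq> 0" using span_0 by blast
  then interpret pointed_collineation scale g e by unfold_locales
  show ?thesis using semilinear l_nonzero l_in by blast
qed

section \<open>Cardinalities\<close>

lemma card_of_exchange:
  assumes "x \<in> S" "y \<notin> S"
  shows "|insert y (S - {x})| =o |S|"
proof -
  have "bij_betw (\<lambda>z. if z = x then y else z) S (insert y (S - {x}))"
    using assms by (auto simp: bij_betw_def inj_on_def)
  then show ?thesis using card_of_ordIsoI ordIso_symmetric by blast
qed

lemma card_of_sandwich:
  assumes "A \<subseteq> B" "|C| =o |B|" "C \<subseteq> A"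
  shows "|A| =o |B|"
proof -
  have "|C| \<le>o |A|" "|A| \<le>o |B|" using assms card_of_mono1 by blast+
  then show ?thesis using assms(2) ordIso_iff_ordLeq ordIso_ordLeq_trans ordIso_symmetric by blast
qed

text \<open>Two parts serve to construct a pair of members; the third is kept in reserve, so that
  what remains still has full cardinality.\<close>

lemma infinite_split3:
  assumes "infinite B"
  obtains D1 D2 D3 where "D1 \<subseteq> B" "D2 \<subseteq> B" "D3 \<subseteq> B" "D1 \<inter> D2 = {}" "D1 \<inter> D3 = {}" "D2 \<inter> D3 = {}"
    "|D1| =o |B|" "|D2| =o |B|" "|D3| =o |B|"
proof -
  have "|B \<times> {0, 1, 2::nat}| =o |B|"
    using assms by (intro card_of_Times_infinite_simps finite_ordLeq_infinite) auto
  then obtain h where h: "bij_betw h (B \<times> {0, 1, 2::nat}) B" using card_of_ordIso by blast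
  have img: "h ` (B \<times> {0, 1, 2}) = B" and inj: "inj_on h (B \<times> {0, 1, 2})"
    using h by (auto simp: bij_betw_def)
  let ?D = "\<lambda>i. h ` (B \<times> {i})"
  have sub: "?D i \<subseteq> B" if "i \<in> {0, 1, 2}" for i
    using that img by (metis image_mono Sigma_mono empty_subsetI insert_subset order_refl)
  have disj: "?D i \<inter> ?D j = {}" if "i \<in> {0, 1, 2}" "j \<in> {0, 1, 2}" "i \<noteq> j" for i j
  proof -
    have "?D i \<inter> ?D j = h ` (B \<times> {i} \<inter> B \<times> {j})"
      using that by (intro inj_on_image_Int[OF inj, symmetric]) auto
    also have "B \<times> {i} \<inter> B \<times> {j} = {}" using that by auto
    finally show ?thesis by simp
  qed
  have card: "|?D i| =o |B|" if "i \<in> {0, 1, 2}" for i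
  proof -
    have "bij_betw (\<lambda>b. h (b, i)) B (?D i)"
      using that inj by (auto simp: bij_betw_def inj_on_def)
    then show ?thesis using card_of_ordIsoI ordIso_symmetric by blast
  qed
  show ?thesis using that[of "?D 0" "?D 1" "?D 2"] sub disj card by simp
qed

lemma obtain_card:
  assumes "Card_order r" "r \<le>o |D|"
  obtains E where "E \<subseteq> D" "|E| =o r"
proof -
  have 1: "|Field r| =o r" using assms(1) by (rule card_of_Field_ordIso)
  then have "|Field r| \<le>o |D|" using assms(2) ordIso_ordLeq_trans by blast
  then obtain h where h: "inj_on h (Field r)" "h ` Field r \<subseteq> D"
    using card_of_ordLeq[of "Field r" D] by auto
  have "|Field r| =o |h ` Field r|"
    by (rule card_of_ordIsoI[OF inj_on_imp_bij_betw[OF h(1)]])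
  then have "|h ` Field r| =o r" using 1 ordIso_transitive ordIso_symmetric by blast
  then show ?thesis using that h(2) by blast
qed

lemma card_of_empty_Field: "|{}::'a set| =o r \<Longrightarrow> Field r = {}"
  unfolding ordIso_def iso_def by (auto simp: bij_betw_def Field_card_of)

lemma obtain_card_containing:
  assumes "Card_order r" "r \<le>o |D|" "p \<in> D" "Field r \<noteq> {}"
  obtains E where "E \<subseteq> D" "p \<in> E" "|E| =o r"
proof -
  obtain E where E: "E \<subseteq> D" "|E| =o r" using obtain_card assms by blast
  show ?thesis
  proof (cases "p \<in> E")
    case False
    have "E \<noteq> {}" using E card_of_empty_Field assms(4) by metis
    then obtain x where x: "x \<in> E" by blast
    have "|insert p (E - {x})| =o r" by (rule ordIso_transitive[OF card_of_exchange[OF x False] E(2)])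
    then show ?thesis using that[of "insert p (E - {x})"] E assms(3) by auto
  qed (use E that in blast)
qed

lemma card_of_singleton: "|S| =o |{x}| \<Longrightarrow> \<exists>s. S = {s}"
proof -
  assume "|S| =o |{x}|"
  then obtain h where "bij_betw h S {x}" using card_of_ordIso[of S "{x}"] by auto
  then have "card S = 1" using bij_betw_same_card by force
  then show ?thesis by (simp add: card_1_singleton_iff)
qed

lemma card_of_Diff_finite:
  assumes "infinite A" "finite F"
  shows "|A - F| =o |A|"
proof -
  have inf: "infinite (A - F)" using assms by simp
  have "|A| \<le>o |(A - F) \<union> F|" by (rule card_of_mono1) auto
  also have "|(A - F) \<union> F| \<le>o |(A - F) <+> F|" by (rule card_of_Un_Plus_ordLeq)
  also have "|(A - F) <+> F| =o |A - F|"
    using card_of_Plus_infinite1[OF inf finite_ordLeq_infinite[OF assms(2) inf]] .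
  finally have "|A| \<le>o |A - F|" .
  moreover have "|A - F| \<le>o |A|" by (rule card_of_mono1) auto
  ultimately show ?thesis using ordIso_iff_ordLeq by blast
qed

lemma Field_empty_card_of: "Field r = {} \<Longrightarrow> |A| =o r \<Longrightarrow> A = {}"
  using card_of_empty_Field unfolding ordIso_def iso_def by (auto simp: bij_betw_def Field_card_of)

section \<open>Bases\<close>

context left_vector_space
begin

lemma basis_iff: "lvs_basis scale B \<longleftrightarrow> indep B \<and> \<langle>B\<rangle> = UNIV"
  by (rule ops_basis_iff)

lemma basisD: "lvs_basis scale B \<Longrightarrow> indep B" "lvs_basis scale B \<Longrightarrow> \<langle>B\<rangle> = UNIV"
  by (simp_all add: basis_iff)

lemma basis_nonzero: "lvs_basis scale B \<Longrightarrow> b \<in> B \<Longrightarrow> b \<noteq> 0"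
  using span_0 by (auto simp: basis_iff indep_def)

lemma basis_notin: "lvs_basis scale B \<Longrightarrow> b \<in> B \<Longrightarrow> b \<notin> \<langle>B - {b}\<rangle>"
  by (auto simp: basis_iff indep_def)

lemma basis_Int_span: "lvs_basis scale B \<Longrightarrow> S \<subseteq> B \<Longrightarrow> B \<inter> \<langle>S\<rangle> = S"
  using in_cl_indep_iff[of B S] by (auto simp: basis_iff)

lemma basis_extend:
  assumes "indep I"
  obtains B where "I \<subseteq> B" "lvs_basis scale B"
proof -
  have "lvs_subspace scale UNIV" by (simp add: closed_under_ops_def)
  then obtain J where "I \<subseteq> J" "indep J" "\<langle>J\<rangle> = UNIV" by (rule obtain_basis[OF _ assms]) auto
  then show ?thesis by (intro that[of J]) (simp_all add: basis_iff)
qed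

lemma span_eq_singleton:
  assumes "x \<in> \<langle>{y}\<rangle>" "x \<noteq> 0"
  shows "\<langle>{x}\<rangle> = \<langle>{y}\<rangle>"
proof (rule span_eqI)
  show "{x} \<subseteq> \<langle>{y}\<rangle>" using assms by simp
  show "{y} \<subseteq> \<langle>{x}\<rangle>" using assms
    by (metis empty_subsetI insert_subset scale_inverse(1) scale_zero_left span_singleton)
qed

lemma basis_eq:
  assumes B: "lvs_basis scale B" and sp: "\<langle>C\<rangle> = UNIV" and C: "C \<subseteq> B"
  shows "C = B"
  using basis_Int_span[OF B C] sp by auto

text \<open>A basis vector missing from the intersection is missing from some member of the family,
  so every vector of the intersection has coordinate zero there.\<close>

lemma span_Int_family:
  assumes B: "lvs_basis scale B" and X: "\<And>X. X \<in> \<X> \<Longrightarrow> X = \<langle>B \<inter> X\<rangle>"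
  shows "\<langle>B \<inter> \<Inter>\<X>\<rangle> = \<Inter>\<X>"
proof
  show "\<langle>B \<inter> \<Inter>\<X>\<rangle> \<subseteq> \<Inter>\<X>"
  proof (rule Inter_greatest)
    fix Y assume "Y \<in> \<X>"
    then show "\<langle>B \<inter> \<Inter>\<X>\<rangle> \<subseteq> Y" using X[of Y] span_mono[of "B \<inter> \<Inter>\<X>" "B \<inter> Y"] by blast
  qed
  show "\<Inter>\<X> \<subseteq> \<langle>B \<inter> \<Inter>\<X>\<rangle>"
  proof
    fix v assume v: "v \<in> \<Inter>\<X>"
    have "\<forall>b\<in>B - B \<inter> \<Inter>\<X>. v \<in> \<langle>B - {b}\<rangle>"
    proof
      fix b assume "b \<in> B - B \<inter> \<Inter>\<X>"
      then obtain Y where Y: "Y \<in> \<X>" "b \<notin> Y" by blast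
      then have "v \<in> \<langle>B \<inter> Y\<rangle>" using v X by auto
      moreover have "B \<inter> Y \<subseteq> B - {b}" using Y by auto
      ultimately show "v \<in> \<langle>B - {b}\<rangle>" using span_mono by blast
    qed
    then show "v \<in> \<langle>B \<inter> \<Inter>\<X>\<rangle>" using cl_subset_iff[of B "B \<inter> \<Inter>\<X>" v] B by (simp add: basis_iff)
  qed
qed

lemma span_Int:
  assumes B: "lvs_basis scale B" and ST: "S \<subseteq> B" "T \<subseteq> B"
  shows "\<langle>S\<rangle> \<inter> \<langle>T\<rangle> = \<langle>S \<inter> T\<rangle>"
proof -
  have "\<langle>B \<inter> \<Inter>{\<langle>S\<rangle>, \<langle>T\<rangle>}\<rangle> = \<Inter>{\<langle>S\<rangle>, \<langle>T\<rangle>}"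
    by (rule span_Int_family[OF B]) (use basis_Int_span[OF B] ST in auto)
  moreover have "B \<inter> \<Inter>{\<langle>S\<rangle>, \<langle>T\<rangle>} = S \<inter> T" using basis_Int_span[OF B] ST by blast
  ultimately show ?thesis by simp
qed

lemma span_Un_span: "\<langle>\<langle>S\<rangle> \<union> \<langle>T\<rangle>\<rangle> = \<langle>S \<union> T\<rangle>"
proof (rule span_eqI)
  show "\<langle>S\<rangle> \<union> \<langle>T\<rangle> \<subseteq> \<langle>S \<union> T\<rangle>" by (simp add: span_mono)
  show "S \<union> T \<subseteq> \<langle>\<langle>S\<rangle> \<union> \<langle>T\<rangle>\<rangle>" using span_superset by blast
qed

lemma span_Un_split: "v \<in> \<langle>S \<union> T\<rangle> \<Longrightarrow> \<exists>x\<in>\<langle>S\<rangle>. v - x \<in> \<langle>T\<rangle>"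
proof -
  assume v: "v \<in> \<langle>S \<union> T\<rangle>"
  let ?W = "{v. \<exists>x\<in>\<langle>S\<rangle>. v - x \<in> \<langle>T\<rangle>}"
  have "lvs_subspace scale ?W"
    unfolding closed_under_ops_def
  proof (intro conjI ballI allI)
    show "0 \<in> ?W" using span_0 by (auto intro!: bexI[of _ 0])
    fix a assume "a \<in> ?W"
    then obtain x where x: "x \<in> \<langle>S\<rangle>" "a - x \<in> \<langle>T\<rangle>" by blast
    show "scale k a \<in> ?W" for k
      using span_scale[OF x(1), of k] span_scale[OF x(2), of k] by (auto simp: scale_diff_right)
    fix b assume "b \<in> ?W"
    then obtain y where y: "y \<in> \<langle>S\<rangle>" "b - y \<in> \<langle>T\<rangle>" by blast
    have "(a + b) - (x + y) \<in> \<langle>T\<rangle>" using span_add[OF x(2) y(2)] by (simp add: algebra_simps)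
    then show "a + b \<in> ?W" using span_add[OF x(1) y(1)] by blast
  qed
  moreover have "S \<union> T \<subseteq> ?W"
  proof
    fix a assume "a \<in> S \<union> T"
    then show "a \<in> ?W" using span_base[of a S] span_base[of a T] by (auto intro: bexI[of _ a] bexI[of _ 0])
  qed
  ultimately show ?thesis using span_minimal v by blast
qed

lemma basis_ordIso:
  assumes "lvs_basis scale B" "lvs_basis scale C"
  shows "|B| =o |C|"
  using assms by (intro indep_ordIso) (auto simp: basis_iff)

lemma identity_semilinear: "semilinear_automorphism scale (\<lambda>x. x)"
  unfolding semilinear_automorphism_def division_ring_automorphism_def
  by (auto intro!: exI[of _ "\<lambda>a. a"] simp: bij_def inj_def surj_def)

lemma lvs_dim_basis: "lvs_basis scale B \<Longrightarrow> |B| =o lvs_dim scale UNIV"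
  using lvs_dim_span[of B] basisD ordIso_symmetric by metis

lemma Card_order_lvs_dim: "Card_order (lvs_dim scale X)"
  unfolding ops_dim_def by (rule card_of_Card_order)

lemma cinfinite_dim_imp_infinite_basis:
  assumes "cinfinite (lvs_dim scale UNIV)" "lvs_basis scale B"
  shows "infinite B"
proof -
  have "cinfinite |B|"
    using assms(1) by (rule cinfinite_mono[rotated])
      (rule ordIso_imp_ordLeq[OF ordIso_symmetric[OF lvs_dim_basis[OF assms(2)]]])
  then show ?thesis by (simp add: cinfinite_def Field_card_of)
qed

lemma adapted_basis:
  assumes "lvs_subspace scale X"
  obtains S B where "S \<subseteq> B" "lvs_basis scale B" "X = \<langle>S\<rangle>" "lvs_dim scale X =o |S|" "lvs_codim scale X =o |B - S|"
proof -
  obtain S where S: "indep S" "\<langle>S\<rangle> = X" by (rule obtain_basis[OF assms indep_empty]) (simp add: sub_0[OF assms])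
  obtain B where B: "S \<subseteq> B" "lvs_basis scale B" by (rule basis_extend[OF S(1)])
  show ?thesis using that[OF B] S lvs_dim_span[OF S(1)] lvs_codim_span[OF B(2,1)] by simp
qed

end

text \<open>A unitriangular change of basis: \<open>K\<close> is fixed and the other vectors are
  corrected by elements of its span. Most changes of apartment below are of this kind.\<close>

locale basis_shear = left_vector_space scale
  for scale :: "'k::division_ring \<Rightarrow> 'v::ab_group_add \<Rightarrow> 'v" +
  fixes B K :: "'v set" and u :: "'v \<Rightarrow> 'v"
  assumes basis_B: "lvs_basis scale B" and KB: "K \<subseteq> B"
    and fixed: "k \<in> K \<Longrightarrow> u k = k"
    and moved: "d \<in> B - K \<Longrightarrow> u d - d \<in> \<langle>K\<rangle>"
begin

text \<open>The corrections lie in the span of fixed vectors of \<open>S\<close>, so they can be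
  undone inside either span. This is how members common to two apartments are recognized.\<close>

lemma span_shear:
  assumes S: "S \<subseteq> B" "\<And>d. d \<in> S - K \<Longrightarrow> u d - d \<in> \<langle>S \<inter> K\<rangle>"
  shows "\<langle>u ` S\<rangle> = \<langle>S\<rangle>"
proof (rule span_eqI; rule subsetI)
  fix y assume "y \<in> u ` S"
  then obtain s where s: "s \<in> S" "y = u s" by blast
  show "y \<in> \<langle>S\<rangle>"
  proof (cases "s \<in> K")
    case False
    then have "u s - s \<in> \<langle>S\<rangle>" using S s span_mono[of "S \<inter> K" S] by blast
    then have "(u s - s) + s \<in> \<langle>S\<rangle>" using span_base[OF s(1)] by (rule span_add)
    then show ?thesis using s by simp
  qed (use s fixed span_base in simp)
next
  fix s assume s: "s \<in> S"
  show "s \<in> \<langle>u ` S\<rangle>"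
  proof (cases "s \<in> K")
    case True
    then have "s \<in> u ` S" using s fixed by (metis imageI)
    then show ?thesis by (rule span_base)
  next
    case False
    have "S \<inter> K \<subseteq> u ` S" using fixed by (metis IntE imageI subsetI)
    then have "u s - s \<in> \<langle>u ` S\<rangle>" using False S s span_mono by blast
    with span_base[OF imageI[OF s]] have "u s - (u s - s) \<in> \<langle>u ` S\<rangle>" by (rule span_diff)
    then show ?thesis by simp
  qed
qed

text \<open>In coordinates with respect to \<open>B\<close>, among the sheared vectors only
  \<open>u d\<close> has a nonzero \<open>d\<close>-coordinate; the other half is
  \<open>shear_notin\<close>. Independence and injectivity follow from the two.\<close>

lemma shear_in: "d \<in> B - K \<Longrightarrow> y \<in> B \<Longrightarrow> y \<noteq> d \<Longrightarrow> u y \<in> \<langle>B - {d}\<rangle>"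
proof (cases "y \<in> K")
  case False
  assume d: "d \<in> B - K" "y \<in> B" "y \<noteq> d"
  then have "K \<subseteq> B - {d}" using KB by auto
  then have "u y - y \<in> \<langle>B - {d}\<rangle>" using moved[of y] False d span_mono by blast
  moreover have "y \<in> \<langle>B - {d}\<rangle>" using d by (intro span_base) auto
  ultimately have "(u y - y) + y \<in> \<langle>B - {d}\<rangle>" by (rule span_add)
  then show "u y \<in> \<langle>B - {d}\<rangle>" by simp
qed (use fixed span_base in simp)

lemma shear_notin: "d \<in> B - K \<Longrightarrow> u d \<notin> \<langle>B - {d}\<rangle>"
proof
  assume d: "d \<in> B - K" and ud: "u d \<in> \<langle>B - {d}\<rangle>"
  have "K \<subseteq> B - {d}" using d KB by auto
  then have "u d - d \<in> \<langle>B - {d}\<rangle>" using moved[OF d] span_mono by blast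
  with ud have "u d - (u d - d) \<in> \<langle>B - {d}\<rangle>" by (rule span_diff)
  then show False using basis_notin[OF basis_B] d by simp
qed

lemma shear_inj: "inj_on u B"
proof (rule inj_onI)
  fix x y assume xy: "x \<in> B" "y \<in> B" "u x = u y"
  show "x = y"
  proof (rule ccontr)
    assume ne: "x \<noteq> y"
    consider "x \<in> K" "y \<in> K" | "x \<in> B - K" | "y \<in> B - K" using xy by blast
    then show False
    proof cases
      case 1
      then show False using xy ne fixed by simp
    next
      case 2
      then show False using shear_in[of x y] shear_notin[of x] xy ne by simp
    next
      case 3
      then show False using shear_in[of y x] shear_notin[of y] xy ne by simp
    qed
  qed
qed

lemma shear_basis: "lvs_basis scale (u ` B)"
  unfolding basis_iff
proof
  have "indep (K \<union> u ` (B - K))"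
  proof (rule indep_Un)
    show "indep K" using KB basis_B basis_iff indep_subset by blast
    fix e assume "e \<in> u ` (B - K)"
    then obtain d where d: "d \<in> B - K" "e = u d" by blast
    have "K \<union> u ` (B - K) - {e} \<subseteq> \<langle>B - {d}\<rangle>" (is "?L \<subseteq> _")
    proof
      fix y assume y: "y \<in> K \<union> u ` (B - K) - {e}"
      then have "\<exists>z\<in>B. y = u z" using fixed KB by force
      then obtain z where z: "z \<in> B" "y = u z" by blast
      then have "z \<noteq> d" using y d(2) by auto
      then show "y \<in> \<langle>B - {d}\<rangle>" using shear_in[OF d(1)] z by simp
    qed
    then have "\<langle>?L\<rangle> \<subseteq> \<langle>B - {d}\<rangle>" by (rule cl_least)
    then show "e \<notin> \<langle>?L\<rangle>" using shear_notin[OF d(1)] d(2) by auto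
  qed
  moreover have "K \<union> u ` (B - K) = u ` B" using KB fixed by force
  ultimately show "indep (u ` B)" by simp
  have "B \<inter> K = K" using KB by auto
  then show "\<langle>u ` B\<rangle> = UNIV" using span_shear[of B] moved basis_B by (simp add: basis_iff)
qed

end

section \<open>Apartments\<close>

text \<open>Dimension \<open>\<beta>\<close> and codimension \<open>\<gamma>\<close> are both
  parameters, which covers the two kinds of Grassmannian at once. \<open>sizes\<close> makes one of
  them \<alpha>, represented by the cardinality of a basis, and the nonempty fields exclude
  zero.\<close>

locale grassmannian = left_vector_space scale
  for scale :: "'k::division_ring \<Rightarrow> 'v::ab_group_add \<Rightarrow> 'v" +
  fixes \<beta> :: "'c rel" and \<gamma> :: "'d rel"
  assumes infinite_basis: "lvs_basis scale B \<Longrightarrow> infinite B"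
    and card_\<beta>: "Card_order \<beta>" and card_\<gamma>: "Card_order \<gamma>"
    and \<beta>_nonempty: "Field \<beta> \<noteq> {}" and \<gamma>_nonempty: "Field \<gamma> \<noteq> {}"
    and sizes: "lvs_basis scale B \<Longrightarrow> \<beta> \<le>o |B| \<and> |B| =o \<gamma> \<or> |B| =o \<beta> \<and> \<gamma> \<le>o |B|"
begin

definition G :: "'v set set" where
  "G = {X. lvs_subspace scale X \<and> lvs_dim scale X =o \<beta> \<and> lvs_codim scale X =o \<gamma>}"

definition sel :: "'v set \<Rightarrow> 'v set \<Rightarrow> bool" where
  "sel B S \<longleftrightarrow> S \<subseteq> B \<and> |S| =o \<beta> \<and> |B - S| =o \<gamma>"

abbreviation Ap :: "'v set \<Rightarrow> 'v set set" where
  "Ap \<equiv> apartment_of scale G"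

lemma ordIso_cong: "r =o s \<Longrightarrow> r =o t \<longleftrightarrow> s =o t"
  by (meson ordIso_transitive ordIso_symmetric)

lemma G_sub: "X \<in> G \<Longrightarrow> lvs_subspace scale X"
  by (simp add: G_def)

lemma span_in_G:
  assumes "lvs_basis scale B" "S \<subseteq> B"
  shows "\<langle>S\<rangle> \<in> G \<longleftrightarrow> sel B S"
proof -
  have "indep S" using assms basisD(1) indep_subset by blast
  then show ?thesis
    using assms
    by (simp add: G_def sel_def span_sub ordIso_cong[OF lvs_dim_span] ordIso_cong[OF lvs_codim_span])
qed

lemma Ap_iff: "lvs_basis scale B \<Longrightarrow> X \<in> Ap B \<longleftrightarrow> (\<exists>S. sel B S \<and> X = \<langle>S\<rangle>)"
  using span_in_G by (auto simp: apartment_of_def sel_def)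

lemma Ap_subset_G: "Ap B \<subseteq> G"
  by (auto simp: apartment_of_def)

lemma ApI: "X \<in> G \<Longrightarrow> S \<subseteq> B \<Longrightarrow> X = \<langle>S\<rangle> \<Longrightarrow> X \<in> Ap B"
  by (auto simp: apartment_of_def)

lemma Ap_trace:
  assumes B: "lvs_basis scale B" and X: "X \<in> Ap B"
  shows "sel B (B \<inter> X)" "X = \<langle>B \<inter> X\<rangle>"
proof -
  obtain S where S: "sel B S" "X = \<langle>S\<rangle>" using X Ap_iff[OF B] by blast
  then have "B \<inter> X = S" using basis_Int_span[OF B, of S] by (simp add: sel_def)
  then show "sel B (B \<inter> X)" "X = \<langle>B \<inter> X\<rangle>" using S by simp_all
qed

lemma sel_trace: "lvs_basis scale B \<Longrightarrow> sel B S \<Longrightarrow> b \<in> B \<Longrightarrow> b \<in> \<langle>S\<rangle> \<longleftrightarrow> b \<in> S"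
  using basis_Int_span[of B S] by (auto simp: sel_def)

lemma sel_nonempty:
  assumes "sel B S"
  shows "S \<noteq> {}" "B - S \<noteq> {}"
  using assms card_of_empty_Field \<beta>_nonempty \<gamma>_nonempty unfolding sel_def by metis+

text \<open>A set of the smaller cardinal is placed inside \<open>D1\<close>; the disjoint
  \<open>D2\<close> keeps its complement at full size.\<close>

lemma ex_sel:
  assumes "lvs_basis scale B"
  shows "\<exists>S. sel B S"
proof -
  obtain D1 D2 D3 where D: "D1 \<subseteq> B" "D2 \<subseteq> B" "D1 \<inter> D2 = {}" "|D1| =o |B|" "|D2| =o |B|"
    using infinite_split3[OF infinite_basis[OF assms]] by metis
  consider "\<beta> \<le>o |B|" "|B| =o \<gamma>" | "|B| =o \<beta>" "\<gamma> \<le>o |B|" using sizes[OF assms] by blast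
  then show ?thesis
  proof cases
    case 1
    have "\<beta> \<le>o |D1|" using 1 D(4) ordIso_symmetric ordLeq_ordIso_trans by blast
    then obtain E where E: "E \<subseteq> D1" "|E| =o \<beta>" using obtain_card[OF card_\<beta>] by blast
    have "|B - E| =o |B|" by (rule card_of_sandwich[OF _ D(5)]) (use D E in auto)
    then have "sel B E" using E D 1 ordIso_transitive unfolding sel_def by blast
    then show ?thesis by blast
  next
    case 2
    have "\<gamma> \<le>o |D1|" using 2 D(4) ordIso_symmetric ordLeq_ordIso_trans by blast
    then obtain E where E: "E \<subseteq> D1" "|E| =o \<gamma>" using obtain_card[OF card_\<gamma>] by blast
    have "|B - E| =o |B|" by (rule card_of_sandwich[OF _ D(5)]) (use D E in auto)
    then have "|B - E| =o \<beta>" using 2 ordIso_transitive by blast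
    moreover have "B - (B - E) = E" using E D by auto
    ultimately have "sel B (B - E)" using E unfolding sel_def by auto
    then show ?thesis by blast
  qed
qed

lemma sel_exchange:
  assumes "sel B S" "x \<in> S" "y \<in> B - S"
  shows "sel B (insert y (S - {x}))"
proof -
  have "B - insert y (S - {x}) = insert x ((B - S) - {y})" using assms by (auto simp: sel_def)
  moreover have "|insert x ((B - S) - {y})| =o |B - S|" using assms by (intro card_of_exchange) auto
  moreover have "|insert y (S - {x})| =o |S|" using assms by (intro card_of_exchange) auto
  ultimately show ?thesis using assms by (auto simp: sel_def intro: ordIso_transitive)
qed

text \<open>An element of \<open>S\<close> outside \<open>I\<close> is given up for
  \<open>x\<close>. The alternative \<open>S \<noteq> I\<close> provides that element; it can break
  down for singletons, which is where degenerate cases arise.\<close>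

lemma sel_force_in:
  assumes "sel B S" "I \<subseteq> S" "J \<inter> S = {}" "x \<in> B" "x \<notin> J" "x \<in> I \<or> S \<noteq> I"
  shows "\<exists>S'. sel B S' \<and> insert x I \<subseteq> S' \<and> J \<inter> S' = {}"
proof (cases "x \<in> S")
  case False
  then obtain y where "y \<in> S" "y \<notin> I" using assms by blast
  then have "sel B (insert x (S - {y}))" "insert x I \<subseteq> insert x (S - {y})" "J \<inter> insert x (S - {y}) = {}"
    using assms False sel_exchange by auto
  then show ?thesis by blast
qed (use assms in blast)

lemma sel_force_out:
  assumes "sel B S" "I \<subseteq> S" "J \<inter> S = {}" "y \<in> B" "y \<notin> I" "y \<in> J \<or> B - S \<noteq> J" "J \<subseteq> B"
  shows "\<exists>S'. sel B S' \<and> I \<subseteq> S' \<and> insert y J \<inter> S' = {}"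
proof (cases "y \<in> S")
  case True
  then obtain x where "x \<in> B - S" "x \<notin> J" using assms by blast
  then have "sel B (insert x (S - {y}))" "I \<subseteq> insert x (S - {y})" "insert y J \<inter> insert x (S - {y}) = {}"
    using assms True sel_exchange[of B S y x] by auto
  then show ?thesis by blast
qed (use assms in blast)

lemma sel_separating:
  assumes B: "lvs_basis scale B" and ij: "i \<in> B" "j \<in> B" "i \<noteq> j"
  shows "\<exists>S. sel B S \<and> i \<in> S \<and> j \<notin> S"
proof -
  obtain S0 where S0: "sel B S0" using ex_sel[OF B] by blast
  obtain S1 where S1: "sel B S1" "i \<in> S1"
    using sel_force_in[of B S0 "{}" "{}" i] S0 sel_nonempty ij by auto
  obtain S2 where "sel B S2" "i \<in> S2" "j \<notin> S2"
    using sel_force_out[of B S1 "{i}" "{}" j] S1 sel_nonempty ij by auto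
  then show ?thesis by blast
qed

text \<open>Dimension one and codimension one are excluded. There \<open>Cset B i j\<close> consists
  of the line of \<open>i\<close>, respectively of the span of \<open>B - {j}\<close>, so one index
  is lost.\<close>

definition nondegenerate :: bool where
  "nondegenerate \<longleftrightarrow> (\<forall>B S x. lvs_basis scale B \<longrightarrow> sel B S \<longrightarrow> S \<noteq> {x} \<and> B - S \<noteq> {x})"

lemma sel_separating2:
  assumes nd: nondegenerate and B: "lvs_basis scale B"
    and el: "i \<in> B" "k \<in> B" "j \<in> B" "m \<in> B" and disj: "{i, k} \<inter> {j, m} = {}"
  shows "\<exists>S. sel B S \<and> i \<in> S \<and> k \<in> S \<and> j \<notin> S \<and> m \<notin> S"
proof -
  have nd': "S \<noteq> {x}" "B - S \<noteq> {x}" if "sel B S" for S x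
    using nd B that unfolding nondegenerate_def by blast+
  obtain S0 where S0: "sel B S0" "i \<in> S0" "j \<notin> S0"
    using sel_separating[OF B el(1,3)] disj by auto
  obtain S1 where S1: "sel B S1" "i \<in> S1" "k \<in> S1" "j \<notin> S1"
    using sel_force_in[of B S0 "{i}" "{j}" k] S0 el disj nd'(1)[OF S0(1), of i] by auto
  obtain S2 where S2: "sel B S2" "{i, k} \<subseteq> S2" "{m, j} \<inter> S2 = {}"
    using sel_force_out[of B S1 "{i, k}" "{j}" m] S1 el disj nd'(2)[OF S1(1), of j] by auto
  then show ?thesis by blast
qed

section \<open>How the sets \<open>Cset B i j\<close> determine an apartment\<close>

definition Cset :: "'v set \<Rightarrow> 'v \<Rightarrow> 'v \<Rightarrow> 'v set set" where
  "Cset B i j = {X \<in> Ap B. i \<in> X \<and> j \<notin> X}"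

lemma Cset_span_iff:
  assumes "lvs_basis scale B" "sel B S" "i \<in> B" "j \<in> B"
  shows "\<langle>S\<rangle> \<in> Cset B i j \<longleftrightarrow> i \<in> S \<and> j \<notin> S"
  using assms sel_trace Ap_iff unfolding Cset_def by blast

lemma Cset_disjoint_iff:
  assumes nd: nondegenerate and B: "lvs_basis scale B"
    and el: "i \<in> B" "j \<in> B" "k \<in> B" "m \<in> B" and ne: "i \<noteq> j" "k \<noteq> m"
  shows "Cset B i j \<inter> Cset B k m = {} \<longleftrightarrow> i = m \<or> j = k"
proof
  assume dis: "Cset B i j \<inter> Cset B k m = {}"
  show "i = m \<or> j = k"
  proof (rule ccontr)
    assume "\<not> (i = m \<or> j = k)"
    then obtain S where S: "sel B S" "i \<in> S" "k \<in> S" "j \<notin> S" "m \<notin> S"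
      using sel_separating2[OF nd B, of i k j m] el ne by auto
    then have "\<langle>S\<rangle> \<in> Cset B i j \<inter> Cset B k m" using Cset_span_iff[OF B] el by simp
    then show False using dis by blast
  qed
qed (auto simp: Cset_def)

text \<open>If \<open>k \<noteq> i\<close>, some member contains \<open>k\<close> but neither
  \<open>m\<close> nor \<open>i\<close>; if \<open>m \<noteq> j\<close>, some member contains
  \<open>k\<close> and \<open>j\<close> but not \<open>m\<close>. This later turns inclusions
  between such sets into equalities.\<close>

lemma Cset_subset:
  assumes nd: nondegenerate and B: "lvs_basis scale B"
    and el: "i \<in> B" "j \<in> B" "k \<in> B" "m \<in> B" and ne: "i \<noteq> j" "k \<noteq> m"
    and sub: "Cset B k m \<subseteq> Cset B i j"
  shows "k = i" "m = j"
proof -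
  have no: "\<not> (k \<in> S \<and> m \<notin> S \<and> (i \<notin> S \<or> j \<in> S))" if S: "sel B S" for S
    using sub Cset_span_iff[OF B S] el by blast
  show ki: "k = i"
  proof (rule ccontr)
    assume "k \<noteq> i"
    then obtain S where "sel B S" "k \<in> S" "m \<notin> S" "i \<notin> S"
      using sel_separating2[OF nd B, of k k m i] el ne by auto
    then show False using no by blast
  qed
  show "m = j"
  proof (rule ccontr)
    assume "m \<noteq> j"
    then obtain S where "sel B S" "k \<in> S" "m \<notin> S" "j \<in> S"
      using sel_separating2[OF nd B, of k j m m] el ne by auto
    then show False using no by blast
  qed
qed

text \<open>A member that contains \<open>j\<close> whenever it contains \<open>i\<close> survives
  the replacement of \<open>i\<close> by \<open>i + j\<close>. A member with \<open>i\<close> but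
  without \<open>j\<close> is lost, since in the new basis only \<open>i + j\<close> has a nonzero
  \<open>i\<close>-coordinate.\<close>

lemma other_apartment:
  assumes B: "lvs_basis scale B" and ij: "i \<in> B" "j \<in> B" "i \<noteq> j"
  obtains C where "lvs_basis scale C" "Ap B - Cset B i j \<subseteq> Ap C" "Ap C \<noteq> Ap B"
proof -
  define u where "u = (\<lambda>b. if b = i then i + j else b)"
  interpret basis_shear scale B "B - {i}" u
    using B ij by unfold_locales (auto simp: u_def span_base)
  show ?thesis
  proof (rule that)
    show "lvs_basis scale (u ` B)" by (rule shear_basis)
    show "Ap B - Cset B i j \<subseteq> Ap (u ` B)"
    proof
      fix X assume X: "X \<in> Ap B - Cset B i j"
      let ?S = "B \<inter> X"
      have XS: "X = \<langle>?S\<rangle>" using X Ap_trace[OF B] by blast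
      have j: "i \<in> X \<Longrightarrow> j \<in> X" using X by (auto simp: Cset_def)
      have "\<langle>u ` ?S\<rangle> = \<langle>?S\<rangle>"
        by (rule span_shear) (use ij j in \<open>auto simp: u_def intro: span_base\<close>)
      then show "X \<in> Ap (u ` B)" using X XS Ap_subset_G by (intro ApI[of X "u ` ?S"]) auto
    qed
    obtain S where S: "sel B S" "i \<in> S" "j \<notin> S" using sel_separating[OF B ij] by blast
    have "\<langle>S\<rangle> \<in> Ap B" using S Ap_iff[OF B] by blast
    moreover have "\<langle>S\<rangle> \<notin> Ap (u ` B)"
    proof
      assume "\<langle>S\<rangle> \<in> Ap (u ` B)"
      then obtain T where T: "T \<subseteq> u ` B" "\<langle>S\<rangle> = \<langle>T\<rangle>" by (auto simp: apartment_of_def)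
      have i: "i \<in> \<langle>S\<rangle>" using S span_base by blast
      show False
      proof (cases "i + j \<in> T")
        case True
        then have "i + j \<in> \<langle>S\<rangle>" using T span_base by blast
        then have "(i + j) - i \<in> \<langle>S\<rangle>" using i by (rule span_diff)
        then show False using sel_trace[OF B S(1) ij(2)] S by simp
      next
        case False
        then have "T \<subseteq> B - {i}" using T by (auto simp: u_def)
        then have "i \<in> \<langle>B - {i}\<rangle>" using i T span_mono by blast
        then show False using basis_notin[OF B ij(1)] by blast
      qed
    qed
    ultimately show "Ap (u ` B) \<noteq> Ap B" by blast
  qed
qed

lemma span_image_eq:
  assumes "\<And>s. s \<in> S \<Longrightarrow> \<langle>{c s}\<rangle> = \<langle>{s}\<rangle>"
  shows "\<langle>c ` S\<rangle> = \<langle>S\<rangle>"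
proof (rule span_eqI; rule subsetI)
  fix x assume "x \<in> c ` S"
  then obtain s where s: "s \<in> S" "x = c s" by blast
  have "x \<in> \<langle>{s}\<rangle>" using assms[OF s(1)] s span_base[of x "{x}"] by simp
  then show "x \<in> \<langle>S\<rangle>" using s span_mono[of "{s}" S] by blast
next
  fix s assume s: "s \<in> S"
  have "s \<in> \<langle>{c s}\<rangle>" using assms[OF s] span_base[of s "{s}"] by simp
  then show "s \<in> \<langle>c ` S\<rangle>" using s span_mono[of "{c s}" "c ` S"] by blast
qed

text \<open>The members of \<open>R\<close> through \<open>i\<close> meet in the line of
  \<open>i\<close>. As members of the apartment of \<open>C\<close> they meet in a span of vectors
  of \<open>C\<close>, so \<open>C\<close> contains a multiple of \<open>i\<close>.\<close>

lemma apartment_unique: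
  assumes B: "lvs_basis scale B" and C: "lvs_basis scale C"
    and R: "R \<subseteq> Ap B" "R \<subseteq> Ap C"
    and sep: "\<And>i j. i \<in> B \<Longrightarrow> j \<in> B \<Longrightarrow> i \<noteq> j \<Longrightarrow> \<exists>X\<in>R. i \<in> X \<and> j \<notin> X"
  shows "Ap B = Ap C"
proof -
  have "\<exists>c\<in>C. \<langle>{c}\<rangle> = \<langle>{i}\<rangle>" if i: "i \<in> B" for i
  proof -
    let ?F = "{X \<in> R. i \<in> X}"
    have "B \<inter> \<Inter>?F = {i}" using sep[OF i] i by blast
    then have 1: "\<Inter>?F = \<langle>{i}\<rangle>"
      using span_Int_family[OF B, of ?F] Ap_trace(2)[OF B] R by auto
    have "\<langle>C \<inter> \<Inter>?F\<rangle> = \<Inter>?F"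
      by (rule span_Int_family[OF C]) (use Ap_trace(2)[OF C] R in auto)
    then have 2: "\<langle>C \<inter> \<langle>{i}\<rangle>\<rangle> = \<langle>{i}\<rangle>" by (simp add: 1)
    have "i \<noteq> 0" using basis_nonzero[OF B i] .
    then have "C \<inter> \<langle>{i}\<rangle> \<noteq> {}" using 2 span_base[of i "{i}"] by auto
    then obtain c where c: "c \<in> C" "c \<in> \<langle>{i}\<rangle>" by blast
    then show ?thesis using span_eq_singleton basis_nonzero[OF C] by blast
  qed
  then obtain c where c: "\<And>i. i \<in> B \<Longrightarrow> c i \<in> C" "\<And>i. i \<in> B \<Longrightarrow> \<langle>{c i}\<rangle> = \<langle>{i}\<rangle>" by metis
  have sp: "\<langle>c ` S\<rangle> = \<langle>S\<rangle>" if "S \<subseteq> B" for S using that c by (intro span_image_eq) blast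
  have CB: "c ` B = C" by (rule basis_eq[OF C]) (use sp basisD(2)[OF B] c in auto)
  show ?thesis
  proof (intro equalityI subsetI)
    fix X assume "X \<in> Ap B"
    then obtain S where "X \<in> G" "S \<subseteq> B" "X = \<langle>S\<rangle>" by (auto simp: apartment_of_def)
    then show "X \<in> Ap C" using sp CB by (intro ApI[of X "c ` S"]) auto
  next
    fix X assume "X \<in> Ap C"
    then obtain T where T: "X \<in> G" "T \<subseteq> C" "X = \<langle>T\<rangle>" by (auto simp: apartment_of_def)
    then obtain S where "S \<subseteq> B" "T = c ` S" using CB subset_image_iff by metis
    then show "X \<in> Ap B" using sp T by (intro ApI[of X S]) auto
  qed
qed

end

section \<open>Bijections between arrow sets\<close>

text \<open>
  An arrow \<open>(i, j)\<close> stands for the set of those members of an apartment that contain \<open>i\<close> but not \<open>j\<close>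
  (\<open>Cset\<close> below); consecutive arrows are the ones with disjoint sets.
\<close>

definition arrows :: "'a set \<Rightarrow> ('a \<times> 'a) set" where
  "arrows B = {(i, j). i \<in> B \<and> j \<in> B \<and> i \<noteq> j}"

definition consecutive :: "'a \<times> 'a \<Rightarrow> 'a \<times> 'a \<Rightarrow> bool" where
  "consecutive a b \<longleftrightarrow> fst a = snd b \<or> snd a = fst b"

lemma arrows_iff: "(i, j) \<in> arrows B \<longleftrightarrow> i \<in> B \<and> j \<in> B \<and> i \<noteq> j"
  by (simp add: arrows_def)

text \<open>Arrows that differ in both ends have at most two common consecutive arrows, while arrows
  sharing a tail or a head have infinitely many. So sharing an end is expressible by consecutiveness
  alone.\<close>

lemma common_consecutive_iff:
  assumes inf: "infinite B" and a: "a \<in> arrows B" and b: "b \<in> arrows B"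
  shows "infinite {c \<in> arrows B. consecutive c a \<and> consecutive c b} \<longleftrightarrow> fst a = fst b \<or> snd a = snd b"
    (is "infinite ?N \<longleftrightarrow> _")
proof
  assume N: "infinite ?N"
  show "fst a = fst b \<or> snd a = snd b"
  proof (rule ccontr)
    assume "\<not> (fst a = fst b \<or> snd a = snd b)"
    then have "?N \<subseteq> {(snd b, fst a), (snd a, fst b)}" by (auto simp: consecutive_def)
    then show False using N finite_subset by blast
  qed
next
  assume "fst a = fst b \<or> snd a = snd b"
  then show "infinite ?N"
  proof
    assume eq: "fst a = fst b"
    have "(\<lambda>m. (m, fst a)) ` (B - {fst a}) \<subseteq> ?N"
      using eq a by (auto simp: arrows_def consecutive_def)
    moreover have "infinite ((\<lambda>m. (m, fst a)) ` (B - {fst a}))"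
      using inf by (subst finite_image_iff) (auto simp: inj_on_def)
    ultimately show ?thesis using finite_subset by blast
  next
    assume eq: "snd a = snd b"
    have "(\<lambda>m. (snd a, m)) ` (B - {snd a}) \<subseteq> ?N"
      using eq a by (auto simp: arrows_def consecutive_def)
    moreover have "infinite ((\<lambda>m. (snd a, m)) ` (B - {snd a}))"
      using inf by (subst finite_image_iff) (auto simp: inj_on_def)
    ultimately show ?thesis using finite_subset by blast
  qed
qed

lemma infinite_two:
  assumes "infinite B" "finite F"
  obtains x y where "x \<in> B - F" "y \<in> B - F" "x \<noteq> y"
proof -
  obtain x where x: "x \<in> B - F" using assms infinite_imp_nonempty Diff_infinite_finite by (metis ex_in_conv)
  have "infinite (B - insert x F)" using assms by (intro Diff_infinite_finite) auto
  then obtain y where "y \<in> B - insert x F" using infinite_imp_nonempty by blast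
  then show ?thesis using that x by blast
qed

locale arrow_bijection =
  fixes B :: "'a set" and B' :: "'b set" and \<tau> :: "'a \<times> 'a \<Rightarrow> 'b \<times> 'b"
  assumes inf: "infinite B"
    and bij: "bij_betw \<tau> (arrows B) (arrows B')"
    and consec: "a \<in> arrows B \<Longrightarrow> b \<in> arrows B \<Longrightarrow> consecutive (\<tau> a) (\<tau> b) \<longleftrightarrow> consecutive a b"
begin

lemma \<tau>_in: "a \<in> arrows B \<Longrightarrow> \<tau> a \<in> arrows B'"
  using bij by (rule bij_betw_apply)

lemma \<tau>_inj: "a \<in> arrows B \<Longrightarrow> b \<in> arrows B \<Longrightarrow> \<tau> a = \<tau> b \<Longrightarrow> a = b"
  using bij by (auto simp: bij_betw_def inj_on_def)

lemma infinite_target: "infinite B'"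
proof
  assume "finite B'"
  then have "finite (arrows B')" by (rule_tac finite_subset[of _ "B' \<times> B'"]) (auto simp: arrows_def)
  then have fin: "finite (arrows B)" using bij bij_betw_finite by blast
  obtain x where x: "x \<in> B" using inf infinite_imp_nonempty by blast
  have "infinite ((\<lambda>m. (m, x)) ` (B - {x}))"
    using inf by (subst finite_image_iff) (auto simp: inj_on_def)
  moreover have "(\<lambda>m. (m, x)) ` (B - {x}) \<subseteq> arrows B" using x by (auto simp: arrows_def)
  ultimately show False using fin finite_subset by blast
qed

lemma share:
  assumes a: "a \<in> arrows B" and b: "b \<in> arrows B"
  shows "fst (\<tau> a) = fst (\<tau> b) \<or> snd (\<tau> a) = snd (\<tau> b) \<longleftrightarrow> fst a = fst b \<or> snd a = snd b"
proof -
  let ?N = "{c \<in> arrows B. consecutive c a \<and> consecutive c b}"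
  have im: "\<tau> ` arrows B = arrows B'" using bij by (simp add: bij_betw_def)
  have "{c \<in> arrows B'. consecutive c (\<tau> a) \<and> consecutive c (\<tau> b)} =
      \<tau> ` {c \<in> arrows B. consecutive (\<tau> c) (\<tau> a) \<and> consecutive (\<tau> c) (\<tau> b)}"
    unfolding im[symmetric] by blast
  also have "{c \<in> arrows B. consecutive (\<tau> c) (\<tau> a) \<and> consecutive (\<tau> c) (\<tau> b)} = ?N"
    using consec[OF _ a] consec[OF _ b] by blast
  finally have "{c \<in> arrows B'. consecutive c (\<tau> a) \<and> consecutive c (\<tau> b)} = \<tau> ` ?N" .
  moreover have "inj_on \<tau> ?N" using \<tau>_inj by (auto simp: inj_on_def)
  ultimately have "infinite {c \<in> arrows B'. consecutive c (\<tau> a) \<and> consecutive c (\<tau> b)} \<longleftrightarrow> infinite ?N"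
    by (simp add: finite_image_iff)
  then show ?thesis
    using common_consecutive_iff[OF inf a b]
      common_consecutive_iff[OF infinite_target \<tau>_in[OF a] \<tau>_in[OF b]] by blast
qed

text \<open>The arrows leaving \<open>i\<close> go to arrows with one common tail;
  \<open>head_row\<close> is the alternative of a common head. The two correspond to the preserving
  and the reversing form of the map on an apartment.\<close>

definition tail_row :: "'a \<Rightarrow> 'b \<Rightarrow> bool" where
  "tail_row i c \<longleftrightarrow> (\<forall>j\<in>B - {i}. fst (\<tau> (i, j)) = c)"

definition head_row :: "'a \<Rightarrow> 'b \<Rightarrow> bool" where
  "head_row i c \<longleftrightarrow> (\<forall>j\<in>B - {i}. snd (\<tau> (i, j)) = c)"

text \<open>Images of arrows leaving \<open>i\<close> pairwise share an end. Once two of them share,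
  say, the tail, a third that avoids this tail would share heads with both, and the first two would
  coincide.\<close>

lemma row_cases:
  assumes i: "i \<in> B"
  shows "(\<exists>c. tail_row i c) \<or> (\<exists>c. head_row i c)"
proof -
  obtain j k where jk: "j \<in> B - {i}" "k \<in> B - {i}" "j \<noteq> k" using infinite_two[OF inf, of "{i}"] by auto
  have arr: "(i, m) \<in> arrows B" if "m \<in> B - {i}" for m using that i by (auto simp: arrows_iff)
  have sh: "fst (\<tau> (i, m)) = fst (\<tau> (i, n)) \<or> snd (\<tau> (i, m)) = snd (\<tau> (i, n))"
    if "m \<in> B - {i}" "n \<in> B - {i}" for m n
    using share[OF arr[OF that(1)] arr[OF that(2)]] by simp
  have ne: "\<tau> (i, j) \<noteq> \<tau> (i, k)" using \<tau>_inj[OF arr[OF jk(1)] arr[OF jk(2)]] jk by auto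
  from sh[OF jk(1,2)] show ?thesis
  proof
    assume eq: "fst (\<tau> (i, j)) = fst (\<tau> (i, k))"
    have "tail_row i (fst (\<tau> (i, j)))"
      unfolding tail_row_def
      using sh[OF _ jk(1)] sh[OF _ jk(2)] eq ne by (metis prod_eqI)
    then show ?thesis by blast
  next
    assume eq: "snd (\<tau> (i, j)) = snd (\<tau> (i, k))"
    have "head_row i (snd (\<tau> (i, j)))"
      unfolding head_row_def
      using sh[OF _ jk(1)] sh[OF _ jk(2)] eq ne by (metis prod_eqI)
    then show ?thesis by blast
  qed
qed

text \<open>Choosing \<open>l = i\<close> makes the arrows \<open>(i, j)\<close> and
  \<open>(k, i)\<close> consecutive for every \<open>j\<close>. In a mixed situation this forces a
  constant head on the row of \<open>i\<close>, whose tail is constant too, against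
  injectivity.\<close>

lemma rows_not_mixed:
  assumes i: "i \<in> B" "tail_row i c" and k: "k \<in> B" "head_row k d" and ne: "i \<noteq> k"
  shows False
proof -
  obtain m where m: "m \<in> B - {i, k}"
    using infinite_two[OF inf, of "{i, k}"] by blast
  have con: "c = d \<or> snd (\<tau> (i, j)) = fst (\<tau> (k, l)) \<longleftrightarrow> i = l \<or> j = k"
    if "j \<in> B - {i}" "l \<in> B - {k}" for j l
  proof -
    have "consecutive (\<tau> (i, j)) (\<tau> (k, l)) \<longleftrightarrow> consecutive (i, j) (k, l)"
      using that i k by (intro consec) (auto simp: arrows_iff)
    then show ?thesis using that i k by (simp add: consecutive_def tail_row_def head_row_def)
  qed
  have "c \<noteq> d" using con[of m m] m by auto
  then have eq: "snd (\<tau> (i, j)) = fst (\<tau> (k, i))" if "j \<in> B - {i}" for j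
    using con[OF that, of i] i ne by auto
  have "snd (\<tau> (i, m)) = snd (\<tau> (i, k))" using eq[of m] eq[of k] m k ne by simp
  moreover have "fst (\<tau> (i, m)) = fst (\<tau> (i, k))" using i k m ne by (simp add: tail_row_def)
  ultimately have "(i, m) = (i, k)" using i k m ne by (intro \<tau>_inj prod_eqI) (auto simp: arrows_iff)
  then show False using m by simp
qed

lemma rows_uniform: "(\<forall>i\<in>B. \<exists>c. tail_row i c) \<or> (\<forall>i\<in>B. \<exists>c. head_row i c)"
  using row_cases rows_not_mixed by metis

lemma element_bijection:
  "\<exists>\<delta>. bij_betw \<delta> B B' \<and> ((\<forall>a\<in>arrows B. fst (\<tau> a) = \<delta> (fst a)) \<or> (\<forall>a\<in>arrows B. snd (\<tau> a) = \<delta> (fst a)))"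
proof -
  \<comment> \<open>\<open>pr\<close> selects the end of an image arrow that is determined by the
    original tail, so both cases share one argument.\<close>
  obtain pr :: "'b \<times> 'b \<Rightarrow> 'b" where pr: "pr = fst \<or> pr = snd"
    and "\<forall>i\<in>B. \<exists>c. \<forall>j\<in>B - {i}. pr (\<tau> (i, j)) = c"
    using rows_uniform unfolding tail_row_def head_row_def by blast
  then obtain \<delta> where "\<forall>i\<in>B. \<forall>j\<in>B - {i}. pr (\<tau> (i, j)) = \<delta> i" by metis
  then have \<delta>: "pr (\<tau> a) = \<delta> (fst a)" if "a \<in> arrows B" for a using that by (auto simp: arrows_def)
  have "bij_betw \<delta> B B'"
    unfolding bij_betw_def
  proof
    show "inj_on \<delta> B"
    proof (rule inj_onI)
      fix i k assume ik: "i \<in> B" "k \<in> B" "\<delta> i = \<delta> k"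
      show "i = k"
      proof (rule ccontr)
        assume ne: "i \<noteq> k"
        obtain j l where jl: "j \<in> B - {i, k}" "l \<in> B - {i, k}" "j \<noteq> l"
          using infinite_two[OF inf, of "{i, k}"] by blast
        have arr: "(i, j) \<in> arrows B" "(k, l) \<in> arrows B" using ik jl by (auto simp: arrows_iff)
        have "pr (\<tau> (i, j)) = pr (\<tau> (k, l))" using \<delta>[OF arr(1)] \<delta>[OF arr(2)] ik by simp
        then show False using share[OF arr] pr ne jl by auto
      qed
    qed
    show "\<delta> ` B = B'"
    proof (intro equalityI subsetI)
      fix c assume "c \<in> \<delta> ` B"
      then obtain i where i: "i \<in> B" "c = \<delta> i" by blast
      obtain j where "j \<in> B - {i}" using infinite_two[OF inf, of "{i}"] by blast
      then have arr: "(i, j) \<in> arrows B" using i by (auto simp: arrows_iff)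
      show "c \<in> B'" using \<delta>[OF arr] \<tau>_in[OF arr] pr i by (auto simp: arrows_def)
    next
      fix c assume c: "c \<in> B'"
      obtain d where d: "d \<in> B' - {c}" using infinite_two[OF infinite_target, of "{c}"] by blast
      have "(c, d) \<in> arrows B'" "(d, c) \<in> arrows B'" using c d by (auto simp: arrows_iff)
      then obtain a where "a \<in> arrows B" "pr (\<tau> a) = c"
        using bij pr unfolding bij_betw_def by (metis fst_conv imageE snd_conv)
      then show "c \<in> \<delta> ` B" using \<delta> by (auto simp: arrows_def)
    qed
  qed
  then show ?thesis using \<delta> pr by blast
qed

end

section \<open>The action on a single apartment\<close>

locale apartment_map = grassmannian scale \<beta> \<gamma>
  for scale :: "'k::division_ring \<Rightarrow> 'v::ab_group_add \<Rightarrow> 'v"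
    and \<beta> :: "'c rel" and \<gamma> :: "'d rel" +
  fixes f :: "'v set \<Rightarrow> 'v set"
  assumes bij_f: "bij_betw f G G"
    and apartment_f: "lvs_basis scale B \<Longrightarrow> \<exists>C. lvs_basis scale C \<and> f ` Ap B = Ap C"
    and apartment_inv: "lvs_basis scale B \<Longrightarrow> \<exists>C. lvs_basis scale C \<and> inv_into G f ` Ap B = Ap C"
begin

abbreviation f' :: "'v set \<Rightarrow> 'v set" where
  "f' \<equiv> inv_into G f"

lemma f'_f [simp]: "X \<in> G \<Longrightarrow> f' (f X) = X" and f_f' [simp]: "X \<in> G \<Longrightarrow> f (f' X) = X"
  using bij_betw_inv_into_left[OF bij_f] bij_betw_inv_into_right[OF bij_f] by simp_all

lemma f_in [simp]: "X \<in> G \<Longrightarrow> f X \<in> G" and f'_in [simp]: "X \<in> G \<Longrightarrow> f' X \<in> G"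
  using bij_betw_apply[OF bij_f] bij_betw_apply[OF bij_betw_inv_into[OF bij_f]] by simp_all

lemma f_inj: "X \<in> G \<Longrightarrow> Y \<in> G \<Longrightarrow> f X = f Y \<longleftrightarrow> X = Y"
  by (metis f'_f)

lemma inv_f': "X \<in> G \<Longrightarrow> inv_into G f' X = f X"
  using bij_f by (rule inv_into_inv_into_eq)

text \<open>Results about \<open>f\<close> thereby apply to \<open>f'\<close>. The inverse of
  \<open>f'\<close> agrees with \<open>f\<close> on \<open>G\<close>, which contains every
  apartment.\<close>

lemma inverse: "apartment_map scale \<beta> \<gamma> f'"
proof unfold_locales
  show "bij_betw f' G G" using bij_f by (rule bij_betw_inv_into)
  show "\<exists>C. lvs_basis scale C \<and> f' ` Ap B = Ap C" if "lvs_basis scale B" for B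
    using that by (rule apartment_inv)
  show "\<exists>C. lvs_basis scale C \<and> inv_into G f' ` Ap B = Ap C" if "lvs_basis scale B" for B
  proof -
    have "inv_into G f' ` Ap B = f ` Ap B" using Ap_subset_G inv_f' by (intro image_cong) blast+
    then show ?thesis using apartment_f[OF that] by simp
  qed
qed

lemma image_f'_f: "A \<subseteq> G \<Longrightarrow> f' ` f ` A = A" and image_f_f': "A \<subseteq> G \<Longrightarrow> f ` f' ` A = A"
  by (force simp: image_image)+

lemma Cset_subset_G: "Cset B i j \<subseteq> G"
  using Ap_subset_G by (auto simp: Cset_def)

text \<open>The members outside \<open>Cset B i j\<close> lie in a second apartment, hence so do
  their images. By \<open>apartment_unique\<close> these images do not separate some
  \<open>k\<close> from some \<open>m\<close>, so \<open>Cset B' k m\<close> avoids them.\<close>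

lemma Cset_image_contains:
  assumes B: "lvs_basis scale B" and B': "lvs_basis scale B'" and im: "f ` Ap B = Ap B'"
    and ij: "(i, j) \<in> arrows B"
  shows "\<exists>(k, m)\<in>arrows B'. Cset B' k m \<subseteq> f ` Cset B i j"
proof -
  let ?R = "Ap B - Cset B i j"
  have el: "i \<in> B" "j \<in> B" "i \<noteq> j" using ij by (simp_all add: arrows_iff)
  obtain C where C: "lvs_basis scale C" "?R \<subseteq> Ap C" "Ap C \<noteq> Ap B"
    by (rule other_apartment[OF B el])
  obtain C' where C': "lvs_basis scale C'" "f ` Ap C = Ap C'" using apartment_f[OF C(1)] by blast
  have ne: "Ap C' \<noteq> Ap B'"
    using C(3) image_f'_f[OF Ap_subset_G[of B]] image_f'_f[OF Ap_subset_G[of C]] by (auto simp: im C'(2))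
  define R where "R = f ` ?R"
  have sub: "R \<subseteq> Ap B'" "R \<subseteq> Ap C'" using im C C' unfolding R_def by blast+
  have "\<exists>k\<in>B'. \<exists>m\<in>B'. k \<noteq> m \<and> (\<forall>X\<in>R. k \<in> X \<longrightarrow> m \<in> X)"
  proof (rule ccontr)
    assume "\<not> ?thesis"
    then have "\<exists>X\<in>R. k \<in> X \<and> m \<notin> X" if "k \<in> B'" "m \<in> B'" "k \<noteq> m" for k m
      using that by blast
    from apartment_unique[OF B' C'(1) sub this] show False using ne by simp
  qed
  then obtain k m where km: "k \<in> B'" "m \<in> B'" "k \<noteq> m" "\<forall>X\<in>R. k \<in> X \<longrightarrow> m \<in> X" by blast
  have "Cset B' k m \<subseteq> f ` Cset B i j"
  proof
    fix Y assume Y: "Y \<in> Cset B' k m"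
    then obtain X where "X \<in> Ap B" "Y = f X" using im by (auto simp: Cset_def)
    then show "Y \<in> f ` Cset B i j" using km Y unfolding R_def by (auto simp: Cset_def)
  qed
  then show ?thesis using km by (intro bexI[of _ "(k, m)"]) (simp_all add: arrows_iff)
qed

text \<open>Applied to \<open>f\<close> and then to \<open>f'\<close>, the inclusion encloses a
  preimage between \<open>Cset B p q\<close> and \<open>Cset B i j\<close>, and
  \<open>Cset_subset\<close> makes the two bounds equal.\<close>

lemma Cset_image:
  assumes nd: nondegenerate
    and B: "lvs_basis scale B" and B': "lvs_basis scale B'" and im: "f ` Ap B = Ap B'"
    and a: "a \<in> arrows B"
  shows "\<exists>b\<in>arrows B'. f ` Cset B (fst a) (snd a) = Cset B' (fst b) (snd b)"
proof -
  interpret i: apartment_map scale \<beta> \<gamma> f' by (rule inverse)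
  obtain i j where ij: "a = (i, j)" by fastforce
  obtain k m where km: "(k, m) \<in> arrows B'" "Cset B' k m \<subseteq> f ` Cset B i j"
    using Cset_image_contains[OF B B' im] a ij by blast
  have "f' ` Ap B' = Ap B" using im image_f'_f[OF Ap_subset_G[of B]] by simp
  then obtain p q where pq: "(p, q) \<in> arrows B" "Cset B p q \<subseteq> f' ` Cset B' k m"
    using i.Cset_image_contains[OF B' B _ km(1)] by blast
  have sub: "f' ` Cset B' k m \<subseteq> Cset B i j"
    using km(2) image_f'_f[OF Cset_subset_G[of B i j]] by blast
  then have "p = i" "q = j"
    using Cset_subset[OF nd B, of i j p q] pq a ij by (auto simp: arrows_iff)
  then have "f' ` Cset B' k m = Cset B i j" using pq sub by blast
  then have "f ` Cset B i j = Cset B' k m" using image_f_f'[OF Cset_subset_G[of B' k m]] by simp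
  then show ?thesis using km(1) ij by (intro bexI[of _ "(k, m)"]) simp_all
qed

definition loc :: "'v set \<Rightarrow> ('v \<Rightarrow> 'v) \<Rightarrow> bool" where
  "loc B \<delta> \<longleftrightarrow> lvs_basis scale B \<and> lvs_basis scale (\<delta> ` B) \<and> inj_on \<delta> B \<and> f ` Ap B = Ap (\<delta> ` B) \<and>
     (\<forall>X\<in>Ap B. \<forall>b\<in>B. b \<in> X \<longleftrightarrow> \<delta> b \<in> f X)"

definition rev_loc :: "'v set \<Rightarrow> ('v \<Rightarrow> 'v) \<Rightarrow> bool" where
  "rev_loc B \<delta> \<longleftrightarrow> lvs_basis scale B \<and> lvs_basis scale (\<delta> ` B) \<and> inj_on \<delta> B \<and> f ` Ap B = Ap (\<delta> ` B) \<and>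
     (\<forall>X\<in>Ap B. \<forall>b\<in>B. b \<in> X \<longleftrightarrow> \<delta> b \<notin> f X)"

lemma nondegenerate_local_form:
  assumes nd: nondegenerate and B: "lvs_basis scale B"
  shows "\<exists>\<delta>. loc B \<delta> \<or> rev_loc B \<delta>"
proof -
  interpret i: apartment_map scale \<beta> \<gamma> f' by (rule inverse)
  obtain B' where B': "lvs_basis scale B'" and im: "f ` Ap B = Ap B'" using apartment_f[OF B] by blast
  have im': "f' ` Ap B' = Ap B" using im image_f'_f[OF Ap_subset_G[of B]] by simp
  let ?C = "\<lambda>B a. Cset B (fst a) (snd a)"
  have C_inj: "a = b" if "?C B a = ?C B b" "a \<in> arrows B" "b \<in> arrows B" "lvs_basis scale B" for a b B
    using Cset_subset[OF nd that(4), of "fst a" "snd a" "fst b" "snd b"] that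
    by (auto simp: arrows_def)
  obtain \<tau> where \<tau>: "\<And>a. a \<in> arrows B \<Longrightarrow> \<tau> a \<in> arrows B'" "\<And>a. a \<in> arrows B \<Longrightarrow> f ` ?C B a = ?C B' (\<tau> a)"
    using Cset_image[OF nd B B' im] by metis
  have \<tau>': "f' ` ?C B' (\<tau> a) = ?C B a" if "a \<in> arrows B" for a
    using \<tau>(2)[OF that] image_f'_f[OF Cset_subset_G] by metis
  interpret arrow_bijection B B' \<tau>
  proof
    show "infinite B" by (rule infinite_basis[OF B])
    show "bij_betw \<tau> (arrows B) (arrows B')"
      unfolding bij_betw_def
    proof
      show "inj_on \<tau> (arrows B)" using \<tau>' C_inj B by (metis inj_onI)
      show "\<tau> ` arrows B = arrows B'"
      proof (intro equalityI subsetI)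
        fix b assume b: "b \<in> arrows B'"
        then obtain a where a: "a \<in> arrows B" "f' ` ?C B' b = ?C B a"
          using i.Cset_image[OF nd B' B im'] by metis
        then have "?C B' b = ?C B' (\<tau> a)" using \<tau>(2)[OF a(1)] image_f_f'[OF Cset_subset_G] by metis
        then have "b = \<tau> a" using C_inj[OF _ b \<tau>(1)[OF a(1)] B'] by blast
        then show "b \<in> \<tau> ` arrows B" using a by blast
      qed (use \<tau> in blast)
    qed
    fix a b assume ab: "a \<in> arrows B" "b \<in> arrows B"
    have con: "consecutive c d \<longleftrightarrow> ?C B c \<inter> ?C B d = {}"
      if "c \<in> arrows B" "d \<in> arrows B" "lvs_basis scale B" for B c d
      using Cset_disjoint_iff[OF nd that(3), of "fst c" "snd c" "fst d" "snd d"] that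
      by (auto simp: arrows_def consecutive_def)
    have "inj_on f G" using bij_f by (simp add: bij_betw_def)
    then have "f ` (?C B a \<inter> ?C B b) = ?C B' (\<tau> a) \<inter> ?C B' (\<tau> b)"
      using \<tau>(2) ab Cset_subset_G by (simp add: inj_on_image_Int[of f G])
    then show "consecutive (\<tau> a) (\<tau> b) \<longleftrightarrow> consecutive a b"
      using con[OF ab B] con[OF \<tau>(1)[OF ab(1)] \<tau>(1)[OF ab(2)] B'] by (metis image_is_empty)
  qed
  obtain \<delta> where \<delta>: "bij_betw \<delta> B B'"
    and or: "(\<forall>a\<in>arrows B. fst (\<tau> a) = \<delta> (fst a)) \<or> (\<forall>a\<in>arrows B. snd (\<tau> a) = \<delta> (fst a))"
    using element_bijection by blast
  have im\<delta>: "\<delta> ` B = B'" and inj\<delta>: "inj_on \<delta> B" using \<delta> by (auto simp: bij_betw_def)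
  have in_iff: "X \<in> ?C B a \<longleftrightarrow> f X \<in> ?C B' (\<tau> a)" if "a \<in> arrows B" "X \<in> Ap B" for a X
  proof
    assume "f X \<in> ?C B' (\<tau> a)"
    then have "f' (f X) \<in> ?C B a" using \<tau>'[OF that(1)] by blast
    then show "X \<in> ?C B a" using that Ap_subset_G f'_f by (metis subsetD)
  qed (use \<tau>(2)[OF that(1)] in blast)
  \<comment> \<open>Every member contains some basis vector and omits another, so membership of a
    single vector can be read off from the sets \<open>Cset B i j\<close>.\<close>
  have mem: "i \<in> X \<longleftrightarrow> (\<exists>j. (i, j) \<in> arrows B \<and> X \<in> Cset B i j)"
    and mem2: "i \<notin> X \<longleftrightarrow> (\<exists>j. (j, i) \<in> arrows B \<and> X \<in> Cset B j i)"
    if "X \<in> Ap B" "i \<in> B" "lvs_basis scale B" for X i B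
  proof -
    have "\<exists>j. j \<in> B \<and> j \<in> X" "\<exists>j. j \<in> B \<and> j \<notin> X"
      using sel_nonempty[OF Ap_trace(1)[OF that(3,1)]] by auto
    then show "i \<in> X \<longleftrightarrow> (\<exists>j. (i, j) \<in> arrows B \<and> X \<in> Cset B i j)"
      "i \<notin> X \<longleftrightarrow> (\<exists>j. (j, i) \<in> arrows B \<and> X \<in> Cset B j i)"
      using that by (auto simp: Cset_def arrows_iff)
  qed
  have lift: "\<exists>k m. (k, m) \<in> arrows B \<and> \<tau> (k, m) = b" if "b \<in> arrows B'" for b
    using bij that by (metis bij_betw_def imageE surj_pair)
  from or show ?thesis
  proof
    assume fst: "\<forall>a\<in>arrows B. fst (\<tau> a) = \<delta> (fst a)"
    have "i \<in> X \<longleftrightarrow> \<delta> i \<in> f X" if X: "X \<in> Ap B" and i: "i \<in> B" for X i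
    proof
      assume "i \<in> X"
      then obtain j where j: "(i, j) \<in> arrows B" "X \<in> Cset B i j" using mem[OF X i B] by blast
      then have "f X \<in> ?C B' (\<tau> (i, j))" using in_iff[OF j(1) X] by simp
      then show "\<delta> i \<in> f X" using fst j(1) by (auto simp: Cset_def)
    next
      assume d: "\<delta> i \<in> f X"
      have fX: "f X \<in> Ap B'" using im X by blast
      obtain c where c: "(\<delta> i, c) \<in> arrows B'" "f X \<in> Cset B' (\<delta> i) c"
        using mem[OF fX _ B', of "\<delta> i"] d i im\<delta> by blast
      obtain k m where km: "(k, m) \<in> arrows B" "\<tau> (k, m) = (\<delta> i, c)" using lift[OF c(1)] by blast
      then have "\<delta> k = \<delta> i" using fst by force
      then have "k = i" using inj\<delta> i km(1) by (auto simp: inj_on_def arrows_iff)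
      then show "i \<in> X" using in_iff[OF km(1) X] km c by (auto simp: Cset_def)
    qed
    then have "loc B \<delta>" using B B' im im\<delta> inj\<delta> by (simp add: loc_def)
    then show ?thesis by blast
  next
    assume snd: "\<forall>a\<in>arrows B. snd (\<tau> a) = \<delta> (fst a)"
    have "i \<in> X \<longleftrightarrow> \<delta> i \<notin> f X" if X: "X \<in> Ap B" and i: "i \<in> B" for X i
    proof
      assume "i \<in> X"
      then obtain j where j: "(i, j) \<in> arrows B" "X \<in> Cset B i j" using mem[OF X i B] by blast
      then have "f X \<in> ?C B' (\<tau> (i, j))" using in_iff[OF j(1) X] by simp
      then show "\<delta> i \<notin> f X" using snd j(1) by (auto simp: Cset_def)
    next
      assume d: "\<delta> i \<notin> f X"
      have fX: "f X \<in> Ap B'" using im X by blast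
      obtain c where c: "(c, \<delta> i) \<in> arrows B'" "f X \<in> Cset B' c (\<delta> i)"
        using mem2[OF fX _ B', of "\<delta> i"] d i im\<delta> by blast
      obtain k m where km: "(k, m) \<in> arrows B" "\<tau> (k, m) = (c, \<delta> i)" using lift[OF c(1)] by blast
      then have "\<delta> k = \<delta> i" using snd by force
      then have "k = i" using inj\<delta> i km(1) by (auto simp: inj_on_def arrows_iff)
      then show "i \<in> X" using in_iff[OF km(1) X] km c by (auto simp: Cset_def)
    qed
    then have "rev_loc B \<delta>" using B B' im im\<delta> inj\<delta> by (simp add: rev_loc_def)
    then show ?thesis by blast
  qed
qed

text \<open>\<open>Q\<close> is \<open>id\<close> in dimension one and \<open>Not\<close> in
  codimension one. Members are then labelled by single basis vectors, so \<open>f\<close> itself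
  supplies the bijection.\<close>

lemma degenerate_local_form:
  assumes Q: "Q True \<noteq> Q False"
    and sel: "\<And>B S. lvs_basis scale B \<Longrightarrow> sel B S \<longleftrightarrow> (\<exists>b\<in>B. S = {x \<in> B. Q (x = b)})"
    and B: "lvs_basis scale B"
  shows "\<exists>\<delta>. loc B \<delta>"
proof -
  obtain B' where B': "lvs_basis scale B'" and im: "f ` Ap B = Ap B'" using apartment_f[OF B] by blast
  let ?T = "\<lambda>B b. {x \<in> B. Q (x = b)}"
  have Ap: "X \<in> Ap B \<longleftrightarrow> (\<exists>b\<in>B. X = \<langle>?T B b\<rangle>)" if "lvs_basis scale B" for B X
    unfolding Ap_iff[OF that] sel[OF that] by blast
  have mem: "x \<in> \<langle>?T B b\<rangle> \<longleftrightarrow> Q (x = b)" if "lvs_basis scale B" "x \<in> B" for B b x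
    using basis_Int_span[OF that(1), of "?T B b"] that(2) by blast
  have T_inj: "a = b" if "\<langle>?T B a\<rangle> = \<langle>?T B b\<rangle>" "lvs_basis scale B" "a \<in> B" for a b B
    using mem[OF that(2,3), of a] mem[OF that(2,3), of b] that(1) Q by (cases "a = b") auto
  have TAp: "\<langle>?T B b\<rangle> \<in> Ap B" if "b \<in> B" for b
    by (rule Ap[OF B, THEN iffD2, OF bexI[OF refl that]])
  have "\<exists>c\<in>B'. f \<langle>?T B b\<rangle> = \<langle>?T B' c\<rangle>" if "b \<in> B" for b
    using imageI[OF TAp[OF that], of f] unfolding im by (rule Ap[OF B', THEN iffD1])
  then have "\<forall>b\<in>B. \<exists>c. c \<in> B' \<and> f \<langle>?T B b\<rangle> = \<langle>?T B' c\<rangle>" by blast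
  from bchoice[OF this] obtain \<delta> where
    \<delta>: "\<And>b. b \<in> B \<Longrightarrow> \<delta> b \<in> B'" "\<And>b. b \<in> B \<Longrightarrow> f \<langle>?T B b\<rangle> = \<langle>?T B' (\<delta> b)\<rangle>" by blast
  have TG: "\<langle>?T B b\<rangle> \<in> G" if "b \<in> B" for b by (rule subsetD[OF Ap_subset_G TAp[OF that]])
  have inj: "inj_on \<delta> B"
  proof (rule inj_onI)
    fix a b assume ab: "a \<in> B" "b \<in> B" "\<delta> a = \<delta> b"
    then have "f \<langle>?T B a\<rangle> = f \<langle>?T B b\<rangle>" using \<delta>(2) by simp
    then show "a = b" using f_inj[OF TG TG] T_inj[OF _ B] ab by blast
  qed
  have "B' \<subseteq> \<delta> ` B"
  proof
    fix c assume c: "c \<in> B'"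
    have "\<langle>?T B' c\<rangle> \<in> f ` Ap B" unfolding im by (rule Ap[OF B', THEN iffD2, OF bexI[OF refl c]])
    then obtain X where X: "X \<in> Ap B" "\<langle>?T B' c\<rangle> = f X" by blast
    from Ap[OF B, THEN iffD1, OF X(1)] obtain b where b: "b \<in> B" "\<langle>?T B' c\<rangle> = f \<langle>?T B b\<rangle>"
      using X(2) by blast
    then have "c = \<delta> b" using T_inj[OF _ B' c] \<delta>(2) by simp
    then show "c \<in> \<delta> ` B" using b by blast
  qed
  then have surj: "\<delta> ` B = B'" using \<delta>(1) by blast
  have "b \<in> X \<longleftrightarrow> \<delta> b \<in> f X" if X: "X \<in> Ap B" and b: "b \<in> B" for X b
  proof -
    from Ap[OF B, THEN iffD1, OF X] obtain a where a: "a \<in> B" "X = \<langle>?T B a\<rangle>" by blast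
    have "b \<in> X \<longleftrightarrow> Q (b = a)" using mem[OF B b] a by simp
    also have "\<dots> \<longleftrightarrow> Q (\<delta> b = \<delta> a)" using inj a b by (simp add: inj_on_eq_iff)
    also have "\<dots> \<longleftrightarrow> \<delta> b \<in> f X" using mem[OF B' \<delta>(1)[OF b]] \<delta>(2)[OF a(1)] a(2) by simp
    finally show ?thesis .
  qed
  then have "loc B \<delta>" using B B' im surj inj by (simp add: loc_def)
  then show ?thesis by blast
qed

lemma local_form:
  assumes B: "lvs_basis scale B"
  shows "\<exists>\<delta>. loc B \<delta> \<or> rev_loc B \<delta>"
proof (cases nondegenerate)
  case True
  then show ?thesis using nondegenerate_local_form B by blast
next
  case False
  \<comment> \<open>A single index set of this shape fixes \<open>\<beta>\<close> or
    \<open>\<gamma>\<close> to be one, and hence the shape of index sets in every basis.\<close>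
  then obtain B0 S0 x where S0: "lvs_basis scale B0" "sel B0 S0" "S0 = {x} \<or> B0 - S0 = {x}"
    unfolding nondegenerate_def by blast
  from S0(3) show ?thesis
  proof
    assume "S0 = {x}"
    then have x: "|{x}| =o \<beta>" using S0 by (simp add: sel_def)
    have "sel B S \<longleftrightarrow> (\<exists>b\<in>B. S = {y \<in> B. id (y = b)})" if B: "lvs_basis scale B" for B S
    proof
      assume S: "sel B S"
      then have "|S| =o |{x}|" using x ordIso_transitive ordIso_symmetric unfolding sel_def by blast
      from card_of_singleton[OF this] obtain s where "S = {s}" by blast
      then show "\<exists>b\<in>B. S = {y \<in> B. id (y = b)}" using S by (auto simp: sel_def)
    next
      assume "\<exists>b\<in>B. S = {y \<in> B. id (y = b)}"
      then obtain b where b: "b \<in> B" "S = {b}" by auto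
      obtain T where T: "sel B T" using ex_sel[OF B] by blast
      then have "|T| =o |{x}|" using x ordIso_transitive ordIso_symmetric unfolding sel_def by blast
      from card_of_singleton[OF this] obtain t where t: "T = {t}" by blast
      show "sel B S"
      proof (cases "b = t")
        case False
        then show ?thesis using sel_exchange[OF T, of t b] b t by simp
      qed (use b t T in simp)
    qed
    then show ?thesis using degenerate_local_form[of id B] B by auto
  next
    assume "B0 - S0 = {x}"
    then have x: "|{x}| =o \<gamma>" using S0 by (auto simp: sel_def)
    have "sel B S \<longleftrightarrow> (\<exists>b\<in>B. S = {y \<in> B. \<not> (y = b)})" if B: "lvs_basis scale B" for B S
    proof
      assume S: "sel B S"
      then have "|B - S| =o |{x}|" using x ordIso_transitive ordIso_symmetric unfolding sel_def by blast
      from card_of_singleton[OF this] obtain s where "B - S = {s}" by blast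
      then have "s \<in> B" "S = {y \<in> B. \<not> (y = s)}" using S unfolding sel_def by blast+
      then show "\<exists>b\<in>B. S = {y \<in> B. \<not> (y = b)}" by blast
    next
      assume "\<exists>b\<in>B. S = {y \<in> B. \<not> (y = b)}"
      then obtain b where b: "b \<in> B" "S = B - {b}" by auto
      obtain T where T: "sel B T" using ex_sel[OF B] by blast
      then have "|B - T| =o |{x}|" using x ordIso_transitive ordIso_symmetric unfolding sel_def by blast
      from card_of_singleton[OF this] obtain t where t: "B - T = {t}" by blast
      have Tt: "t \<in> B" "T = B - {t}" using t T by (auto simp: sel_def)
      show "sel B S"
      proof (cases "b = t")
        case False
        then have "insert t (T - {b}) = S" using b Tt by auto
        then show ?thesis using sel_exchange[OF T, of b t] b Tt False by auto
      qed (use b Tt T in simp)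
    qed
    then show ?thesis using degenerate_local_form[of Not B] B by auto
  qed
qed

end

section \<open>Comparing apartments\<close>

context grassmannian
begin

lemma small: "lvs_basis scale B \<Longrightarrow> \<beta> \<le>o |B|" "lvs_basis scale B \<Longrightarrow> \<gamma> \<le>o |B|"
  using sizes[of B] ordIso_imp_ordLeq ordIso_symmetric by blast+

text \<open>The alternative in \<open>sizes\<close> is stated basis by basis; equal cardinality of
  all bases makes it uniform.\<close>

lemma large_side: "(\<forall>B. lvs_basis scale B \<longrightarrow> |B| =o \<gamma>) \<or> (\<forall>B. lvs_basis scale B \<longrightarrow> |B| =o \<beta>)"
proof (cases "\<exists>B. lvs_basis scale B \<and> |B| =o \<gamma>")
  case True
  then obtain B where B: "lvs_basis scale B" "|B| =o \<gamma>" by blast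
  have "|C| =o \<gamma>" if "lvs_basis scale C" for C
    by (rule ordIso_transitive[OF basis_ordIso[OF that B(1)] B(2)])
  then show ?thesis by blast
next
  case False
  then show ?thesis using sizes by blast
qed

end

context apartment_map
begin

section \<open>Excluding the reversing case\<close>

lemma loc_image:
  assumes "loc B \<delta>" "sel B S"
  shows "f \<langle>S\<rangle> = \<langle>\<delta> ` S\<rangle>" "sel (\<delta> ` B) (\<delta> ` S)"
proof -
  have B: "lvs_basis scale B" and B': "lvs_basis scale (\<delta> ` B)" and im: "f ` Ap B = Ap (\<delta> ` B)"
    and mem: "\<forall>X\<in>Ap B. \<forall>b\<in>B. b \<in> X \<longleftrightarrow> \<delta> b \<in> f X"
    using assms(1) by (auto simp: loc_def)
  have S: "\<langle>S\<rangle> \<in> Ap B" using Ap_iff[OF B] assms by blast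
  then have fS: "f \<langle>S\<rangle> \<in> Ap (\<delta> ` B)" using im by blast
  have "\<delta> ` B \<inter> f \<langle>S\<rangle> = \<delta> ` (B \<inter> \<langle>S\<rangle>)" using mem S by blast
  also have "B \<inter> \<langle>S\<rangle> = S" using basis_Int_span[OF B] assms by (simp add: sel_def)
  finally show "f \<langle>S\<rangle> = \<langle>\<delta> ` S\<rangle>" "sel (\<delta> ` B) (\<delta> ` S)" using Ap_trace[OF B' fS] by simp_all
qed

lemma rev_loc_image:
  assumes "rev_loc B \<delta>" "sel B S"
  shows "f \<langle>S\<rangle> = \<langle>\<delta> ` (B - S)\<rangle>" "sel (\<delta> ` B) (\<delta> ` (B - S))"
proof -
  have B: "lvs_basis scale B" and B': "lvs_basis scale (\<delta> ` B)" and im: "f ` Ap B = Ap (\<delta> ` B)"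
    and mem: "\<forall>X\<in>Ap B. \<forall>b\<in>B. b \<in> X \<longleftrightarrow> \<delta> b \<notin> f X"
    using assms(1) by (auto simp: rev_loc_def)
  have S: "\<langle>S\<rangle> \<in> Ap B" using Ap_iff[OF B] assms by blast
  then have fS: "f \<langle>S\<rangle> \<in> Ap (\<delta> ` B)" using im by blast
  have "\<delta> ` B \<inter> f \<langle>S\<rangle> = \<delta> ` (B - \<langle>S\<rangle>)" using mem S by blast
  also have "B - \<langle>S\<rangle> = B - S" using basis_Int_span[OF B, of S] assms unfolding sel_def by blast
  finally show "f \<langle>S\<rangle> = \<langle>\<delta> ` (B - S)\<rangle>" "sel (\<delta> ` B) (\<delta> ` (B - S))" using Ap_trace[OF B' fS] by simp_all
qed

text \<open>Complementing index sets exchanges \<open>\<beta>\<close> with \<open>\<gamma>\<close>,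
  so the two coincide, and one of them is \<alpha>.\<close>

lemma rev_loc_balanced:
  assumes rev: "rev_loc B \<delta>" and C: "lvs_basis scale C"
  shows "|C| =o \<beta>" "|C| =o \<gamma>"
proof -
  have B: "lvs_basis scale B" and inj: "inj_on \<delta> B" using rev by (simp_all add: rev_loc_def)
  obtain S where S: "sel B S" using ex_sel[OF B] by blast
  have "inj_on \<delta> (B - S)" using inj by (rule inj_on_subset) auto
  then have "|B - S| =o |\<delta> ` (B - S)|" by (intro card_of_ordIsoI[OF inj_on_imp_bij_betw])
  also have "|\<delta> ` (B - S)| =o \<beta>" using rev_loc_image(2)[OF rev S] by (simp add: sel_def)
  finally have "|B - S| =o \<beta>" .
  moreover have "|B - S| =o \<gamma>" using S by (simp add: sel_def)
  ultimately have "\<beta> =o \<gamma>" by (meson ordIso_symmetric ordIso_transitive)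
  then show "|C| =o \<beta>" "|C| =o \<gamma>" using sizes[OF C] by (meson ordIso_symmetric ordIso_transitive)+
qed

text \<open>
  Let \<open>H\<close> be the coordinate sum zero hyperplane of \<open>\<langle>T\<rangle>\<close>. Then \<open>f H\<close> exceeds \<open>f \<langle>T\<rangle>\<close> by a single
  vector \<open>q\<close>, whose support is finite, so \<open>f H \<subseteq> f \<langle>T - F\<rangle>\<close> for a finite \<open>F\<close>. Both subspaces belong to
  an apartment on which \<open>f\<close> reverses inclusion, hence \<open>\<langle>T - F\<rangle> \<subseteq> H\<close>, which is absurd.
\<close>

lemma not_rev_loc: "\<not> rev_loc B \<delta>"
proof
  assume rev: "rev_loc B \<delta>"
  have B: "lvs_basis scale B" and B': "lvs_basis scale (\<delta> ` B)" and inj: "inj_on \<delta> B"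
    and mem: "\<And>X b. X \<in> Ap B \<Longrightarrow> b \<in> B \<Longrightarrow> b \<in> X \<longleftrightarrow> \<delta> b \<notin> f X"
    using rev by (auto simp: rev_loc_def)
  have selI: "sel C S" if "lvs_basis scale C" "S \<subseteq> C" "|S| =o |C|" "|C - S| =o |C|" for C S
    using that rev_loc_balanced[OF rev that(1)] unfolding sel_def by (meson ordIso_transitive)
  have selD: "|S| =o |C|" "|C - S| =o |C|" if "lvs_basis scale C" "sel C S" for C S
    using that(2) rev_loc_balanced[OF rev that(1)] unfolding sel_def by (meson ordIso_symmetric ordIso_transitive)+
  obtain T where T: "sel B T" using ex_sel[OF B] by blast
  have TB: "T \<subseteq> B" using T by (simp add: sel_def)
  have infT: "infinite T" "infinite (B - T)"
    using selD[OF B T] infinite_basis[OF B] card_of_ordIso_finite by blast+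
  \<comment> \<open>The new basis contains \<open>t\<close> and the differences
    \<open>b - t\<close>, so \<open>\<langle>T\<rangle>\<close> and the coordinate sum zero
    hyperplane in it are both spanned by parts of it.\<close>
  define u where "u t b = (if b \<in> T - {t} then b - t else b)" for t b :: 'v
  have shear: "basis_shear scale B (B - (T - {t})) (u t)" if "t \<in> T" for t
  proof unfold_locales
    fix d assume d: "d \<in> B - (B - (T - {t}))"
    have "- t \<in> \<langle>B - (T - {t})\<rangle>" using that TB by (intro span_uminus span_base) auto
    then show "u t d - d \<in> \<langle>B - (T - {t})\<rangle>" using d by (simp add: u_def)
  qed (use B in \<open>auto simp: u_def\<close>)
  have basis: "lvs_basis scale (u t ` B)" if "t \<in> T" for t
    using basis_shear.shear_basis[OF shear[OF that]] .
  have inj_u: "inj_on (u t) B" if "t \<in> T" for t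
    using basis_shear.shear_inj[OF shear[OF that]] .
  have u_t: "u t t = t" for t by (simp add: u_def)
  have span_u: "\<langle>u t ` S\<rangle> = \<langle>S\<rangle>" if "t \<in> T" "S \<subseteq> B" "t \<in> S" for t S
  proof (rule basis_shear.span_shear[OF shear[OF that(1)] that(2)])
    fix d assume d: "d \<in> S - (B - (T - {t}))"
    have "- t \<in> \<langle>S \<inter> (B - (T - {t}))\<rangle>" using that by (intro span_uminus span_base) auto
    then show "u t d - d \<in> \<langle>S \<inter> (B - (T - {t}))\<rangle>" using d that(2) by (auto simp: u_def)
  qed
  have sel_u: "sel (u t ` B) (u t ` S)" if "t \<in> T" "sel B S" "t \<in> S" for t S
  proof -
    have SB: "S \<subseteq> B" using that by (simp add: sel_def)
    have "\<langle>u t ` S\<rangle> \<in> G" using span_u[OF that(1) SB that(3)] span_in_G[OF B SB] that(2) by simp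
    then show ?thesis using span_in_G[OF basis[OF that(1)]] SB by blast
  qed
  \<comment> \<open>\<open>\<langle>T\<rangle>\<close> and
    \<open>\<langle>insert b T\<rangle>\<close> lie in both apartments. Preserving their inclusion
    on the sheared apartment would contradict the reversal on that of \<open>B\<close>.\<close>
  have rev_u: "\<exists>\<epsilon>. rev_loc (u t ` B) \<epsilon>" if t: "t \<in> T" for t
  proof -
    obtain \<epsilon> where \<epsilon>: "loc (u t ` B) \<epsilon> \<or> rev_loc (u t ` B) \<epsilon>" using local_form[OF basis[OF t]] by blast
    have "\<not> loc (u t ` B) \<epsilon>"
    proof
      assume lo: "loc (u t ` B) \<epsilon>"
      obtain b where b: "b \<in> B - T" using infT infinite_imp_nonempty by blast
      have "|insert b T| =o |B|"
        by (rule card_of_sandwich[OF _ selD(1)[OF B T]]) (use b TB in auto)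
      moreover have "B - insert b T = (B - T) - {b}" by auto
      then have "|B - insert b T| =o |B|"
        using ordIso_transitive[OF card_of_Diff_finite[OF infT(2), of "{b}"] selD(2)[OF B T]] by simp
      ultimately have S: "sel B (insert b T)" using b TB by (intro selI[OF B]) auto
      have "f \<langle>T\<rangle> = \<langle>\<epsilon> ` u t ` T\<rangle>"
        using loc_image(1)[OF lo sel_u[OF t T t]] span_u[OF t TB t] by simp
      moreover have "f \<langle>insert b T\<rangle> = \<langle>\<epsilon> ` u t ` insert b T\<rangle>"
        using loc_image(1)[OF lo sel_u[OF t S]] span_u[OF t, of "insert b T"] t b TB by auto
      moreover have "\<langle>\<epsilon> ` u t ` T\<rangle> \<subseteq> \<langle>\<epsilon> ` u t ` insert b T\<rangle>" by (rule span_mono) auto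
      ultimately have "f \<langle>T\<rangle> \<subseteq> f \<langle>insert b T\<rangle>" by simp
      moreover have "\<delta> b \<in> f \<langle>T\<rangle>"
        using mem[of "\<langle>T\<rangle>" b] sel_trace[OF B T, of b] T b Ap_iff[OF B] by blast
      moreover have "\<delta> b \<notin> f \<langle>insert b T\<rangle>"
        using mem[of "\<langle>insert b T\<rangle>" b] sel_trace[OF B S, of b] S b Ap_iff[OF B] by blast
      ultimately show False by blast
    qed
    then show ?thesis using \<epsilon> by blast
  qed
  \<comment> \<open>The description by differences distinguishes no \<open>t\<close>, so the base
    point can be changed once the finite support of \<open>q\<close> is known.\<close>
  define H where "H = \<langle>{s - s' | s s'. s \<in> T \<and> s' \<in> T}\<rangle>"
  have H: "H = \<langle>u t ` (T - {t})\<rangle>" if t: "t \<in> T" for t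
    unfolding H_def
  proof (rule span_eqI; rule subsetI)
    fix x assume "x \<in> {s - s' | s s'. s \<in> T \<and> s' \<in> T}"
    then obtain s s' where s: "s \<in> T" "s' \<in> T" "x = s - s'" by blast
    have st: "s - t \<in> \<langle>u t ` (T - {t})\<rangle>" if "s \<in> T" for s
    proof (cases "s = t")
      case False
      then have "u t s \<in> u t ` (T - {t})" "u t s = s - t" using that by (auto simp: u_def)
      then show ?thesis using span_base by metis
    qed simp
    have "(s - t) - (s' - t) \<in> \<langle>u t ` (T - {t})\<rangle>" using st s by (intro span_diff[OF st st])
    then show "x \<in> \<langle>u t ` (T - {t})\<rangle>" using s by simp
  next
    fix x assume "x \<in> u t ` (T - {t})"
    then show "x \<in> \<langle>{s - s' | s s'. s \<in> T \<and> s' \<in> T}\<rangle>" using t by (intro span_base) (auto simp: u_def)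
  qed
  have sel_H: "sel (u t ` B) (u t ` (T - {t}))" if t: "t \<in> T" for t
  proof (rule selI[OF basis[OF t]])
    have card: "|u t ` S| =o |u t ` B|" if "|S| =o |B|" "S \<subseteq> B" for S
    proof -
      have "|S| =o |u t ` S|" "|B| =o |u t ` B|"
        using inj_u[OF t] inj_on_subset[OF inj_u[OF t] that(2)]
        by (blast intro: card_of_ordIsoI inj_on_imp_bij_betw)+
      then show ?thesis using that(1) by (meson ordIso_symmetric ordIso_transitive)
    qed
    have "|T - {t}| =o |B|"
      using ordIso_transitive[OF card_of_Diff_finite[OF infT(1), of "{t}"] selD(1)[OF B T]] by simp
    then show "|u t ` (T - {t})| =o |u t ` B|" using TB by (intro card) auto
    have "|B - (T - {t})| =o |B|" by (rule card_of_sandwich[OF _ selD(2)[OF B T]]) auto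
    then have "|u t ` (B - (T - {t}))| =o |u t ` B|" by (intro card) auto
    moreover have "u t ` (B - (T - {t})) = u t ` B - u t ` (T - {t})"
      using TB by (intro inj_on_image_set_diff[OF inj_u[OF t]]) auto
    ultimately show "|u t ` B - u t ` (T - {t})| =o |u t ` B|" by simp
  qed (use TB in auto)
  obtain t where t: "t \<in> T" using infT infinite_imp_nonempty by blast
  obtain \<epsilon> where \<epsilon>: "rev_loc (u t ` B) \<epsilon>" using rev_u[OF t] by blast
  define q where "q = \<epsilon> t"
  have "f \<langle>T\<rangle> = \<langle>\<epsilon> ` (u t ` B - u t ` T)\<rangle>"
    using rev_loc_image(1)[OF \<epsilon> sel_u[OF t T t]] span_u[OF t TB t] by simp
  moreover have "u t ` B - u t ` (T - {t}) = insert t (u t ` B - u t ` T)"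
  proof -
    have "u t ` B - u t ` (T - {t}) = u t ` (B - (T - {t}))"
      using TB by (intro inj_on_image_set_diff[OF inj_u[OF t], symmetric]) auto
    also have "B - (T - {t}) = insert t (B - T)" using t TB by auto
    also have "u t ` (insert t (B - T)) = insert t (u t ` (B - T))" by (simp add: u_t)
    also have "u t ` (B - T) = u t ` B - u t ` T"
      using TB by (intro inj_on_image_set_diff[OF inj_u[OF t]]) auto
    finally show ?thesis .
  qed
  moreover have "f H = \<langle>\<epsilon> ` (u t ` B - u t ` (T - {t}))\<rangle>"
    using rev_loc_image(1)[OF \<epsilon> sel_H[OF t]] H[OF t] by simp
  ultimately have fH: "f H = \<langle>insert q (\<epsilon> ` (u t ` B - u t ` T))\<rangle>"
    and fT: "f \<langle>T\<rangle> = \<langle>\<epsilon> ` (u t ` B - u t ` T)\<rangle>" by (simp_all add: q_def)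
  have "q \<in> \<langle>\<delta> ` B\<rangle>" using basisD(2)[OF B'] by simp
  then obtain F0 where F0: "finite F0" "F0 \<subseteq> \<delta> ` B" "q \<in> \<langle>F0\<rangle>" using span_finite by blast
  obtain F where F: "F \<subseteq> B" "F0 = \<delta> ` F" using F0(2) subset_image_iff by metis
  have finF: "finite F" using F0(1) F inj finite_image_iff inj_on_subset by metis
  have TF: "sel B (T - F)"
  proof (rule selI[OF B])
    show "|T - F| =o |B|" using card_of_Diff_finite[OF infT(1) finF] selD(1)[OF B T] by (meson ordIso_transitive)
    show "|B - (T - F)| =o |B|" by (rule card_of_sandwich[OF _ selD(2)[OF B T]]) auto
  qed (use TB in auto)
  have fW: "f \<langle>T - F\<rangle> = \<langle>\<delta> ` (B - (T - F))\<rangle>" by (rule rev_loc_image(1)[OF rev TF])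
  have "q \<in> f \<langle>T - F\<rangle>"
    using F0(3) F span_mono[of F0 "\<delta> ` (B - (T - F))"] unfolding fW by blast
  moreover have "f \<langle>T\<rangle> \<subseteq> f \<langle>T - F\<rangle>"
    unfolding fW rev_loc_image(1)[OF rev T] by (rule span_mono) auto
  then have "\<langle>\<epsilon> ` (u t ` B - u t ` T)\<rangle> \<subseteq> f \<langle>T - F\<rangle>" unfolding fT .
  then have "\<epsilon> ` (u t ` B - u t ` T) \<subseteq> f \<langle>T - F\<rangle>" by (rule order_trans[OF span_superset])
  ultimately have sub: "f H \<subseteq> f \<langle>T - F\<rangle>"
    unfolding fH fW by (intro cl_least) auto
  \<comment> \<open>With \<open>s\<close> outside \<open>F\<close>, both \<open>H\<close> and
    \<open>\<langle>T - F\<rangle>\<close> belong to the apartment sheared at \<open>s\<close>, and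
    \<open>s\<close> lies in the second but not in the first.\<close>
  obtain s where s: "s \<in> T" "s \<notin> F" using infT(1) finF by (meson finite_subset subsetI)
  obtain \<eta> where \<eta>: "rev_loc (u s ` B) \<eta>" using rev_u[OF s(1)] by blast
  then have mem_\<eta>: "\<And>X. X \<in> Ap (u s ` B) \<Longrightarrow> s \<in> X \<longleftrightarrow> \<eta> s \<notin> f X"
    using s TB u_t[of s] unfolding rev_loc_def by (metis image_eqI subsetD)
  have "H \<in> Ap (u s ` B)" using H[OF s(1)] sel_H[OF s(1)] Ap_iff[OF basis[OF s(1)]] by blast
  moreover have "\<langle>T - F\<rangle> \<in> Ap (u s ` B)"
    using span_u[OF s(1), of "T - F"] sel_u[OF s(1) TF] s TB Ap_iff[OF basis[OF s(1)]] by blast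
  moreover have "s \<in> \<langle>T - F\<rangle>" using s by (intro span_base) simp
  ultimately have "s \<in> H" using mem_\<eta> sub by blast
  moreover have "s \<notin> u s ` (T - {s})"
  proof
    assume "s \<in> u s ` (T - {s})"
    then obtain x where "x \<in> T - {s}" "u s s = u s x" by (auto simp: u_t)
    then show False using inj_onD[OF inj_u[OF s(1)], of s x] s TB by auto
  qed
  moreover have "s \<in> u s ` B" using s TB u_t[of s] by (metis image_eqI subsetD)
  ultimately show False using sel_trace[OF basis[OF s(1)] sel_H[OF s(1)]] H[OF s(1)] by blast
qed

section \<open>Independence of the basis\<close>

lemma ex_loc: "lvs_basis scale B \<Longrightarrow> \<exists>\<delta>. loc B \<delta>"
  using local_form not_rev_loc by blast

text \<open>
  The members \<open>\<langle>E1\<rangle>\<close> and \<open>\<langle>E2\<rangle>\<close> lie both in the apartment of \<open>B\<close> and in one containing \<open>X\<close>, and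
  they meet in the line of \<open>p\<close>.
\<close>

lemma transfer_small_dim:
  assumes \<gamma>: "\<And>C. lvs_basis scale C \<Longrightarrow> |C| =o \<gamma>"
    and lo: "loc B \<delta>" and p: "p \<in> B" and X: "X \<in> G" "p \<in> X"
  shows "\<delta> p \<in> f X"
proof -
  have B: "lvs_basis scale B" and B': "lvs_basis scale (\<delta> ` B)" and inj: "inj_on \<delta> B"
    using lo by (simp_all add: loc_def)
  have "indep {p}" using basis_nonzero[OF B p] by (rule indep_singleton)
  then obtain I where I: "p \<in> I" "indep I" "\<langle>I\<rangle> = X"
    using obtain_basis[OF G_sub[OF X(1)], of "{p}"] X(2) by (metis empty_subsetI insert_subset)
  \<comment> \<open>The added vectors come from \<open>B\<close>, so \<open>J - I\<close>, whose
    size is the codimension of \<open>X\<close>, is common to \<open>J\<close> and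
    \<open>B\<close>.\<close>
  obtain J where J: "I \<subseteq> J" "J \<subseteq> I \<union> B" "indep J" "B \<subseteq> \<langle>J\<rangle>" by (rule indep_extend[OF I(2)])
  have "\<langle>J\<rangle> = UNIV" using cl_least[OF J(4)] basisD(2)[OF B] by auto
  then have Jb: "lvs_basis scale J" using J by (simp add: basis_iff)
  have "sel J I" using span_in_G[OF Jb J(1)] I X by simp
  then have B0: "|J - I| =o \<gamma>" by (simp add: sel_def)
  then have JI: "|J - I| =o |B|" using \<gamma>[OF B] by (meson ordIso_symmetric ordIso_transitive)
  then have "infinite (J - I)" using infinite_basis[OF B] card_of_ordIso_finite by blast
  then obtain D1 D2 D3 where D: "D1 \<subseteq> J - I" "D2 \<subseteq> J - I" "D3 \<subseteq> J - I" "D1 \<inter> D2 = {}"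
      "D1 \<inter> D3 = {}" "D2 \<inter> D3 = {}" and D1: "|D1| =o |J - I|" and D2: "|D2| =o |J - I|" and D3: "|D3| =o |J - I|"
    using infinite_split3 by metis
  have le: "\<beta> \<le>o |insert p D|" if "|D| =o |J - I|" for D
  proof -
    have "|B| =o |D|" using that JI by (meson ordIso_symmetric ordIso_transitive)
    then have "\<beta> \<le>o |D|" using small(1)[OF B] by (rule ordLeq_ordIso_trans[rotated])
    then show ?thesis by (rule ordLeq_transitive) (rule card_of_mono1, blast)
  qed
  obtain E1 where E1: "E1 \<subseteq> insert p D1" "p \<in> E1" "|E1| =o \<beta>"
    using obtain_card_containing[OF card_\<beta> le[OF D1] _ \<beta>_nonempty] by blast
  obtain E2 where E2: "E2 \<subseteq> insert p D2" "p \<in> E2" "|E2| =o \<beta>"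
    using obtain_card_containing[OF card_\<beta> le[OF D2] _ \<beta>_nonempty] by blast
  have selI: "sel C E" if "lvs_basis scale C" "E \<subseteq> C" "|E| =o \<beta>" "D3 \<subseteq> C - E" for C E
  proof -
    have "|D3| =o |C|" using D3 B0 \<gamma>[OF that(1)] by (meson ordIso_symmetric ordIso_transitive)
    then have "|C - E| =o |C|" using that by (intro card_of_sandwich[of "C - E" C D3]) auto
    then show ?thesis using that \<gamma>[OF that(1)] unfolding sel_def by (meson ordIso_transitive)
  qed
  have D3': "D3 \<subseteq> C - E1" "D3 \<subseteq> C - E2" if "J - I \<subseteq> C" for C using that D E1 E2 I(1) by blast+
  have JIB: "J - I \<subseteq> B" using J by auto
  have selB: "sel B E1" "sel B E2"
    by (rule selI[OF B]; use E1 E2 D JIB p D3'[OF JIB] in blast)+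
  have selJ: "sel J E1" "sel J E2"
    by (rule selI[OF Jb]; use E1 E2 D J I D3'[of J] in blast)+
  obtain \<epsilon> where \<epsilon>: "loc J \<epsilon>" using ex_loc[OF Jb] by blast
  \<comment> \<open>Hence each of the two apartments computes
    \<open>f \<langle>E1\<rangle> \<inter> f \<langle>E2\<rangle>\<close> as the line of its own
    image of \<open>p\<close>.\<close>
  have Int: "E1 \<inter> E2 = {p}" using E1 E2 D I(1) by blast
  have "f \<langle>E1\<rangle> \<inter> f \<langle>E2\<rangle> = \<langle>{h p}\<rangle>" if lo: "loc C h" and sel: "sel C E1" "sel C E2" for C h
  proof -
    have C: "lvs_basis scale (h ` C)" "inj_on h C" using lo by (simp_all add: loc_def)
    have E: "E1 \<subseteq> C" "E2 \<subseteq> C" using sel by (simp_all add: sel_def)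
    have "f \<langle>E1\<rangle> \<inter> f \<langle>E2\<rangle> = \<langle>h ` E1\<rangle> \<inter> \<langle>h ` E2\<rangle>" using loc_image(1)[OF lo] sel by simp
    also have "\<dots> = \<langle>h ` E1 \<inter> h ` E2\<rangle>" using E by (intro span_Int[OF C(1)]) auto
    also have "h ` E1 \<inter> h ` E2 = {h p}" using inj_on_image_Int[OF C(2) E] Int by simp
    finally show ?thesis .
  qed
  from this[OF lo selB] this[OF \<epsilon> selJ] have "\<langle>{\<delta> p}\<rangle> = \<langle>{\<epsilon> p}\<rangle>" by simp
  then have "\<delta> p \<in> \<langle>{\<epsilon> p}\<rangle>" using span_base[of "\<delta> p" "{\<delta> p}"] by simp
  moreover have "\<epsilon> p \<in> f X"
  proof -
    have "\<epsilon> ` I \<subseteq> f X" using loc_image(1)[OF \<epsilon> \<open>sel J I\<close>] I(3) span_superset by simp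
    then show ?thesis using I(1) by blast
  qed
  then have "\<langle>{\<epsilon> p}\<rangle> \<subseteq> f X" using G_sub[OF f_in[OF X(1)]] by (intro span_minimal) auto
  ultimately show ?thesis by blast
qed

text \<open>
  Dual to the previous lemma: shearing \<open>B\<close> along a complement \<open>B3\<close> of \<open>X\<close> in the hyperplane gives a
  basis adapted to \<open>X\<close>, and its apartment shares with that of \<open>B\<close> all members containing \<open>B3\<close> but not \<open>b\<close>.
\<close>

lemma hyperplane_bound:
  assumes \<beta>: "\<And>C. lvs_basis scale C \<Longrightarrow> |C| =o \<beta>"
    and lo: "loc B \<delta>" and b: "b \<in> B" and X: "X \<in> G" "X \<subseteq> \<langle>B - {b}\<rangle>"
  shows "f X \<subseteq> \<langle>\<delta> ` (B - {b})\<rangle>"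
proof -
  have B: "lvs_basis scale B" and B': "lvs_basis scale (\<delta> ` B)" and inj: "inj_on \<delta> B"
    using lo by (simp_all add: loc_def)
  obtain I where I: "indep I" "\<langle>I\<rangle> = X"
    by (rule obtain_basis[OF G_sub[OF X(1)] indep_empty]) auto
  obtain J where J: "I \<subseteq> J" "J \<subseteq> I \<union> (B - {b})" "indep J" "B - {b} \<subseteq> \<langle>J\<rangle>"
    by (rule indep_extend[OF I(1)])
  define B3 where "B3 = J - I"
  define D where "D = B - {b} - B3"
  have B3: "B3 \<subseteq> B - {b}" using J by (auto simp: B3_def)
  have JI: "J = I \<union> B3" using J by (auto simp: B3_def)
  \<comment> \<open>\<open>B3\<close> spans a complement of \<open>X\<close> in the hyperplane; the
    shear replaces \<open>d\<close> by its component \<open>x d\<close> in \<open>X\<close>.\<close>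
  have "\<exists>x\<in>X. d - x \<in> \<langle>B3\<rangle>" if "d \<in> D" for d
  proof -
    have "d \<in> \<langle>I \<union> B3\<rangle>" using that J(4) JI by (auto simp: D_def)
    then show ?thesis using span_Un_split[of d I B3] I(2) by simp
  qed
  then obtain x where x: "\<And>d. d \<in> D \<Longrightarrow> x d \<in> X" "\<And>d. d \<in> D \<Longrightarrow> d - x d \<in> \<langle>B3\<rangle>" by metis
  define u where "u d = (if d \<in> D then x d else d)" for d
  have uD: "u d - d \<in> \<langle>B3\<rangle>" if "d \<in> D" for d
    using span_uminus[OF x(2)[OF that]] that by (simp add: u_def)
  \<comment> \<open>\<open>b\<close> belongs to the fixed vectors, so it stays in the new basis
    although the corrections lie in \<open>\<langle>B3\<rangle>\<close>.\<close>
  interpret shear: basis_shear scale B "insert b B3" u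
  proof unfold_locales
    fix d assume "d \<in> B - insert b B3"
    then have "d \<in> D" by (auto simp: D_def)
    then show "u d - d \<in> \<langle>insert b B3\<rangle>" using uD span_mono[of B3 "insert b B3"] by blast
  qed (use B b B3 in \<open>auto simp: u_def D_def\<close>)
  have span_u: "\<langle>u ` S\<rangle> = \<langle>S\<rangle>" if S: "S \<subseteq> B" "B3 \<subseteq> S" "b \<notin> S" for S
  proof (rule shear.span_shear[OF S(1)])
    fix d assume "d \<in> S - insert b B3"
    then have "d \<in> D" using S by (auto simp: D_def)
    moreover have "B3 \<subseteq> S \<inter> insert b B3" using S by auto
    ultimately show "u d - d \<in> \<langle>S \<inter> insert b B3\<rangle>" using uD span_mono by blast
  qed
  have DX: "u ` D \<subseteq> X" using x by (auto simp: u_def)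
  have split: "B - {b} = D \<union> B3" using B3 by (auto simp: D_def)
  have uB3: "u ` B3 = B3" by (auto simp: u_def D_def)
  have XD: "X = \<langle>u ` D\<rangle>"
  proof
    show "\<langle>u ` D\<rangle> \<subseteq> X" using DX by (rule span_minimal[OF G_sub[OF X(1)]])
    show "X \<subseteq> \<langle>u ` D\<rangle>"
    proof
      fix v assume v: "v \<in> X"
      have "u ` (B - {b}) = u ` D \<union> B3" by (simp add: split image_Un uB3)
      moreover have "\<langle>u ` (B - {b})\<rangle> = \<langle>B - {b}\<rangle>" using B3 by (intro span_u) auto
      ultimately have "\<langle>B - {b}\<rangle> = \<langle>u ` D \<union> B3\<rangle>" by simp
      then have "v \<in> \<langle>u ` D \<union> B3\<rangle>" using v X(2) by blast
      then obtain y where y: "y \<in> \<langle>u ` D\<rangle>" "v - y \<in> \<langle>B3\<rangle>" using span_Un_split by blast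
      have "y \<in> X" using y(1) \<open>\<langle>u ` D\<rangle> \<subseteq> X\<close> by blast
      \<comment> \<open>\<open>I\<close> and \<open>B3\<close> are disjoint parts of one independent
        set, so the remainder \<open>v - y\<close>, lying in both spans, vanishes.\<close>
      then have "v - y \<in> \<langle>I\<rangle>" using v I(2) sub_diff[OF G_sub[OF X(1)]] by blast
      moreover obtain M where M: "J \<subseteq> M" "lvs_basis scale M" by (rule basis_extend[OF J(3)])
      have "\<langle>I\<rangle> \<inter> \<langle>B3\<rangle> = \<langle>I \<inter> B3\<rangle>" by (rule span_Int[OF M(2)]) (use M JI in auto)
      moreover have "I \<inter> B3 = {}" by (auto simp: B3_def)
      ultimately have "v - y \<in> {0}" using y(2) by (metis IntI span_empty)
      then have "v - y = 0" by simp
      then show "v \<in> \<langle>u ` D\<rangle>" using y(1) by simp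
    qed
  qed
  have C: "lvs_basis scale (u ` B)" by (rule shear.shear_basis)
  have DB: "D \<subseteq> B" by (auto simp: D_def)
  have selD: "sel (u ` B) (u ` D)" using span_in_G[OF C image_mono[OF DB]] XD X by simp
  have "|D| =o |u ` D|"
    using inj_on_subset[OF shear.shear_inj DB] by (intro card_of_ordIsoI[OF inj_on_imp_bij_betw])
  moreover have "|u ` D| =o \<beta>" using selD by (simp add: sel_def)
  ultimately have D\<beta>: "|D| =o \<beta>" by (rule ordIso_transitive)
  then have DBc: "|D| =o |B|" using \<beta>[OF B] by (meson ordIso_symmetric ordIso_transitive)
  then have "infinite D" using infinite_basis[OF B] card_of_ordIso_finite by blast
  then obtain D1 D2 D3 where D: "D1 \<subseteq> D" "D2 \<subseteq> D" "D3 \<subseteq> D" "D1 \<inter> D2 = {}"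
      "D1 \<inter> D3 = {}" "D2 \<inter> D3 = {}" and D1: "|D1| =o |D|" and D2: "|D2| =o |D|" and D3: "|D3| =o |D|"
    using infinite_split3 by metis
  have le: "\<gamma> \<le>o |insert b E|" if "|E| =o |D|" for E
  proof -
    have "|B| =o |E|" using that DBc by (meson ordIso_symmetric ordIso_transitive)
    then have "\<gamma> \<le>o |E|" using small(2)[OF B] by (rule ordLeq_ordIso_trans[rotated])
    then show ?thesis by (rule ordLeq_transitive) (rule card_of_mono1, blast)
  qed
  obtain E1 where E1: "E1 \<subseteq> insert b D1" "b \<in> E1" "|E1| =o \<gamma>"
    using obtain_card_containing[OF card_\<gamma> le[OF D1] _ \<gamma>_nonempty] by blast
  obtain E2 where E2: "E2 \<subseteq> insert b D2" "b \<in> E2" "|E2| =o \<gamma>"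
    using obtain_card_containing[OF card_\<gamma> le[OF D2] _ \<gamma>_nonempty] by blast
  have bD: "b \<notin> D" by (simp add: D_def)
  have sel: "sel B (B - E)" if "E \<subseteq> B" "|E| =o \<gamma>" "D3 \<subseteq> B - E" for E
  proof -
    have "|D3| =o |B|" using D3 DBc by (rule ordIso_transitive)
    then have "|B - E| =o |B|" using that by (intro card_of_sandwich[of "B - E" B D3]) auto
    then have "|B - E| =o \<beta>" using \<beta>[OF B] by (rule ordIso_transitive)
    moreover have "B - (B - E) = E" using that by auto
    ultimately show ?thesis using that by (simp add: sel_def)
  qed
  have sel1: "sel B (B - E1)" and sel2: "sel B (B - E2)"
    by (rule sel; use E1 E2 D DB b bD in blast)+
  have sub: "B - E \<subseteq> B" "B3 \<subseteq> B - E" "b \<notin> B - E" if "E \<subseteq> insert b D" "b \<in> E" for E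
    using that B3 by (auto simp: D_def)
  have Z1: "\<langle>u ` (B - E1)\<rangle> = \<langle>B - E1\<rangle>" and Z2: "\<langle>u ` (B - E2)\<rangle> = \<langle>B - E2\<rangle>"
    by (rule span_u; use sub[of E1] sub[of E2] E1 E2 D in blast)+
  have selu: "sel (u ` B) (u ` S)" if "sel B S" "\<langle>u ` S\<rangle> = \<langle>S\<rangle>" for S
    using that span_in_G[OF B, of S] span_in_G[OF C, of "u ` S"] by (auto simp: sel_def)
  obtain \<epsilon> where \<epsilon>: "loc (u ` B) \<epsilon>" using ex_loc[OF C] by blast
  \<comment> \<open>The two common members together span the hyperplane of \<open>B - {b}\<close>.
    Joining their images in each apartment therefore yields one and the same hyperplane.\<close>
  have un: "(B - E1) \<union> (B - E2) = B - {b}" using E1 E2 D bD DB by blast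
  have "\<langle>\<delta> ` (B - {b})\<rangle> = \<langle>f \<langle>B - E1\<rangle> \<union> f \<langle>B - E2\<rangle>\<rangle>"
    by (simp add: loc_image(1)[OF lo sel1] loc_image(1)[OF lo sel2] span_Un_span image_Un[symmetric] un)
  also have "\<dots> = \<langle>\<epsilon> ` u ` (B - {b})\<rangle>"
    using loc_image(1)[OF \<epsilon> selu[OF sel1 Z1]] loc_image(1)[OF \<epsilon> selu[OF sel2 Z2]]
    by (simp add: Z1 Z2 span_Un_span image_Un[symmetric] un)
  also have "\<langle>\<epsilon> ` u ` D\<rangle> \<subseteq> \<langle>\<epsilon> ` u ` (B - {b})\<rangle>" using split by (intro span_mono) auto
  ultimately show ?thesis using loc_image(1)[OF \<epsilon> selD] XD by simp
qed

text \<open>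
  If \<open>q = \<delta> p\<close> were outside \<open>f X\<close>, shear \<open>\<delta> ` B\<close> along \<open>q\<close> into a hyperplane containing \<open>f X\<close>. The
  members through \<open>q\<close> do not change, so the preimage apartment still has \<open>p\<close> as the line
  belonging to \<open>q\<close>, and \<open>hyperplane_bound\<close> for the inverse map keeps \<open>X\<close> away from \<open>p\<close>.
\<close>

lemma transfer_small_codim:
  assumes \<beta>: "\<And>C. lvs_basis scale C \<Longrightarrow> |C| =o \<beta>"
    and lo: "loc B \<delta>" and p: "p \<in> B" and X: "X \<in> G" "p \<in> X"
  shows "\<delta> p \<in> f X"
proof (rule ccontr)
  interpret i: apartment_map scale \<beta> \<gamma> f' by (rule inverse)
  have B: "lvs_basis scale B" and B': "lvs_basis scale (\<delta> ` B)" and inj: "inj_on \<delta> B"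
    and mem: "\<And>X b. X \<in> Ap B \<Longrightarrow> b \<in> B \<Longrightarrow> b \<in> X \<longleftrightarrow> \<delta> b \<in> f X"
    using lo by (auto simp: loc_def)
  define q where "q = \<delta> p"
  assume "\<delta> p \<notin> f X"
  then have q: "q \<notin> f X" by (simp add: q_def)
  have qB: "q \<in> \<delta> ` B" using p by (simp add: q_def)
  obtain I where I: "indep I" "\<langle>I\<rangle> = f X"
    by (rule obtain_basis[OF G_sub[OF f_in[OF X(1)]] indep_empty]) auto
  have "indep (insert q I)" using I q by (intro indep_insert) auto
  then obtain M where M: "insert q I \<subseteq> M" "lvs_basis scale M" by (rule basis_extend)
  \<comment> \<open>A hyperplane that contains \<open>f X\<close> and avoids
    \<open>q\<close>.\<close>
  let ?H = "\<langle>M - {q}\<rangle>"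
  have qH: "q \<notin> ?H" using basis_notin[OF M(2)] M(1) by blast
  have qI: "q \<notin> I" using q I span_base by blast
  have XH: "f X \<subseteq> ?H" using M(1) qI I(2) span_mono[of I "M - {q}"] by blast
  have "\<exists>k. v - scale k q \<in> ?H" for v
    using span_insert_iff[of v q "M - {q}"] basisD(2)[OF M(2)] M(1) by (simp add: insert_absorb)
  \<comment> \<open>\<open>k v\<close> is the \<open>q\<close>-coordinate of \<open>v\<close>
    relative to \<open>?H\<close>; subtracting it projects \<open>v\<close> along \<open>q\<close>
    into \<open>?H\<close>.\<close>
  then obtain k where k: "\<And>v. v - scale (k v) q \<in> ?H" by metis
  define u where "u b = (if b = q then q else b - scale (k b) q)" for b
  interpret shear: basis_shear scale "\<delta> ` B" "{q}" u
  proof unfold_locales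
    fix d assume "d \<in> \<delta> ` B - {q}"
    then show "u d - d \<in> \<langle>{q}\<rangle>" by (auto simp: u_def span_base span_scale intro!: span_uminus)
  qed (use B' qB in \<open>auto simp: u_def\<close>)
  define C where "C = u ` \<delta> ` B"
  have C: "lvs_basis scale C" unfolding C_def by (rule shear.shear_basis)
  have qC: "q \<in> C" using qB by (auto simp: C_def u_def image_iff)
  have CH: "C - {q} \<subseteq> ?H" using k by (auto simp: C_def u_def)
  have XC: "f X \<subseteq> \<langle>C - {q}\<rangle>"
  proof
    fix v assume "v \<in> f X"
    then have v: "v \<in> ?H" using XH by blast
    have "v \<in> \<langle>insert q (C - {q})\<rangle>" using basisD(2)[OF C] qC by (simp add: insert_absorb)
    then obtain a where a: "v - scale a q \<in> \<langle>C - {q}\<rangle>" using span_insert_iff by blast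
    then have "v - scale a q \<in> ?H" using cl_least[OF CH] by blast
    with v have "v - (v - scale a q) \<in> ?H" by (rule span_diff)
    then have "a = 0" using qH span_scale_iff[of a q] by auto
    then show "v \<in> \<langle>C - {q}\<rangle>" using a by simp
  qed
  obtain \<eta> where \<eta>: "i.loc C \<eta>" using i.ex_loc[OF C] by blast
  then have \<eta>C: "lvs_basis scale (\<eta> ` C)" "inj_on \<eta> C" by (simp_all add: i.loc_def)
  define c where "c = \<eta> q"
  have "f' (f X) \<subseteq> \<langle>\<eta> ` (C - {q})\<rangle>"
    by (rule i.hyperplane_bound[OF \<beta> \<eta> qC f_in[OF X(1)] XC])
  moreover have "\<eta> ` (C - {q}) = \<eta> ` C - {c}"
    using \<eta>C(2) qC by (auto simp: c_def inj_on_def)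
  ultimately have p_in: "p \<in> \<langle>\<eta> ` C - {c}\<rangle>" using X by auto
  \<comment> \<open>The image of a member through \<open>p\<close> contains \<open>q\<close>, so the
    shear along \<open>q\<close> keeps it in the new apartment; going back by \<open>f'\<close>
    takes \<open>q\<close> to \<open>c\<close>.\<close>
  have c_in: "c \<in> \<langle>S\<rangle>" if S: "sel B S" "p \<in> S" for S
  proof -
    have SB: "S \<subseteq> B" and SG: "\<langle>S\<rangle> \<in> G" using S span_in_G[OF B, of S] by (auto simp: sel_def)
    have "\<langle>u ` \<delta> ` S\<rangle> = \<langle>\<delta> ` S\<rangle>"
    proof (rule shear.span_shear)
      fix d assume d: "d \<in> \<delta> ` S - {q}"
      have "\<delta> ` S \<inter> {q} = {q}" using S by (auto simp: q_def)
      then show "u d - d \<in> \<langle>\<delta> ` S \<inter> {q}\<rangle>" using shear.moved[of d] d SB by auto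
    qed (use SB in auto)
    then have eq: "f \<langle>S\<rangle> = \<langle>u ` \<delta> ` S\<rangle>" using loc_image(1)[OF lo S(1)] by simp
    have sub: "u ` \<delta> ` S \<subseteq> C" using SB by (auto simp: C_def)
    have sel: "sel C (u ` \<delta> ` S)" using span_in_G[OF C sub] f_in[OF SG] eq by simp
    have "q \<in> u ` \<delta> ` S" using S(2) by (force simp: u_def q_def image_iff)
    then have "c \<in> \<eta> ` u ` \<delta> ` S" by (auto simp: c_def)
    then have "c \<in> f' (f \<langle>S\<rangle>)" using i.loc_image(1)[OF \<eta> sel] eq span_base by simp
    then show ?thesis using SG by simp
  qed
  \<comment> \<open>The members through \<open>p\<close> meet in its line. Together with
    \<open>p_in\<close> this puts the basis vector \<open>c\<close> into the span of the
    others.\<close>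
  have "c \<in> \<langle>{p}\<rangle>"
  proof -
    have "\<forall>b\<in>B - {p}. c \<in> \<langle>B - {b}\<rangle>"
    proof
      fix b assume b: "b \<in> B - {p}"
      then obtain S where S: "sel B S" "p \<in> S" "b \<notin> S" using sel_separating[OF B p, of b] by auto
      then have "S \<subseteq> B - {b}" by (auto simp: sel_def)
      then show "c \<in> \<langle>B - {b}\<rangle>" using c_in[OF S(1,2)] span_mono by blast
    qed
    then show ?thesis using cl_subset_iff[of B "{p}" c] basisD[OF B] p by simp
  qed
  moreover have "\<langle>{p}\<rangle> \<subseteq> \<langle>\<eta> ` C - {c}\<rangle>" using p_in by (intro cl_least) simp
  moreover have "c \<in> \<eta> ` C" using qC by (simp add: c_def)
  ultimately show False using basis_notin[OF \<eta>C(1)] by blast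
qed

lemma transfer_half:
  assumes "loc B \<delta>" "p \<in> B" "X \<in> G" "p \<in> X"
  shows "\<delta> p \<in> f X"
  using large_side transfer_small_dim[OF _ assms] transfer_small_codim[OF _ assms] by blast

lemma loc_inverse:
  assumes lo: "loc B \<delta>"
  shows "apartment_map.loc scale \<beta> \<gamma> f' (\<delta> ` B) (inv_into B \<delta>)"
proof -
  interpret i: apartment_map scale \<beta> \<gamma> f' by (rule inverse)
  have B: "lvs_basis scale B" "lvs_basis scale (\<delta> ` B)" "inj_on \<delta> B" and im: "f ` Ap B = Ap (\<delta> ` B)"
    and mem: "\<forall>X\<in>Ap B. \<forall>b\<in>B. b \<in> X \<longleftrightarrow> \<delta> b \<in> f X"
    using lo by (auto simp: loc_def)
  have inv: "inv_into B \<delta> ` \<delta> ` B = B" using B(3) by (simp add: image_image)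
  have inj: "inj_on (inv_into B \<delta>) (\<delta> ` B)" by (rule inj_on_inv_into) simp
  have im': "f' ` Ap (\<delta> ` B) = Ap B" using image_f'_f[OF Ap_subset_G[of B]] im by simp
  have "b \<in> Y \<longleftrightarrow> inv_into B \<delta> b \<in> f' Y" if Y: "Y \<in> Ap (\<delta> ` B)" and b: "b \<in> \<delta> ` B" for Y b
  proof -
    obtain X where X: "X \<in> Ap B" "Y = f X" using Y im by blast
    obtain a where a: "a \<in> B" "b = \<delta> a" using b by blast
    have "X \<in> G" using X Ap_subset_G by blast
    then show ?thesis using mem X a B(3) by simp
  qed
  then show ?thesis unfolding i.loc_def using B inv inj im' by simp
qed

text \<open>The converse implication is \<open>transfer_half\<close> for \<open>f'\<close>, whose
  bijection of bases is the inverse of \<open>\<delta>\<close>.\<close>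

lemma transfer:
  assumes lo: "loc B \<delta>" and p: "p \<in> B" and X: "X \<in> G"
  shows "p \<in> X \<longleftrightarrow> \<delta> p \<in> f X"
proof
  interpret i: apartment_map scale \<beta> \<gamma> f' by (rule inverse)
  assume "\<delta> p \<in> f X"
  then have "inv_into B \<delta> (\<delta> p) \<in> f' (f X)"
    using p X by (intro i.transfer_half[OF loc_inverse[OF lo]]) simp_all
  then show "p \<in> X" using p X lo by (simp add: loc_def)
qed (rule transfer_half[OF lo p X])

end

section \<open>The induced map of points\<close>

context apartment_map
begin

text \<open>The choice of basis and bijection is harmless: by \<open>pt_parallel_loc\<close> every
  choice gives the same line.\<close>

definition pt :: "'v \<Rightarrow> 'v" where
  "pt p = (SOME q. \<exists>B \<delta>. loc B \<delta> \<and> p \<in> B \<and> q = \<delta> p)"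

lemma pt_loc:
  assumes "p \<noteq> 0"
  obtains B \<delta> where "loc B \<delta>" "p \<in> B" "pt p = \<delta> p"
proof -
  obtain B where B: "{p} \<subseteq> B" "lvs_basis scale B" by (rule basis_extend[OF indep_singleton[OF assms]])
  obtain \<delta> where "loc B \<delta>" using ex_loc[OF B(2)] by blast
  then have "\<exists>q B \<delta>. loc B \<delta> \<and> p \<in> B \<and> q = \<delta> p" using B by blast
  then have "\<exists>B \<delta>. loc B \<delta> \<and> p \<in> B \<and> pt p = \<delta> p" unfolding pt_def by (rule someI_ex)
  then show ?thesis using that by blast
qed

lemma pt_nonzero: "p \<noteq> 0 \<Longrightarrow> pt p \<noteq> 0"
  by (rule pt_loc[of p]) (auto simp: loc_def dest: basis_nonzero)

lemma pt_mem: "p \<noteq> 0 \<Longrightarrow> X \<in> G \<Longrightarrow> p \<in> X \<longleftrightarrow> pt p \<in> f X"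
  by (rule pt_loc[of p]) (simp_all add: transfer)

lemma point_separation:
  assumes p: "p \<noteq> 0" and q: "\<And>X. X \<in> G \<Longrightarrow> p \<in> X \<Longrightarrow> q \<in> X"
  shows "q \<in> \<langle>{p}\<rangle>"
proof -
  obtain B where B: "{p} \<subseteq> B" "lvs_basis scale B" by (rule basis_extend[OF indep_singleton[OF p]])
  have "\<forall>b\<in>B - {p}. q \<in> \<langle>B - {b}\<rangle>"
  proof
    fix b assume b: "b \<in> B - {p}"
    then obtain S where S: "sel B S" "p \<in> S" "b \<notin> S" using sel_separating[OF B(2), of p b] B(1) by auto
    then have "\<langle>S\<rangle> \<in> G" using span_in_G[OF B(2), of S] by (simp add: sel_def)
    then have "q \<in> \<langle>S\<rangle>" using q S(2) span_base by blast
    moreover have "S \<subseteq> B - {b}" using S by (auto simp: sel_def)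
    ultimately show "q \<in> \<langle>B - {b}\<rangle>" using span_mono by blast
  qed
  then show ?thesis using cl_subset_iff[of B "{p}" q] basisD[OF B(2)] B(1) by simp
qed

lemma image_point_separation:
  assumes p: "p \<noteq> 0" and q: "\<And>X. X \<in> G \<Longrightarrow> p \<in> f X \<Longrightarrow> q \<in> f X"
  shows "q \<in> \<langle>{p}\<rangle>"
  by (rule point_separation[OF p]) (metis q f_f' f'_in)

text \<open>By \<open>transfer\<close>, the image members through \<open>\<delta> b\<close> are
  exactly those whose preimages contain \<open>b\<close>, a condition without reference to the
  basis; separation of points does the rest.\<close>

lemma pt_parallel_loc:
  assumes lo: "loc B \<delta>" and b: "b \<in> B"
  shows "\<langle>{pt b}\<rangle> = \<langle>{\<delta> b}\<rangle>"
proof -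
  have "lvs_basis scale B" "lvs_basis scale (\<delta> ` B)" using lo by (simp_all add: loc_def)
  then have b0: "b \<noteq> 0" "\<delta> b \<noteq> 0" using b basis_nonzero by (simp_all)
  have "pt b \<in> \<langle>{\<delta> b}\<rangle>"
    by (rule image_point_separation[OF b0(2)]) (simp add: pt_mem[OF b0(1), symmetric] transfer[OF lo b, symmetric])
  then show ?thesis using span_eq_singleton pt_nonzero[OF b0(1)] by blast
qed

lemma pt_parallel:
  assumes "x \<noteq> 0" "y \<noteq> 0" "y \<in> \<langle>{x}\<rangle>"
  shows "pt y \<in> \<langle>{pt x}\<rangle>"
proof (rule image_point_separation[OF pt_nonzero[OF assms(1)]])
  fix X assume X: "X \<in> G" "pt x \<in> f X"
  then have "x \<in> X" using pt_mem assms by blast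
  then have "\<langle>{x}\<rangle> \<subseteq> X" using G_sub[OF X(1)] by (intro span_minimal) auto
  then show "pt y \<in> f X" using pt_mem[OF assms(2) X(1)] assms(3) by blast
qed

text \<open>One basis accommodates all three points, and the coordinate hyperplane omitting
  \<open>\<delta> z\<close> separates the image of \<open>z\<close> from the other two.\<close>

lemma pt_not_collinear:
  assumes nz: "x \<noteq> 0" "y \<noteq> 0" and z: "z \<notin> \<langle>{x, y}\<rangle>"
  shows "pt z \<notin> \<langle>{pt x, pt y}\<rangle>"
proof -
  have z0: "z \<noteq> 0" using z span_0 by blast
  \<comment> \<open>For parallel \<open>x\<close> and \<open>y\<close> only \<open>x\<close> enters
    the basis; \<open>pt_parallel\<close> then controls the image of \<open>y\<close>.\<close>
  obtain J where J: "x \<in> J" "y \<in> J \<or> y \<in> \<langle>{x}\<rangle>" "J \<subseteq> {x, y}" "indep J"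
  proof (cases "y \<in> \<langle>{x}\<rangle>")
    case True
    then show ?thesis using that[of "{x}"] indep_singleton[OF nz(1)] by simp
  next
    case False
    then have "indep (insert y {x})" by (intro indep_insert indep_singleton nz(1))
    then show ?thesis using that[of "{x, y}"] by (simp add: insert_commute)
  qed
  have zJ: "z \<notin> \<langle>J\<rangle>" using z span_mono[OF J(3)] by blast
  then have "indep (insert z J)" using J(4) by (intro indep_insert)
  then obtain B where B: "insert z J \<subseteq> B" "lvs_basis scale B" by (rule basis_extend)
  obtain \<delta> where lo: "loc B \<delta>" using ex_loc[OF B(2)] by blast
  have B': "lvs_basis scale (\<delta> ` B)" "inj_on \<delta> B" using lo by (simp_all add: loc_def)
  let ?H = "\<langle>\<delta> ` B - {\<delta> z}\<rangle>"
  have H: "pt b \<in> ?H" if "b \<in> J" for b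
  proof -
    have "b \<noteq> z" using that zJ span_base by blast
    then have "\<delta> b \<in> \<delta> ` B - {\<delta> z}" using that B B'(2) by (auto simp: inj_on_def)
    then have "\<langle>{\<delta> b}\<rangle> \<subseteq> ?H" by (intro span_mono) simp
    moreover have "pt b \<in> \<langle>{\<delta> b}\<rangle>"
      using pt_parallel_loc[OF lo, of b] that B(1) span_base[of "pt b" "{pt b}"] by auto
    ultimately show ?thesis by blast
  qed
  have px: "pt x \<in> ?H" using H J(1) by blast
  have py: "pt y \<in> ?H"
    using J(2)
  proof
    assume "y \<in> \<langle>{x}\<rangle>"
    then have "pt y \<in> \<langle>{pt x}\<rangle>" using pt_parallel nz by blast
    moreover have "\<langle>{pt x}\<rangle> \<subseteq> ?H" using px by (intro cl_least) simp
    ultimately show ?thesis by blast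
  qed (rule H)
  have "\<langle>{pt x, pt y}\<rangle> \<subseteq> ?H" using px py by (intro cl_least) simp
  moreover have "pt z \<notin> ?H"
  proof
    assume "pt z \<in> ?H"
    then have "\<langle>{pt z}\<rangle> \<subseteq> ?H" by (intro cl_least) simp
    then have "\<delta> z \<in> ?H" using pt_parallel_loc[OF lo, of z] B(1) span_base[of "\<delta> z" "{\<delta> z}"] by auto
    then show False using basis_notin[OF B'(1), of "\<delta> z"] B(1) by simp
  qed
  ultimately show ?thesis by blast
qed

lemma pt_collineation: "collineation scale pt"
proof unfold_locales
  interpret i: apartment_map scale \<beta> \<gamma> f' by (rule inverse)
  show "pt x \<noteq> 0" if "x \<noteq> 0" for x using that by (rule pt_nonzero)
  \<comment> \<open>Returning to the original line lets \<open>pt_not_collinear\<close> for the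
    inverse map prove that collinear points have collinear images.\<close>
  have round_trip: "\<langle>{i.pt (pt x)}\<rangle> = \<langle>{x}\<rangle>" if x: "x \<noteq> 0" for x
  proof (rule span_eq_singleton)
    show "i.pt (pt x) \<in> \<langle>{x}\<rangle>"
    proof (rule point_separation[OF x])
      fix X assume X: "X \<in> G" "x \<in> X"
      then have "pt x \<in> f X" using pt_mem x by blast
      then have "i.pt (pt x) \<in> f' (f X)" using i.pt_mem[OF pt_nonzero[OF x] f_in[OF X(1)]] by blast
      then show "i.pt (pt x) \<in> X" using X by simp
    qed
    show "i.pt (pt x) \<noteq> 0" using i.pt_nonzero pt_nonzero x by blast
  qed
  show "z \<in> \<langle>{x, y}\<rangle> \<longleftrightarrow> pt z \<in> \<langle>{pt x, pt y}\<rangle>" if nz: "x \<noteq> 0" "y \<noteq> 0" "z \<noteq> 0" for x y z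
  proof
    assume z: "z \<in> \<langle>{x, y}\<rangle>"
    show "pt z \<in> \<langle>{pt x, pt y}\<rangle>"
    proof (rule ccontr)
      assume "pt z \<notin> \<langle>{pt x, pt y}\<rangle>"
      then have n: "i.pt (pt z) \<notin> \<langle>{i.pt (pt x), i.pt (pt y)}\<rangle>"
        by (rule i.pt_not_collinear[OF pt_nonzero[OF nz(1)] pt_nonzero[OF nz(2)]])
      have "x \<in> \<langle>{i.pt (pt x)}\<rangle>" "y \<in> \<langle>{i.pt (pt y)}\<rangle>" "i.pt (pt z) \<in> \<langle>{z}\<rangle>"
        using round_trip[OF nz(1)] round_trip[OF nz(2)] round_trip[OF nz(3)] span_base[of x "{x}"] span_base[of y "{y}"]
          span_base[of "i.pt (pt z)" "{i.pt (pt z)}"] by auto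
      then have "x \<in> \<langle>{i.pt (pt x), i.pt (pt y)}\<rangle>" "y \<in> \<langle>{i.pt (pt x), i.pt (pt y)}\<rangle>" "i.pt (pt z) \<in> \<langle>{z}\<rangle>"
        using span_mono[of "{i.pt (pt x)}" "{i.pt (pt x), i.pt (pt y)}"]
          span_mono[of "{i.pt (pt y)}" "{i.pt (pt x), i.pt (pt y)}"] by blast+
      then have "\<langle>{x, y}\<rangle> \<subseteq> \<langle>{i.pt (pt x), i.pt (pt y)}\<rangle>" by (intro cl_least) simp
      then have "\<langle>{z}\<rangle> \<subseteq> \<langle>{i.pt (pt x), i.pt (pt y)}\<rangle>" using z by (intro cl_least) auto
      then show False using n \<open>i.pt (pt z) \<in> \<langle>{z}\<rangle>\<close> by blast
    qed
  qed (use pt_not_collinear[OF nz(1,2), of z] in blast)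
  show "\<exists>x. x \<noteq> 0 \<and> pt x \<in> \<langle>{y}\<rangle>" if y: "y \<noteq> 0" for y
  proof (intro exI conjI)
    show x0: "i.pt y \<noteq> 0" using y by (rule i.pt_nonzero)
    show "pt (i.pt y) \<in> \<langle>{y}\<rangle>"
    proof (rule point_separation[OF y])
      fix Y assume Y: "Y \<in> G" "y \<in> Y"
      then have "i.pt y \<in> f' Y" using i.pt_mem y by blast
      then have "pt (i.pt y) \<in> f (f' Y)" using pt_mem[OF x0 f'_in[OF Y(1)]] by blast
      then show "pt (i.pt y) \<in> Y" using Y by simp
    qed
  qed
  show "\<exists>z. z \<notin> \<langle>{x, y}\<rangle>" for x y
  proof (rule ccontr)
    assume all: "\<nexists>z. z \<notin> \<langle>{x, y}\<rangle>"
    obtain B where B: "lvs_basis scale B" by (rule basis_extend[OF indep_empty])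
    obtain F where F: "finite F" "card F = 3" "F \<subseteq> B"
      using infinite_arbitrarily_large[OF infinite_basis[OF B]] by blast
    have "indep F" using F basisD(1)[OF B] indep_subset by blast
    then have "card F \<le> card {x, y}" using F all by (intro card_indep_le) auto
    also have "\<dots> \<le> 2" by (simp add: card_insert_if)
    finally show False using F by simp
  qed
qed

lemma induced_by_semilinear:
  "\<exists>l. semilinear_automorphism scale l \<and> (\<forall>X\<in>G. f X = l ` X)"
proof -
  interpret c: collineation scale pt by (rule pt_collineation)
  obtain l where l: "semilinear_automorphism scale l" "\<And>x. x \<noteq> 0 \<Longrightarrow> l x \<noteq> 0 \<and> l x \<in> \<langle>{pt x}\<rangle>"
    using c.fundamental_theorem by blast
  have bij: "bij l" and add: "\<And>x y. l (x + y) = l x + l y"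
    using l(1) by (auto simp: semilinear_automorphism_def)
  have l0: "l 0 = 0" using add[of 0 0] by simp
  have mem: "l x \<in> f X \<longleftrightarrow> x \<in> X" if X: "X \<in> G" for x X
  proof (cases "x = 0")
    case True
    then show ?thesis using l0 sub_0 G_sub X f_in by metis
  next
    case False
    have "\<langle>{l x}\<rangle> = \<langle>{pt x}\<rangle>" using l(2)[OF False] span_eq_singleton by blast
    moreover have "y \<in> f X \<longleftrightarrow> \<langle>{y}\<rangle> \<subseteq> f X" for y
      using span_minimal[OF G_sub[OF f_in[OF X]], of "{y}"] span_base[of y "{y}"] by blast
    ultimately show ?thesis using pt_mem[OF False X] by simp
  qed
  have "f X = l ` X" if X: "X \<in> G" for X
  proof (intro equalityI subsetI)
    fix y assume y: "y \<in> f X"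
    obtain x where "y = l x" using bij by (meson bij_pointE)
    then show "y \<in> l ` X" using mem[OF X] y by blast
  qed (use mem[OF X] in blast)
  then show ?thesis using l(1) by blast
qed

end

section \<open>Conclusion for both kinds of Grassmannian\<close>

theorem theorem1:
  fixes scale :: "'k::division_ring \<Rightarrow> 'v::ab_group_add \<Rightarrow> 'v"
    and \<beta> :: "'c rel"
    and G :: "'v set set"
    and f :: "'v set \<Rightarrow> 'v set"
  assumes "left_vector_space scale"
    and "cinfinite (lvs_dim scale UNIV)"
    and "Card_order \<beta>" and "\<beta> \<le>o lvs_dim scale UNIV"
    and "G = grassmannian_dim scale \<beta> \<or> G = grassmannian_codim scale \<beta>"
    and "bij_betw f G G"
    and "\<And>A. is_apartment scale G A \<Longrightarrow> is_apartment scale G (f ` A)"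
    and "\<And>A. is_apartment scale G A \<Longrightarrow> is_apartment scale G (inv_into G f ` A)"
  shows "\<exists>l. semilinear_automorphism scale l \<and> (\<forall>X\<in>G. f X = l ` X)"
proof -
  interpret left_vector_space scale by (rule assms(1))
  let ?\<alpha> = "lvs_dim scale UNIV"
  \<comment> \<open>This serves \<beta> = 0, encoded by an empty field, where \<open>G\<close> can
    contain only the zero space or only the whole space.\<close>
  have trivial: ?thesis if "\<And>X Y. X \<in> G \<Longrightarrow> Y \<in> G \<Longrightarrow> X = Y"
  proof -
    have "f X = (\<lambda>x. x) ` X" if "X \<in> G" for X
      using that \<open>\<And>X Y. X \<in> G \<Longrightarrow> Y \<in> G \<Longrightarrow> X = Y\<close> bij_betw_apply[OF assms(6)] by simp
    then show ?thesis using identity_semilinear by blast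
  qed
  have ne: "Field ?\<alpha> \<noteq> {}" using assms(2) by (auto simp: cinfinite_def)
  have le: "\<beta> \<le>o |B|" and iso: "|B| =o ?\<alpha>" if "lvs_basis scale B" for B
    using ordLeq_ordIso_trans[OF assms(4) ordIso_symmetric] lvs_dim_basis[OF that] by blast+
  have ap: "\<exists>C. lvs_basis scale C \<and> f ` apartment_of scale G B = apartment_of scale G C"
    and ap_inv: "\<exists>C. lvs_basis scale C \<and> inv_into G f ` apartment_of scale G B = apartment_of scale G C"
    if "lvs_basis scale B" for B
    using that assms(7,8)[of "apartment_of scale G B"] unfolding is_apartment_def by blast+
  show ?thesis
  proof (cases "Field \<beta> = {}")
    case True
    note empty = Field_empty_card_of[OF True]
    have one: "X = (if G = grassmannian_dim scale \<beta> then {0} else UNIV)" if X: "X \<in> G" for X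
    proof -
      have "lvs_subspace scale X" using X assms(5) by (auto simp: grassmannian_dim_def grassmannian_codim_def)
      then obtain S B where S: "S \<subseteq> B" "lvs_basis scale B" "X = \<langle>S\<rangle>"
          and c: "lvs_dim scale X =o |S|" "lvs_codim scale X =o |B - S|"
        by (rule adapted_basis)
      show ?thesis
      proof (cases "G = grassmannian_dim scale \<beta>")
        case True
        then have "|S| =o \<beta>" using X c(1) ordIso_transitive[OF ordIso_symmetric] by (auto simp: grassmannian_dim_def)
        then have "S = {}" by (rule empty)
        then show ?thesis using S True by simp
      next
        case False
        then have "|B - S| =o \<beta>" using X c(2) assms(5) ordIso_transitive[OF ordIso_symmetric]
          by (auto simp: grassmannian_codim_def)
        then have "B - S = {}" by (rule empty)
        then have "S = B" using S(1) by auto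
        then show ?thesis using basisD(2)[OF S(2)] S(3) False by simp
      qed
    qed
    show ?thesis by (rule trivial) (metis one)
  next
    case \<beta>: False
    from assms(5) show ?thesis
    proof
      assume G: "G = grassmannian_dim scale \<beta>"
      \<comment> \<open>Dimension and codimension are \<beta> and \<alpha> here; in the other case
        their roles are interchanged.\<close>
      interpret gr: grassmannian scale \<beta> ?\<alpha>
        by unfold_locales (use cinfinite_dim_imp_infinite_basis[OF assms(2)] assms(3) Card_order_lvs_dim \<beta> ne le iso in blast)+
      have eq: "gr.G = G" by (simp add: gr.G_def G grassmannian_dim_def)
      interpret apartment_map scale \<beta> ?\<alpha> f
        by unfold_locales (simp_all add: eq assms(6) ap ap_inv)
      show ?thesis using induced_by_semilinear by (simp add: eq)
    next
      assume G: "G = grassmannian_codim scale \<beta>"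
      interpret gr: grassmannian scale ?\<alpha> \<beta>
        by unfold_locales (use cinfinite_dim_imp_infinite_basis[OF assms(2)] assms(3) Card_order_lvs_dim \<beta> ne le iso in blast)+
      have eq: "gr.G = G" by (simp add: gr.G_def G grassmannian_codim_def)
      interpret apartment_map scale ?\<alpha> \<beta> f
        by unfold_locales (simp_all add: eq assms(6) ap ap_inv)
      show ?thesis using induced_by_semilinear by (simp add: eq)
    qed
  qed
qed

end
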